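(* Let $M$ be a fixed closed, connected, oriented Riemannian manifold of dimension $n\ge2$. Let $\mu_j$ be Borel probability measures on $M$ converging weakly to a probability measure $\nu$, and let $G_j$ be elliptic structures on $M$ with a common ellipticity bound $\Lambda$. If there is a point $x\in M$ with $$0<\nu(\{x\})<1,$$ then $A_{G_j}(\mu_j)\to\infty$ as $j\to\infty$.
   Context: $m=\mathrm{vol}_M/\mathrm{vol}_M(M)$ is normalized volume. A bounded elliptic structure $G$ is a measurable field of positive definite symmetric endomorphisms of $TM$ with determinant one, such that for some $\Lambda\ge1$ (its ellipticity bound) $\Lambda^{-1}|\xi|\le|\xi|_G\le\Lambda|\xi|$ for covectors almost everywhere, where $|\cdot|_G$ is the covector norm dual to the metric $\langle Gv,w\rangle$ (extended as a Hilbert norm to complex covectors). Put $E_G(v)=\left(\int_M|\mathrm dv|_G^n\,\mathrm dm\right)^{1/n}$ and $\mathcal D=C(M)\cap W^{1,n}(M)$ (complex-valued functions). For a Borel probability measure $\nu$ on $M$, with $\nu(v)=\int v\,\mathrm d\nu$, $$A_G(\nu)=\sup_{v\in\mathcal D,\ E_G(v)>0}\frac{\|v-\nu(v)\|_{L^1(\nu)}}{E_G(v)}\in[0,\infty].$$ *)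

theory Defs
  imports "HOL-Probability.Probability"
begin

section \<open>Smooth maps\<close>

text \<open>\<open>C\<^sup>k\<close> and \<open>C\<^sup>\<infinity>\<close> maps on an open set \<open>S\<close>, through iterated directional derivatives.\<close>

primrec Ck_on :: "nat \<Rightarrow> ('a::euclidean_space \<Rightarrow> 'b::real_normed_vector) \<Rightarrow> 'a set \<Rightarrow> bool" where
  "Ck_on 0 f S \<longleftrightarrow> continuous_on S f"
| "Ck_on (Suc k) f S \<longleftrightarrow>
     (\<forall>x\<in>S. f differentiable (at x)) \<and> (\<forall>u. Ck_on k (\<lambda>x. frechet_derivative f (at x) u) S)"

definition smooth_on :: "'a set \<Rightarrow> ('a::euclidean_space \<Rightarrow> 'b::real_normed_vector) \<Rightarrow> bool" where
  "smooth_on S f \<longleftrightarrow> (\<forall>k. Ck_on k f S)"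

section \<open>Closed connected oriented Riemannian manifolds\<close>

text \<open>
  The manifold \<open>M\<close> is the whole type \<open>'m\<close>, and its dimension is \<open>CARD('n)\<close>. A chart is a pair of
  its domain and its coordinate map; the values of the map outside the domain are irrelevant.
\<close>

type_synonym ('m, 'n) chart = "'m set \<times> ('m \<Rightarrow> real ^ 'n)"

definition chart_inv :: "('m, 'n::finite) chart \<Rightarrow> real ^ 'n \<Rightarrow> 'm" where
  "chart_inv c = inv_into (fst c) (snd c)"

definition transition_jacobian ::
    "('m, 'n::finite) chart \<Rightarrow> ('m, 'n) chart \<Rightarrow> 'm \<Rightarrow> real ^ 'n ^ 'n" where
  "transition_jacobian c c' p = jacobian (snd c' \<circ> chart_inv c) (at (snd c p))"

definition oriented_smooth_atlas ::
    "('m::{t2_space, second_countable_topology}, 'n::finite) chart set \<Rightarrow> bool" where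
  "oriented_smooth_atlas A \<longleftrightarrow>
     (\<Union>c\<in>A. fst c) = UNIV \<and>
     (\<forall>c\<in>A. open (fst c) \<and> open (snd c ` fst c) \<and>
        homeomorphism (fst c) (snd c ` fst c) (snd c) (chart_inv c)) \<and>
     (\<forall>c\<in>A. \<forall>c'\<in>A. smooth_on (snd c ` (fst c \<inter> fst c')) (snd c' \<circ> chart_inv c)) \<and>
     (\<forall>c\<in>A. \<forall>c'\<in>A. \<forall>p\<in>fst c \<inter> fst c'. det (transition_jacobian c c' p) > 0)"

text \<open>
  A tensor field is represented by its components: \<open>T c p\<close> are the components at \<open>p\<close> in the
  chart \<open>c\<close> of the atlas (meaningful only for \<open>p \<in> fst c\<close>), subject to the transformation law of
  the respective kind of tensor. The three kinds below are covariant 2-tensors, endomorphisms of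
  \<open>TM\<close>, and complex covectors.
\<close>

definition two_tensor_field ::
    "('m, 'n::finite) chart set \<Rightarrow> (('m, 'n) chart \<Rightarrow> 'm \<Rightarrow> real ^ 'n ^ 'n) \<Rightarrow> bool" where
  "two_tensor_field A g \<longleftrightarrow> (\<forall>c\<in>A. \<forall>c'\<in>A. \<forall>p\<in>fst c \<inter> fst c'.
     g c p = transpose (transition_jacobian c c' p) ** g c' p ** transition_jacobian c c' p)"

definition endomorphism_field ::
    "('m, 'n::finite) chart set \<Rightarrow> (('m, 'n) chart \<Rightarrow> 'm \<Rightarrow> real ^ 'n ^ 'n) \<Rightarrow> bool" where
  "endomorphism_field A G \<longleftrightarrow> (\<forall>c\<in>A. \<forall>c'\<in>A. \<forall>p\<in>fst c \<inter> fst c'.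
     G c' p ** transition_jacobian c c' p = transition_jacobian c c' p ** G c p)"

definition covector_field ::
    "('m, 'n::finite) chart set \<Rightarrow> (('m, 'n) chart \<Rightarrow> 'm \<Rightarrow> complex ^ 'n) \<Rightarrow> bool" where
  "covector_field A \<omega> \<longleftrightarrow> (\<forall>c\<in>A. \<forall>c'\<in>A. \<forall>p\<in>fst c \<inter> fst c'. \<forall>i.
     \<omega> c p $ i = (\<Sum>k\<in>UNIV. complex_of_real (transition_jacobian c c' p $ k $ i) * \<omega> c' p $ k))"

text \<open>The inner product of two tangent vectors given by their components in the chart \<open>c\<close>.\<close>

definition metric_inner ::
    "(('m, 'n::finite) chart \<Rightarrow> 'm \<Rightarrow> real ^ 'n ^ 'n) \<Rightarrow> ('m, 'n) chart \<Rightarrow> 'm \<Rightarrow>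
     real ^ 'n \<Rightarrow> real ^ 'n \<Rightarrow> real" where
  "metric_inner g c p u w = u \<bullet> (g c p *v w)"

definition riemannian_metric ::
    "('m, 'n::finite) chart set \<Rightarrow> (('m, 'n) chart \<Rightarrow> 'm \<Rightarrow> real ^ 'n ^ 'n) \<Rightarrow> bool" where
  "riemannian_metric A g \<longleftrightarrow>
     two_tensor_field A g \<and>
     (\<forall>c\<in>A. smooth_on (snd c ` fst c) (\<lambda>x. g c (chart_inv c x))) \<and>
     (\<forall>c\<in>A. \<forall>p\<in>fst c.
        (\<forall>u w. metric_inner g c p u w = metric_inner g c p w u) \<and>
        (\<forall>u. u \<noteq> 0 \<longrightarrow> metric_inner g c p u u > 0))"

definition closed_connected_oriented_riemannian_manifold ::
    "('m::{t2_space, second_countable_topology}, 'n::finite) chart set \<Rightarrow>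
     (('m, 'n) chart \<Rightarrow> 'm \<Rightarrow> real ^ 'n ^ 'n) \<Rightarrow> bool" where
  "closed_connected_oriented_riemannian_manifold A g \<longleftrightarrow>
     compact (UNIV :: 'm set) \<and> connected (UNIV :: 'm set) \<and>
     oriented_smooth_atlas A \<and> riemannian_metric A g"

text \<open>
  The Riemannian volume: the (unique) Borel measure that is \<open>\<surd>(det g) dx\<close> in every chart.
\<close>

definition riemannian_volume ::
    "('m::topological_space, 'n::finite) chart set \<Rightarrow>
     (('m, 'n) chart \<Rightarrow> 'm \<Rightarrow> real ^ 'n ^ 'n) \<Rightarrow> 'm measure \<Rightarrow> bool" where
  "riemannian_volume A g vol \<longleftrightarrow>
     sets vol = sets borel \<and>
     (\<forall>c\<in>A. \<forall>S\<in>sets borel. S \<subseteq> fst c \<longrightarrow>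
        emeasure vol S =
          (\<integral>\<^sup>+x\<in>snd c ` S. ennreal (sqrt (det (g c (chart_inv c x)))) \<partial>lborel))"

definition normalized_volume :: "'m measure \<Rightarrow> 'm measure" where
  "normalized_volume vol = uniform_measure vol (space vol)"

section \<open>Elliptic structures and covector norms\<close>

text \<open>Norm on covectors dual to the norm of an inner product \<open>B\<close>, and its Hilbert extension.\<close>

definition dual_norm :: "(real ^ 'n \<Rightarrow> real ^ 'n \<Rightarrow> real) \<Rightarrow> real ^ 'n::finite \<Rightarrow> real" where
  "dual_norm B \<xi> = Sup {\<xi> \<bullet> u | u. B u u \<le> 1}"

definition complex_dual_norm :: "(real ^ 'n \<Rightarrow> real ^ 'n \<Rightarrow> real) \<Rightarrow> complex ^ 'n::finite \<Rightarrow> real" where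
  "complex_dual_norm B \<zeta> =
     sqrt ((dual_norm B (\<chi> i. Re (\<zeta> $ i)))\<^sup>2 + (dual_norm B (\<chi> i. Im (\<zeta> $ i)))\<^sup>2)"

text \<open>The inner product \<open>\<langle>G u, w\<rangle>\<close>.\<close>

definition elliptic_inner ::
    "(('m, 'n::finite) chart \<Rightarrow> 'm \<Rightarrow> real ^ 'n ^ 'n) \<Rightarrow> (('m, 'n) chart \<Rightarrow> 'm \<Rightarrow> real ^ 'n ^ 'n) \<Rightarrow>
     ('m, 'n) chart \<Rightarrow> 'm \<Rightarrow> real ^ 'n \<Rightarrow> real ^ 'n \<Rightarrow> real" where
  "elliptic_inner g G c p u w = metric_inner g c p (G c p *v u) w"

text \<open>Measurability is with respect to the completed volume, i.e. Lebesgue measurability.\<close>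

definition elliptic_field ::
    "('m::topological_space, 'n::finite) chart set \<Rightarrow>
     (('m, 'n) chart \<Rightarrow> 'm \<Rightarrow> real ^ 'n ^ 'n) \<Rightarrow> 'm measure \<Rightarrow>
     (('m, 'n) chart \<Rightarrow> 'm \<Rightarrow> real ^ 'n ^ 'n) \<Rightarrow> bool" where
  "elliptic_field A g vol G \<longleftrightarrow>
     endomorphism_field A G \<and>
     (\<forall>c\<in>A. G c \<in> borel_measurable (restrict_space (completion vol) (fst c))) \<and>
     (\<forall>c\<in>A. \<forall>p\<in>fst c.
        (\<forall>u w. metric_inner g c p (G c p *v u) w = metric_inner g c p u (G c p *v w)) \<and>
        (\<forall>u. u \<noteq> 0 \<longrightarrow> metric_inner g c p (G c p *v u) u > 0) \<and>
        det (G c p) = 1)"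

definition ellipticity_bound ::
    "('m, 'n::finite) chart set \<Rightarrow> (('m, 'n) chart \<Rightarrow> 'm \<Rightarrow> real ^ 'n ^ 'n) \<Rightarrow> 'm measure \<Rightarrow>
     real \<Rightarrow> (('m, 'n) chart \<Rightarrow> 'm \<Rightarrow> real ^ 'n ^ 'n) \<Rightarrow> bool" where
  "ellipticity_bound A g vol \<Lambda> G \<longleftrightarrow>
     \<Lambda> \<ge> 1 \<and>
     (AE p in vol. \<forall>c\<in>A. p \<in> fst c \<longrightarrow> (\<forall>\<xi>.
        inverse \<Lambda> * dual_norm (metric_inner g c p) \<xi> \<le> dual_norm (elliptic_inner g G c p) \<xi> \<and>
        dual_norm (elliptic_inner g G c p) \<xi> \<le> \<Lambda> * dual_norm (metric_inner g c p) \<xi>))"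

definition bounded_elliptic_structure ::
    "('m::topological_space, 'n::finite) chart set \<Rightarrow>
     (('m, 'n) chart \<Rightarrow> 'm \<Rightarrow> real ^ 'n ^ 'n) \<Rightarrow> 'm measure \<Rightarrow> real \<Rightarrow>
     (('m, 'n) chart \<Rightarrow> 'm \<Rightarrow> real ^ 'n ^ 'n) \<Rightarrow> bool" where
  "bounded_elliptic_structure A g vol \<Lambda> G \<longleftrightarrow>
     elliptic_field A g vol G \<and> ellipticity_bound A g vol \<Lambda> G"

text \<open>
  The pointwise norms \<open>|\<omega>|\<close> and \<open>|\<omega>|\<^sub>G\<close> of a covector field are independent of the chart used to
  compute them, by the transformation laws.
\<close>

definition chart_at :: "('m, 'n) chart set \<Rightarrow> 'm \<Rightarrow> ('m, 'n) chart" where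
  "chart_at A p = (SOME c. c \<in> A \<and> p \<in> fst c)"

definition covector_norm ::
    "('m, 'n::finite) chart set \<Rightarrow> (('m, 'n) chart \<Rightarrow> 'm \<Rightarrow> real ^ 'n ^ 'n) \<Rightarrow>
     (('m, 'n) chart \<Rightarrow> 'm \<Rightarrow> complex ^ 'n) \<Rightarrow> 'm \<Rightarrow> real" where
  "covector_norm A g \<omega> p =
     complex_dual_norm (metric_inner g (chart_at A p) p) (\<omega> (chart_at A p) p)"

definition elliptic_covector_norm ::
    "('m, 'n::finite) chart set \<Rightarrow> (('m, 'n) chart \<Rightarrow> 'm \<Rightarrow> real ^ 'n ^ 'n) \<Rightarrow>
     (('m, 'n) chart \<Rightarrow> 'm \<Rightarrow> real ^ 'n ^ 'n) \<Rightarrow>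
     (('m, 'n) chart \<Rightarrow> 'm \<Rightarrow> complex ^ 'n) \<Rightarrow> 'm \<Rightarrow> real" where
  "elliptic_covector_norm A g G \<omega> p =
     complex_dual_norm (elliptic_inner g G (chart_at A p) p) (\<omega> (chart_at A p) p)"

section \<open>Sobolev functions and energy\<close>

definition test_function :: "(real ^ 'n::finite) set \<Rightarrow> (real ^ 'n \<Rightarrow> real) \<Rightarrow> bool" where
  "test_function V \<eta> \<longleftrightarrow>
     smooth_on UNIV \<eta> \<and> compact (closure {x. \<eta> x \<noteq> 0}) \<and> closure {x. \<eta> x \<noteq> 0} \<subseteq> V"

definition weak_gradient_on ::
    "(real ^ 'n::finite) set \<Rightarrow> (real ^ 'n \<Rightarrow> complex) \<Rightarrow> (real ^ 'n \<Rightarrow> complex ^ 'n) \<Rightarrow> bool" where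
  "weak_gradient_on V f F \<longleftrightarrow>
     (\<forall>K. compact K \<and> K \<subseteq> V \<longrightarrow> set_integrable lebesgue K f \<and> set_integrable lebesgue K F) \<and>
     (\<forall>\<eta> i. test_function V \<eta> \<longrightarrow>
        (LINT x:V|lebesgue. complex_of_real (frechet_derivative \<eta> (at x) (axis i 1)) * f x) =
        - (LINT x:V|lebesgue. complex_of_real (\<eta> x) * F x $ i))"

definition weak_differential ::
    "('m, 'n::finite) chart set \<Rightarrow> ('m \<Rightarrow> complex) \<Rightarrow>
     (('m, 'n) chart \<Rightarrow> 'm \<Rightarrow> complex ^ 'n) \<Rightarrow> bool" where
  "weak_differential A v \<omega> \<longleftrightarrow>
     covector_field A \<omega> \<and>
     (\<forall>c\<in>A. weak_gradient_on (snd c ` fst c) (\<lambda>x. v (chart_inv c x)) (\<lambda>x. \<omega> c (chart_inv c x)))"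

text \<open>The weak differential is unique up to a null set whenever it exists.\<close>

definition weak_d ::
    "('m, 'n::finite) chart set \<Rightarrow> ('m \<Rightarrow> complex) \<Rightarrow> ('m, 'n) chart \<Rightarrow> 'm \<Rightarrow> complex ^ 'n" where
  "weak_d A v = (SOME \<omega>. weak_differential A v \<omega>)"

definition sobolev_W1n ::
    "('m::topological_space, 'n::finite) chart set \<Rightarrow>
     (('m, 'n) chart \<Rightarrow> 'm \<Rightarrow> real ^ 'n ^ 'n) \<Rightarrow> 'm measure \<Rightarrow> ('m \<Rightarrow> complex) set" where
  "sobolev_W1n A g vol = {v.
     v \<in> borel_measurable (completion vol) \<and>
     (\<integral>\<^sup>+p. ennreal (norm (v p) ^ CARD('n)) \<partial>vol) < \<infinity> \<and>
     (\<exists>\<omega>. weak_differential A v \<omega>) \<and>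
     (\<integral>\<^sup>+p. ennreal (covector_norm A g (weak_d A v) p ^ CARD('n)) \<partial>vol) < \<infinity>}"

definition energy_space ::
    "('m::topological_space, 'n::finite) chart set \<Rightarrow>
     (('m, 'n) chart \<Rightarrow> 'm \<Rightarrow> real ^ 'n ^ 'n) \<Rightarrow> 'm measure \<Rightarrow> ('m \<Rightarrow> complex) set" where
  "energy_space A g vol = {v. continuous_on UNIV v} \<inter> sobolev_W1n A g vol"

text \<open>
  The integral is finite on \<open>W\<^sup>1\<^sup>,\<^sup>n\<close> for a bounded elliptic structure. It is a nonnegative integral
  because this is insensitive to completing the measure, so that Lebesgue measurable integrands
  are integrated correctly.
\<close>

definition energy ::
    "('m::topological_space, 'n::finite) chart set \<Rightarrow>
     (('m, 'n) chart \<Rightarrow> 'm \<Rightarrow> real ^ 'n ^ 'n) \<Rightarrow> 'm measure \<Rightarrow>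
     (('m, 'n) chart \<Rightarrow> 'm \<Rightarrow> real ^ 'n ^ 'n) \<Rightarrow> ('m \<Rightarrow> complex) \<Rightarrow> real" where
  "energy A g vol G v =
     enn2real (\<integral>\<^sup>+p. ennreal (elliptic_covector_norm A g G (weak_d A v) p ^ CARD('n))
       \<partial>normalized_volume vol) powr (1 / real CARD('n))"

definition A_const ::
    "('m::topological_space, 'n::finite) chart set \<Rightarrow>
     (('m, 'n) chart \<Rightarrow> 'm \<Rightarrow> real ^ 'n ^ 'n) \<Rightarrow> 'm measure \<Rightarrow>
     (('m, 'n) chart \<Rightarrow> 'm \<Rightarrow> real ^ 'n ^ 'n) \<Rightarrow> 'm measure \<Rightarrow> ennreal" where
  "A_const A g vol G \<nu> =
     (SUP v\<in>{v \<in> energy_space A g vol. energy A g vol G v > 0}.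
        ennreal ((LINT p|\<nu>. norm (v p - (LINT q|\<nu>. v q))) / energy A g vol G v))"

section \<open>Borel probability measures\<close>

definition borel_prob :: "'m::topological_space measure \<Rightarrow> bool" where
  "borel_prob \<nu> \<longleftrightarrow> prob_space \<nu> \<and> sets \<nu> = sets borel"

definition weakly_converges ::
    "(nat \<Rightarrow> 'm::topological_space measure) \<Rightarrow> 'm measure \<Rightarrow> bool" where
  "weakly_converges \<mu> \<nu> \<longleftrightarrow>
     (\<forall>f :: 'm \<Rightarrow> real. continuous_on UNIV f \<and> bounded (range f) \<longrightarrow>
        (\<lambda>j. LINT p|\<mu> j. f p) \<longlonglongrightarrow> (LINT p|\<nu>. f p))"

end

theory Submission
  imports Defs
begin

text \<open>
  The idea is that a point of a manifold of dimension \<open>n \<ge> 2\<close> has zero \<open>n\<close>-capacity, so an atom of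
  \<open>\<nu>\<close> is detected by continuous functions of arbitrarily small energy.

  Let \<open>x\<close> be an atom of mass \<open>\<alpha>\<close> with \<open>0 < \<alpha> < 1\<close>, and suppose that functions \<open>w\<^sub>N : M \<rightarrow> [0,1]\<close> are
  continuous, tend pointwise to the indicator of \<open>x\<close>, and satisfy \<open>E\<^sub>G(w\<^sub>N) \<le> \<epsilon>\<^sub>N \<rightarrow> 0\<close> uniformly over all
  elliptic structures \<open>G\<close> with bound \<open>\<Lambda>\<close>. By dominated convergence the oscillation
  \<open>\<parallel>w\<^sub>N - \<nu>(w\<^sub>N)\<parallel>\<close> in \<open>L\<^sup>1(\<nu>)\<close> tends to \<open>2 \<alpha> (1 - \<alpha>) > 0\<close> (\<open>oscillation_atom_limit\<close>). For one fixed
  continuous function, the oscillation is continuous under weak convergence of the measure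
  (\<open>oscillation_tendsto\<close>). So, fixing \<open>N\<close> with \<open>\<epsilon>\<^sub>N\<close> small, for all large \<open>j\<close> the quotient that defines the
  constant of \<open>\<mu>\<^sub>j\<close> and \<open>G\<^sub>j\<close> is at least \<open>\<alpha> (1 - \<alpha>) / \<epsilon>\<^sub>N\<close> at \<open>w\<^sub>N\<close>, which is as large as desired.

  For \<open>w\<^sub>N\<close> one takes, in a chart centred at \<open>x\<close>, the average of \<open>N\<close> copies \<open>y \<mapsto> \<phi>(2\<^sup>k y)\<close>, \<open>k < N\<close>, of
  a \<open>C\<^sup>1\<close> radial bump \<open>\<phi>\<close> that is \<open>1\<close> on the ball of radius \<open>1/2\<close> and \<open>0\<close> outside the unit ball: a
  discretized logarithmic cutoff. The gradients of the copies live on disjoint annuli, and all copies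
  have the same \<open>n\<close>-energy, since that is invariant under scaling. Hence the \<open>n\<close>-th power of the
  energy of the average is at most \<open>const \<cdot> N / N\<^sup>n \<le> const / N\<close> (\<open>norm_cascade_grad_le\<close>,
  \<open>cascade_energy_sum\<close>). Ellipticity and compactness of a coordinate ball make the passage from the
  Euclidean energy to \<open>E\<^sub>G\<close> cost only a factor that depends on \<open>\<Lambda>\<close>, the metric and the ball
  (\<open>energy_integral_le\<close>). Only functions with \<open>E\<^sub>G > 0\<close> compete in the supremum; positivity holds
  because the gradient of \<open>w\<^sub>N\<close> is nonzero on an open set (\<open>energy_integral_pos\<close>).

  The energy is defined through an arbitrary choice of weak differential. To compute it one needs that
  the classical differential of a \<open>C\<^sup>1\<close> function is a weak one (\<open>weak_gradient_on_C1\<close>), and that weak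
  differentials are unique almost everywhere (\<open>weak_gradient_on_unique\<close>). The latter is the
  fundamental lemma of the calculus of variations, for which smooth bumps on boxes are constructed.
\<close>

section \<open>Smooth bumps\<close>

lemma Ck_on_Suc_imp: "Ck_on (Suc k) f S \<Longrightarrow> Ck_on k f S"
proof (induction k arbitrary: f)
  case 0
  then have "\<forall>x\<in>S. isCont f x"
    by (auto intro: differentiable_imp_continuous_within)
  then show ?case by (simp add: continuous_at_imp_continuous_on)
next
  case (Suc k)
  then show ?case by auto
qed

lemma Ck_on_const: "Ck_on k (\<lambda>x. c) S"
  by (induction k arbitrary: c) auto

lemma Ck_on_add:
  "Ck_on k f UNIV \<Longrightarrow> Ck_on k g UNIV \<Longrightarrow> Ck_on k (\<lambda>x. f x + g x) UNIV"
proof (induction k arbitrary: f g)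
  case 0
  then show ?case by (auto intro: continuous_intros)
next
  case (Suc k)
  have "(\<lambda>x. frechet_derivative (\<lambda>x. f x + g x) (at x) u) =
    (\<lambda>x. frechet_derivative f (at x) u + frechet_derivative g (at x) u)" for u
  proof
    fix x
    have "((\<lambda>x. f x + g x) has_derivative
        (\<lambda>h. frechet_derivative f (at x) h + frechet_derivative g (at x) h)) (at x)"
      using Suc.prems by (intro has_derivative_add) (auto simp: frechet_derivative_works)
    from frechet_derivative_at[OF this]
    show "frechet_derivative (\<lambda>x. f x + g x) (at x) u =
        frechet_derivative f (at x) u + frechet_derivative g (at x) u" by metis
  qed
  then show ?case using Suc by simp
qed

lemma Ck_on_mult:
  fixes f g :: "'a::euclidean_space \<Rightarrow> real"
  shows "Ck_on k f UNIV \<Longrightarrow> Ck_on k g UNIV \<Longrightarrow> Ck_on k (\<lambda>x. f x * g x) UNIV"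
proof (induction k arbitrary: f g)
  case 0
  then show ?case by (auto intro: continuous_intros)
next
  case (Suc k)
  have d: "f differentiable (at x)" "g differentiable (at x)" for x
    using Suc.prems by auto
  have "frechet_derivative (\<lambda>x. f x * g x) (at x) u =
      f x * frechet_derivative g (at x) u + frechet_derivative f (at x) u * g x" for x u
  proof -
    have "((\<lambda>x. f x * g x) has_derivative
        (\<lambda>h. f x * frechet_derivative g (at x) h + frechet_derivative f (at x) h * g x)) (at x)"
      using d by (intro has_derivative_mult) (auto simp: frechet_derivative_works)
    from frechet_derivative_at[OF this] show ?thesis by metis
  qed
  moreover have "Ck_on k f UNIV" "Ck_on k g UNIV"
    using Suc.prems Ck_on_Suc_imp by blast+
  ultimately show ?case
    using Suc d by (auto intro!: Ck_on_add)
qed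

lemma Ck_on_prod:
  fixes f :: "'i \<Rightarrow> 'a::euclidean_space \<Rightarrow> real"
  assumes "\<And>i. i \<in> I \<Longrightarrow> Ck_on k (f i) UNIV"
  shows "Ck_on k (\<lambda>x. \<Prod>i\<in>I. f i x) UNIV"
  using assms by (induction I rule: infinite_finite_induct) (auto intro: Ck_on_const Ck_on_mult)

lemma Ck_on_affine:
  fixes \<phi> :: "real \<Rightarrow> real" and e :: "'a::euclidean_space"
  shows "Ck_on k \<phi> UNIV \<Longrightarrow> Ck_on k (\<lambda>x. \<phi> (x \<bullet> e + d)) UNIV"
proof (induction k arbitrary: \<phi>)
  case 0
  have "continuous_on UNIV (\<phi> \<circ> (\<lambda>x. x \<bullet> e + d))"
    using 0 by (intro continuous_on_compose continuous_intros)
       (auto intro: continuous_on_subset)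
  then show ?case by (simp add: o_def)
next
  case (Suc k)
  have d: "((\<lambda>x. \<phi> (x \<bullet> e + d)) has_derivative
      (\<lambda>h. frechet_derivative \<phi> (at (x \<bullet> e + d)) (h \<bullet> e))) (at x)" for x :: 'a
  proof -
    have "((\<lambda>x. x \<bullet> e + d) has_derivative (\<lambda>h. h \<bullet> e)) (at x)"
      by (auto intro!: derivative_eq_intros)
    moreover have "(\<phi> has_derivative frechet_derivative \<phi> (at (x \<bullet> e + d))) (at (x \<bullet> e + d))"
      using Suc.prems by (auto simp: frechet_derivative_works)
    ultimately show ?thesis
      using diff_chain_at by (fastforce simp: o_def)
  qed
  have "frechet_derivative (\<lambda>x. \<phi> (x \<bullet> e + d)) (at x) u =
     frechet_derivative \<phi> (at (x \<bullet> e + d)) (u \<bullet> e)" for x u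
    using frechet_derivative_at[OF d] by metis
  moreover have "(\<lambda>x. \<phi> (x \<bullet> e + d)) differentiable (at x)" for x
    using d differentiable_def by blast
  moreover have "Ck_on k (\<lambda>x. frechet_derivative \<phi> (at (x \<bullet> e + d)) (u \<bullet> e)) UNIV" for u :: 'a
    using Suc.prems by (intro Suc.IH) simp
  ultimately show ?case by simp
qed

text \<open>
  The linear span of this family is closed under differentiation, which makes smoothness of the member
  \<open>m = 0\<close>, from which the bumps are built, an induction on the order of differentiability.
\<close>

definition flat_exp :: "nat \<Rightarrow> real \<Rightarrow> real" where
  "flat_exp m t = (if t \<le> 0 then 0 else (1 / t) ^ m * exp (- (1 / t)))"

lemma flat_exp_tendsto_0: "((\<lambda>t. flat_exp m t) \<longlongrightarrow> 0) (at_right 0)"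
proof -
  have "((\<lambda>s::real. s ^ m / exp s) \<longlongrightarrow> 0) at_top"
    by (rule tendsto_power_div_exp_0)
  then have "((\<lambda>t::real. (inverse t) ^ m / exp (inverse t)) \<longlongrightarrow> 0) (at_right 0)"
    by (rule filterlim_compose[OF _ filterlim_inverse_at_top_right])
  then show ?thesis
  proof (rule Lim_transform_eventually)
    show "eventually (\<lambda>t. inverse t ^ m / exp (inverse t) = flat_exp m t) (at_right 0)"
      by (auto simp: eventually_at_filter flat_exp_def exp_minus divide_simps)
  qed
qed

lemma flat_exp_has_derivative:
  "(flat_exp m has_real_derivative flat_exp (m + 2) t - real m * flat_exp (m + 1) t) (at t)"
proof (cases t "0::real" rule: linorder_cases)
  case less
  have "((\<lambda>_. 0) has_real_derivative 0) (at t)" by simp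
  then have "(flat_exp m has_real_derivative 0) (at t)"
    by (rule has_field_derivative_transform_within_open[of _ _ _ "{..<0}"])
       (use less in \<open>auto simp: flat_exp_def\<close>)
  then show ?thesis using less by (simp add: flat_exp_def)
next
  case greater
  have "((\<lambda>t. (1 / t) ^ m * exp (- (1 / t))) has_real_derivative
      flat_exp (m + 2) t - real m * flat_exp (m + 1) t) (at t)"
  proof (cases m)
    case 0
    then show ?thesis using greater
      by (auto intro!: derivative_eq_intros simp: flat_exp_def power2_eq_square)
  next
    case (Suc l)
    then show ?thesis using greater
      by (auto intro!: derivative_eq_intros simp: flat_exp_def power2_eq_square field_simps)
         (cases l; simp)
  qed
  then show ?thesis
    by (rule has_field_derivative_transform_within_open[of _ _ _ "{0<..}"])
       (use greater in \<open>auto simp: flat_exp_def\<close>)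
next
  case equal
  have "((\<lambda>s. (flat_exp m s - flat_exp m 0) / (s - 0)) \<longlongrightarrow> 0) (at 0)"
  proof (rule filterlim_split_at)
    show "((\<lambda>s. (flat_exp m s - flat_exp m 0) / (s - 0)) \<longlongrightarrow> 0) (at_left 0)"
      by (rule Lim_transform_eventually[OF tendsto_const])
         (auto simp: eventually_at_filter flat_exp_def)
    show "((\<lambda>s. (flat_exp m s - flat_exp m 0) / (s - 0)) \<longlongrightarrow> 0) (at_right 0)"
      by (rule Lim_transform_eventually[OF flat_exp_tendsto_0[of "Suc m"]])
         (auto simp: eventually_at_filter flat_exp_def)
  qed
  then show ?thesis using equal
    by (simp add: has_field_derivative_iff flat_exp_def)
qed

lemma Ck_on_flat_exp: "Ck_on k (flat_exp m) UNIV"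
proof (induction k arbitrary: m)
  case 0
  have "isCont (flat_exp m) t" for t
    using flat_exp_has_derivative DERIV_isCont by blast
  then show ?case by (simp add: continuous_at_imp_continuous_on)
next
  case (Suc k)
  have d: "(flat_exp m has_derivative (\<lambda>h. (flat_exp (m + 2) t - real m * flat_exp (m + 1) t) * h)) (at t)" for t
    using flat_exp_has_derivative[of m t] by (simp add: has_field_derivative_def)
  have "frechet_derivative (flat_exp m) (at t) u =
      u * flat_exp (m + 2) t + (- u * real m) * flat_exp (m + 1) t" for t u
    using fun_cong[OF frechet_derivative_at[OF d], of t u] by (simp add: algebra_simps)
  then have "(\<lambda>t. frechet_derivative (flat_exp m) (at t) u) =
      (\<lambda>t. u * flat_exp (m + 2) t + (- u * real m) * flat_exp (m + 1) t)" for u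
    by (rule ext)
  moreover have "flat_exp m differentiable (at t)" for t
    using d differentiable_def by blast
  ultimately show ?case
    unfolding Ck_on.simps by (simp only: Ck_on_add Ck_on_mult Ck_on_const Suc.IH simp_thms, simp)
qed

text \<open>
  Smooth functions that are positive exactly on the open box between \<open>a\<close> and \<open>b\<close> and increase, as
  \<open>k\<close> grows, to its indicator.
\<close>

definition box_bump :: "real ^ 'n \<Rightarrow> real ^ 'n \<Rightarrow> nat \<Rightarrow> real ^ 'n::finite \<Rightarrow> real" where
  "box_bump a b k x =
     (\<Prod>i\<in>UNIV. flat_exp 0 (real (Suc k) * (x $ i - a $ i)) * flat_exp 0 (real (Suc k) * (b $ i - x $ i)))"

lemma flat_exp_0_bounds: "0 \<le> flat_exp 0 t" "flat_exp 0 t \<le> 1" "flat_exp 0 t = 0 \<longleftrightarrow> t \<le> 0"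
  by (auto simp: flat_exp_def)

lemma flat_exp_0_tendsto:
  "(\<lambda>k. flat_exp 0 (real (Suc k) * t)) \<longlonglongrightarrow> (if t \<le> 0 then 0 else 1)"
proof (cases "t \<le> 0")
  case True
  then show ?thesis by (simp add: flat_exp_def mult_nonneg_nonpos)
next
  case False
  have "(\<lambda>k. exp (- (inverse (real (Suc k)) * inverse t))) \<longlonglongrightarrow> exp (- (0 * inverse t))"
    by (intro tendsto_intros LIMSEQ_inverse_real_of_nat)
  then show ?thesis using False
    by (simp add: flat_exp_def mult_le_0_iff divide_inverse)
qed

lemma smooth_on_box_bump: "smooth_on UNIV (box_bump a b k)"
proof -
  have *: "Ck_on l (\<lambda>x :: real^'n. flat_exp 0 (c * x $ i + d)) UNIV" for l c d i
    using Ck_on_affine[OF Ck_on_flat_exp, of l 0 "axis i c" d]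
    by (simp add: inner_axis mult.commute)
  have "Ck_on l (\<lambda>x. flat_exp 0 (real (Suc k) * (x $ i - a $ i)) *
      flat_exp 0 (real (Suc k) * (b $ i - x $ i))) UNIV" for l i
    using Ck_on_mult[OF *[of l "real (Suc k)" i "- real (Suc k) * a $ i"]
        *[of l "- real (Suc k)" i "real (Suc k) * b $ i"]]
    by (simp add: algebra_simps)
  then show ?thesis
    unfolding smooth_on_def box_bump_def by (intro allI Ck_on_prod)
qed

lemma box_bump_bounds: "0 \<le> box_bump a b k x" "box_bump a b k x \<le> 1"
  unfolding box_bump_def
  by (intro prod_nonneg prod_le_1 ballI mult_nonneg_nonneg mult_le_one conjI flat_exp_0_bounds)+

lemma box_bump_nonzero: "{x. box_bump a b k x \<noteq> 0} = box a b"
  by (auto simp: box_bump_def flat_exp_0_bounds mem_box_cart mult_le_0_iff not_le)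

lemma box_bump_tendsto: "(\<lambda>k. box_bump a b k x) \<longlonglongrightarrow> indicator (box a b) x"
proof -
  have "(\<lambda>k. box_bump a b k x) \<longlonglongrightarrow> (\<Prod>i\<in>UNIV. (if x $ i - a $ i \<le> 0 then 0 else 1)
      * (if b $ i - x $ i \<le> 0 then 0 else 1))"
    unfolding box_bump_def by (intro tendsto_intros flat_exp_0_tendsto)
  also have "(\<Prod>i\<in>UNIV. (if x $ i - a $ i \<le> 0 then 0 else 1)
      * (if b $ i - x $ i \<le> 0 then 0 else 1)) = (indicator (box a b) x :: real)"
  proof (cases "x \<in> box a b")
    case True
    then show ?thesis by (auto simp: mem_box_cart not_le intro!: prod.neutral)
  next
    case False
    then obtain i where "x $ i \<le> a $ i \<or> b $ i \<le> x $ i"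
      by (auto simp: mem_box_cart not_less)
    then have "(\<Prod>i\<in>UNIV. (if x $ i - a $ i \<le> 0 then 0 else 1)
      * (if b $ i - x $ i \<le> 0 then 0 else (1::real))) = 0"
      by (intro prod_zero) (auto intro!: bexI[of _ i])
    with False show ?thesis by simp
  qed
  finally show ?thesis .
qed

lemma test_function_box_bump:
  assumes "box l u \<subseteq> cbox a b" "cbox a b \<subseteq> V"
  shows "test_function V (box_bump l u k)"
proof -
  have "closure (box l u) \<subseteq> cbox a b"
    using assms(1) by (simp add: closure_minimal closed_cbox)
  then show ?thesis
    using assms(2) unfolding test_function_def box_bump_nonzero
    by (auto simp: smooth_on_box_bump compact_closure bounded_box)
qed

section \<open>The fundamental lemma of the calculus of variations\<close>

lemma sigma_finite_completion_lborel: "sigma_finite_measure (completion lborel)"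
proof
  obtain \<A> :: "'a set set" where A: "countable \<A>" "\<A> \<subseteq> sets lborel" "\<Union>\<A> = space lborel"
      "\<forall>a\<in>\<A>. emeasure lborel a \<noteq> \<infinity>"
    using lborel.sigma_finite_countable by blast
  then show "\<exists>\<A> :: 'a set set. countable \<A> \<and> \<A> \<subseteq> sets lebesgue \<and> \<Union>\<A> = space lebesgue \<and>
      (\<forall>a\<in>\<A>. emeasure lebesgue a \<noteq> \<infinity>)"
    by (intro exI[of _ \<A>]) (auto simp: emeasure_completion)
qed

text \<open>
  Boxes are an intersection-stable generator of the Borel sets, so by Dynkin's argument the integral of
  \<open>F\<close> vanishes over every Borel set, hence over every Lebesgue set.
\<close>

lemma AE_zero_if_box_integrals_zero:
  fixes F :: "'a::euclidean_space \<Rightarrow> complex"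
  assumes F: "integrable lebesgue F"
    and box: "\<And>l u. (LINT x:box l u|lebesgue. F x) = 0"
  shows "AE x in lebesgue. F x = 0"
proof (rule sigma_finite_measure.density_zero[OF sigma_finite_completion_lborel F])
  have int: "set_integrable lebesgue X F" if "X \<in> sets lebesgue" for X
    using F that by (simp add: set_integrable_def integrable_mult_indicator)
  \<comment> \<open>The whole space is an increasing union of boxes; complements then reduce to it.\<close>
  have tot: "(LINT x|lebesgue. F x) = 0"
  proof -
    have "(\<lambda>k. LINT x:box (- (real k *\<^sub>R One)) (real k *\<^sub>R One)|lebesgue. F x)
        \<longlonglongrightarrow> (LINT x:(\<Union>k. box (- (real k *\<^sub>R One)) (real k *\<^sub>R One))|lebesgue. F x)"
    proof (rule set_integral_cont_up)
      show "incseq (\<lambda>k. box (- (real k *\<^sub>R One)) (real k *\<^sub>R One) :: 'a set)"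
        unfolding incseq_def by (intro allI impI subset_box_imp) auto
    qed (auto intro!: int)
    then have "(\<lambda>k::nat. 0) \<longlonglongrightarrow> (LINT x:UNIV|lebesgue. F x)"
      unfolding UN_box_eq_UNIV box .
    then show ?thesis
      by (simp add: LIMSEQ_const_iff set_lebesgue_integral_def)
  qed
  have borel: "(LINT x:X|lebesgue. F x) = 0" if "X \<in> sets borel" for X
  proof -
    have "Int_stable (range (\<lambda>(a, b). box a b :: 'a set))"
      by (auto simp: Int_stable_def box_Int_box)
    moreover have "range (\<lambda>(a, b). box a b :: 'a set) \<subseteq> Pow UNIV" by simp
    moreover have "X \<in> sigma_sets UNIV (range (\<lambda>(a, b). box a b :: 'a set))"
      using that by (simp add: borel_eq_box)
    ultimately show ?thesis
    proof (induction rule: sigma_sets_induct_disjoint)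
      case (basic A)
      then show ?case using box by auto
    next
      case empty
      then show ?case by (simp add: set_lebesgue_integral_def)
    next
      case (compl A)
      have "A \<in> sets borel" using compl(1) by (simp add: borel_eq_box)
      then have A: "A \<in> sets lebesgue" by simp
      have "(LINT x:UNIV - A|lebesgue. F x) + (LINT x:A|lebesgue. F x) =
          (LINT x:(UNIV - A) \<union> A|lebesgue. F x)"
        using A by (subst set_integral_Un) (auto intro!: int)
      also have "\<dots> = 0" using tot by (simp add: set_lebesgue_integral_def)
      finally show ?case using compl by simp
    next
      case (union A)
      have "A i \<in> sigma_sets UNIV (range (\<lambda>(a, b). box a b :: 'a set))" for i
        using union.hyps by blast
      then have "A i \<in> sets borel" for i by (simp add: borel_eq_box)
      then have A: "A i \<in> sets lebesgue" for i by simp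
      have "(LINT x:(\<Union>i. A i)|lebesgue. F x) = (\<Sum>i. (LINT x:A i|lebesgue. F x))"
      proof (rule lebesgue_integral_countable_add)
        show "A i \<inter> A j = {}" if "i \<noteq> j" for i j
          using union.hyps that by (metis disjoint_family_onD iso_tuple_UNIV_I)
        show "set_integrable lebesgue (\<Union>i. A i) F"
          by (rule int[OF sets.countable_UN]) (use A in blast)
      qed (rule A)
      then show ?case using union.IH by simp
    qed
  qed
  have Fm [measurable]: "F \<in> borel_measurable lebesgue"
    using F by (rule borel_measurable_integrable)
  fix X :: "'a set" assume X [measurable]: "X \<in> sets lebesgue"
  have "(LINT x:X|lebesgue. F x) = (LINT x:main_part lborel X|lebesgue. F x)"
    unfolding set_lebesgue_integral_def
  proof (rule integral_cong_AE)
    show "AE x in lebesgue. indicator X x *\<^sub>R F x = indicator (main_part lborel X) x *\<^sub>R F x"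
    proof -
      obtain N where N: "N \<in> null_sets lborel" "null_part lborel X \<subseteq> N"
        using null_part[OF X] by auto
      have "N \<in> null_sets lebesgue" using N(1) by (simp add: null_sets_completionI)
      then have "AE x in lebesgue. x \<notin> N" by (rule AE_not_in)
      then show ?thesis
      proof eventually_elim
        case (elim x)
        then have "x \<notin> null_part lborel X" using N by auto
        moreover have "main_part lborel X \<union> null_part lborel X = X"
          using X by (rule main_part_null_part_Un)
        ultimately have "x \<in> X \<longleftrightarrow> x \<in> main_part lborel X" by blast
        then show ?case by (simp add: indicator_def)
      qed
    qed
    show "(\<lambda>x. indicator X x *\<^sub>R F x) \<in> borel_measurable lebesgue"
      by (intro borel_measurable_scaleR borel_measurable_indicator X Fm)
    have "main_part lborel X \<in> sets lebesgue"
      using main_part_sets[OF X] by (rule sets_completionI_sets)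
    then show "(\<lambda>x. indicator (main_part lborel X) x *\<^sub>R F x) \<in> borel_measurable lebesgue"
      by (intro borel_measurable_scaleR borel_measurable_indicator Fm)
  qed
  also have "\<dots> = 0" using borel[of "main_part lborel X"] main_part_sets[OF X] by simp
  finally show "(LINT x:X|lebesgue. F x) = 0" .
qed

text \<open>
  Testing against the bumps of a box and letting them increase to the indicator of the box shows
  that the integral of \<open>F\<close> over each box inside \<open>V\<close> vanishes. As \<open>F\<close> is only locally integrable, the
  argument is carried out for the restriction of \<open>F\<close> to one closed box at a time; countably many of
  these exhaust \<open>V\<close>.
\<close>

lemma fundamental_lemma_calculus_of_variations:
  fixes V :: "(real ^ 'n::finite) set" and F :: "real ^ 'n \<Rightarrow> complex"
  assumes V: "open V"
    and loc: "\<And>K. compact K \<Longrightarrow> K \<subseteq> V \<Longrightarrow> set_integrable lebesgue K F"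
    and orth: "\<And>\<eta>. test_function V \<eta> \<Longrightarrow> (LINT x:V|lebesgue. complex_of_real (\<eta> x) * F x) = 0"
  shows "AE x in lebesgue. x \<in> V \<longrightarrow> F x = 0"
proof -
  have cb: "AE x in lebesgue. x \<in> cbox a b \<longrightarrow> F x = 0" if ab: "cbox a b \<subseteq> V" for a b
  proof -
    define F0 where "F0 x = indicator (cbox a b) x *\<^sub>R F x" for x
    have F0: "integrable lebesgue F0"
      using loc[OF compact_cbox ab] by (simp add: set_integrable_def F0_def[abs_def])
    have sub: "(LINT x:box l u|lebesgue. F0 x) = 0" if lu: "box l u \<subseteq> cbox a b" for l u
    proof -
      have "(\<lambda>k. LINT x|lebesgue. box_bump l u k x *\<^sub>R F0 x)
          \<longlonglongrightarrow> (LINT x|lebesgue. indicator (box l u) x *\<^sub>R F0 x)"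
      proof (rule integral_dominated_convergence[where w = "\<lambda>x. norm (F0 x)"])
        have "box_bump l u k \<in> borel_measurable borel" for k
          using smooth_on_box_bump[of l u k]
          by (intro borel_measurable_continuous_onI) (metis Ck_on.simps(1) smooth_on_def)
        then have [measurable]: "box_bump l u k \<in> borel_measurable lebesgue" for k
          by (simp add: measurable_completion)
        have [measurable]: "F0 \<in> borel_measurable lebesgue"
          using F0 by simp
        show "(\<lambda>x. box_bump l u k x *\<^sub>R F0 x) \<in> borel_measurable lebesgue" for k
          by measurable
        have [measurable]: "box l u \<in> sets lebesgue" by simp
        show "(\<lambda>x. indicator (box l u) x *\<^sub>R F0 x) \<in> borel_measurable lebesgue"
          by measurable
        show "AE x in lebesgue. (\<lambda>k. box_bump l u k x *\<^sub>R F0 x) \<longlonglongrightarrow> indicator (box l u) x *\<^sub>R F0 x"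
          by (intro AE_I2 tendsto_intros box_bump_tendsto)
        show "AE x in lebesgue. norm (box_bump l u k x *\<^sub>R F0 x) \<le> norm (F0 x)" for k
          by (auto simp: box_bump_bounds mult_left_le_one_le)
      qed (use F0 in auto)
      moreover have "(LINT x|lebesgue. box_bump l u k x *\<^sub>R F0 x) = 0" for k
      proof -
        have "box_bump l u k x *\<^sub>R F0 x = indicator V x *\<^sub>R (complex_of_real (box_bump l u k x) * F x)" for x
        proof (cases "x \<in> box l u")
          case True
          then have "x \<in> cbox a b" "x \<in> V" using lu ab by auto
          then show ?thesis
            by (simp add: F0_def scaleR_conv_of_real)
        next
          case False
          then have "box_bump l u k x = 0" using box_bump_nonzero[of l u k] by blast
          then show ?thesis by simp
        qed
        then show ?thesis
          using orth[OF test_function_box_bump[OF lu ab], of k]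
          by (simp add: set_lebesgue_integral_def)
      qed
      ultimately show ?thesis
        by (simp add: set_lebesgue_integral_def LIMSEQ_const_iff)
    qed
    have "(LINT x:box l u|lebesgue. F0 x) = 0" for l u
    proof -
      obtain l' u' where lu: "box l u \<inter> box a b = box l' u'"
        by (rule that[OF box_Int_box])
      have "(LINT x:box l u|lebesgue. F0 x) = (LINT x:box l' u'|lebesgue. F0 x)"
        unfolding set_lebesgue_integral_def
      proof (rule integral_cong_AE)
        have "AE x in lebesgue. x \<notin> cbox a b - box a b"
          by (rule AE_not_in) (metis negligible_frontier_interval negligible_iff_null_sets)
        then show "AE x in lebesgue. indicator (box l u) x *\<^sub>R F0 x = indicator (box l' u') x *\<^sub>R F0 x"
        proof eventually_elim
          case (elim x)
          have "x \<in> box l' u' \<longleftrightarrow> x \<in> box l u \<and> x \<in> box a b" using lu by blast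
          moreover have "F0 x = 0" if "x \<notin> box a b" using elim that by (simp add: F0_def)
          ultimately show ?case by (cases "x \<in> box a b") (simp_all add: indicator_def)
        qed
        show "(\<lambda>x. indicator (box l u) x *\<^sub>R F0 x) \<in> borel_measurable lebesgue"
          "(\<lambda>x. indicator (box l' u') x *\<^sub>R F0 x) \<in> borel_measurable lebesgue"
          by (intro borel_measurable_scaleR borel_measurable_indicator
                borel_measurable_integrable[OF F0]; simp)+
      qed
      also have "\<dots> = 0"
        by (rule sub, fold lu) (rule order_trans[OF Int_lower2 box_subset_cbox])
      finally show ?thesis .
    qed
    from AE_zero_if_box_integrals_zero[OF F0 this]
    show ?thesis
    proof eventually_elim
      case (elim x)
      then show ?case by (cases "x \<in> cbox a b") (simp_all add: F0_def)
    qed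
  qed
  obtain \<D> where D: "countable \<D>" "\<D> \<subseteq> Pow V" "\<And>X. X \<in> \<D> \<Longrightarrow> \<exists>a b. X = cbox a b"
      "\<Union>\<D> = V"
  proof (rule open_countable_Union_open_cbox[OF V])
    fix \<D> :: "(real ^ 'n) set set"
    assume "countable \<D>" "\<D> \<subseteq> Pow V" "\<And>X. X \<in> \<D> \<Longrightarrow> \<exists>a b. X = cbox a b" "\<Union>\<D> = V"
    then show thesis by (rule that)
  qed
  have "AE x in lebesgue. \<forall>X\<in>\<D>. x \<in> X \<longrightarrow> F x = 0"
  proof (subst AE_ball_countable[OF D(1)], rule ballI)
    fix X assume "X \<in> \<D>"
    then obtain a b where "X = cbox a b" "cbox a b \<subseteq> V" using D(2,3) by blast
    then show "AE x in lebesgue. x \<in> X \<longrightarrow> F x = 0" using cb by simp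
  qed
  then show ?thesis
    by eventually_elim (use D(4) in blast)
qed

section \<open>Weak gradients of continuously differentiable functions\<close>

lemma has_derivative_zero_outside:
  assumes "closed K" "\<And>y. y \<notin> K \<Longrightarrow> h y = 0" "x \<notin> K"
  shows "(h has_derivative (\<lambda>_. 0)) (at x)"
proof -
  have "((\<lambda>_. 0) has_derivative (\<lambda>_. 0)) (at x)" by simp
  then show ?thesis
    by (rule has_derivative_transform_within_open[of _ _ _ _ "- K"]) (use assms in auto)
qed

text \<open>
  This is integration by parts without Fubini. The integral of a difference quotient of \<open>h\<close> is zero by
  translation invariance of Lebesgue measure; by the mean value inequality the difference quotients
  are dominated by a constant on a fixed ball, so one may pass to the limit.
\<close>

lemma integral_directional_derivative_eq_0:
  fixes h :: "'a::euclidean_space \<Rightarrow> complex"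
  assumes h: "\<And>x. (h has_derivative h' x) (at x)"
    and cont: "continuous_on UNIV (\<lambda>x. h' x u)"
    and K: "compact K" "\<And>x. x \<notin> K \<Longrightarrow> h x = 0"
  shows "(LINT x|lborel. h' x u) = 0"
proof -
  have d0: "h' x u = 0" if "x \<notin> K" for x
    using has_derivative_unique[OF h has_derivative_zero_outside[OF compact_imp_closed[OF K(1)] K(2) that]]
    by metis
  have "compact ((\<lambda>x. h' x u) ` K)"
    using cont K(1) by (intro compact_continuous_image) (auto intro: continuous_on_subset)
  then obtain B0 where "\<forall>z\<in>(\<lambda>x. h' x u) ` K. norm z \<le> B0"
    using compact_imp_bounded bounded_iff by metis
  then have B: "norm (h' x u) \<le> max 0 B0" for x
    using d0[of x] by (cases "x \<in> K") auto
  obtain r where r: "\<And>x. x \<in> K \<Longrightarrow> norm x \<le> r"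
    using compact_imp_bounded[OF K(1)] bounded_iff by metis
  have conth: "continuous_on UNIV h"
    by (intro continuous_at_imp_continuous_on ballI has_derivative_continuous[OF h])
  have [measurable]: "h \<in> borel_measurable borel" "(\<lambda>x. h' x u) \<in> borel_measurable borel"
    using conth cont by (auto intro: borel_measurable_continuous_onI)
  have inth: "integrable lborel h"
  proof -
    have "integrable lborel (\<lambda>x. indicator K x *\<^sub>R h x)"
      using K(1) conth by (intro borel_integrable_compact) (auto intro: continuous_on_subset)
    also have "(\<lambda>x. indicator K x *\<^sub>R h x) = h" using K(2) by (auto simp: indicator_def)
    finally show ?thesis .
  qed
  define t where "t k = inverse (real (Suc k))" for k
  have t: "0 < t k" "t k \<le> 1" for k
    by (auto simp: t_def inverse_le_1_iff)
  define q where "q k x = (h (x + t k *\<^sub>R u) - h x) /\<^sub>R t k" for k x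
  have line: "((\<lambda>s. h (x + s *\<^sub>R u)) has_derivative (\<lambda>s. s *\<^sub>R h' (x + s0 *\<^sub>R u) u)) (at s0)" for x s0
  proof -
    have "((\<lambda>s. x + s *\<^sub>R u) has_derivative (\<lambda>s. s *\<^sub>R u)) (at s0)"
      by (auto intro!: derivative_eq_intros)
    from diff_chain_at[OF this h]
    have "((\<lambda>s. h (x + s *\<^sub>R u)) has_derivative (\<lambda>s. h' (x + s0 *\<^sub>R u) (s *\<^sub>R u))) (at s0)"
      by (simp add: o_def)
    moreover have "linear (h' (x + s0 *\<^sub>R u))"
      using h has_derivative_linear by blast
    ultimately show ?thesis by (simp add: linear_cmul)
  qed
  have "(\<lambda>k. LINT x|lborel. q k x) \<longlonglongrightarrow> (LINT x|lborel. h' x u)"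
  proof (rule integral_dominated_convergence
      [where w = "\<lambda>x. indicator (cball 0 (r + norm u)) x *\<^sub>R max 0 B0"])
    show "integrable lborel (\<lambda>x::'a. indicator (cball 0 (r + norm u)) x *\<^sub>R max 0 B0)"
      by (rule borel_integrable_compact) auto
    show "(\<lambda>x. q k x) \<in> borel_measurable lborel" for k
      unfolding q_def by measurable
    show "AE x in lborel. (\<lambda>k. q k x) \<longlonglongrightarrow> h' x u"
    proof (rule AE_I2)
      fix x
      have "((\<lambda>s. (h (x + s *\<^sub>R u) - h (x + 0 *\<^sub>R u) - (s - 0) *\<^sub>R h' (x + 0 *\<^sub>R u) u) /\<^sub>R norm (s - 0))
          \<longlongrightarrow> 0) (at 0)"
        using line[of x 0] unfolding has_derivative_at_within by blast
      moreover have "filterlim t (at 0) sequentially"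
      proof (rule filterlim_atI)
        show "t \<longlonglongrightarrow> 0"
          using LIMSEQ_inverse_real_of_nat unfolding t_def .
        show "\<forall>\<^sub>F k in sequentially. t k \<noteq> 0"
          using t(1) by (intro always_eventually allI) (rule less_imp_neq[symmetric])
      qed
      ultimately have "(\<lambda>k. (h (x + t k *\<^sub>R u) - h (x + 0 *\<^sub>R u) - (t k - 0) *\<^sub>R h' (x + 0 *\<^sub>R u) u)
          /\<^sub>R norm (t k - 0)) \<longlonglongrightarrow> 0"
        by (rule filterlim_compose)
      moreover have "(h (x + t k *\<^sub>R u) - h (x + 0 *\<^sub>R u) - (t k - 0) *\<^sub>R h' (x + 0 *\<^sub>R u) u)
          /\<^sub>R norm (t k - 0) = q k x - h' x u" for k
        using t[of k] by (simp add: q_def scaleR_diff_right)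
      ultimately have "(\<lambda>k. q k x - h' x u) \<longlonglongrightarrow> 0" by simp
      then show "(\<lambda>k. q k x) \<longlonglongrightarrow> h' x u" by (simp add: LIM_zero_iff)
    qed
    show "AE x in lborel. norm (q k x) \<le> indicator (cball 0 (r + norm u)) x *\<^sub>R max 0 B0" for k
    proof (rule AE_I2)
      fix x
      show "norm (q k x) \<le> indicator (cball 0 (r + norm u)) x *\<^sub>R max 0 B0"
      proof (cases "norm x \<le> r + norm u")
        case True
        have "\<exists>s\<in>{0<..<t k}. norm (h (x + t k *\<^sub>R u) - h (x + 0 *\<^sub>R u))
            \<le> norm ((t k - 0) *\<^sub>R h' (x + s *\<^sub>R u) u)"
        proof (rule mvt_general[where f = "\<lambda>s. h (x + s *\<^sub>R u)"])
          show "continuous_on {0..t k} (\<lambda>s. h (x + s *\<^sub>R u))"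
            by (intro continuous_at_imp_continuous_on ballI has_derivative_continuous[OF line])
        qed (use t line in auto)
        then obtain s where "norm (h (x + t k *\<^sub>R u) - h x) \<le> t k * norm (h' (x + s *\<^sub>R u) u)"
          using t[of k] by auto
        also have "\<dots> \<le> t k * max 0 B0"
          using B t[of k] by (intro mult_left_mono) auto
        finally have "norm (h (x + t k *\<^sub>R u) - h x) / t k \<le> max 0 B0"
          using t[of k] by (simp add: pos_divide_le_eq mult.commute)
        then have "norm (q k x) \<le> max 0 B0"
          using t[of k] by (simp add: q_def divide_inverse mult.commute)
        then show ?thesis using True by simp
      next
        case False
        have "norm (t k *\<^sub>R u) \<le> norm u"
          using t[of k] by (simp add: mult_left_le_one_le)
        moreover have "norm x \<le> norm (x + t k *\<^sub>R u) + norm (t k *\<^sub>R u)"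
          using norm_triangle_ineq4[of "x + t k *\<^sub>R u" "t k *\<^sub>R u"] by simp
        ultimately have "r < norm (x + t k *\<^sub>R u)" "r < norm x"
          using False norm_ge_zero[of u] by linarith+
        then have "x + t k *\<^sub>R u \<notin> K" "x \<notin> K" using r by force+
        then have "q k x = 0" using K(2) by (simp add: q_def)
        then show ?thesis by simp
      qed
    qed
  qed simp
  moreover have "(LINT x|lborel. q k x) = 0" for k
  proof -
    have "(LINT x|lborel. h x) = (LINT x|distr lborel borel ((+) (t k *\<^sub>R u)). h x)"
      by (simp add: lborel_distr_plus)
    also have "\<dots> = (LINT x|lborel. h (t k *\<^sub>R u + x))"
      by (rule integral_distr) auto
    finally have 1: "(LINT x|lborel. h (x + t k *\<^sub>R u)) = (LINT x|lborel. h x)"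
      by (simp add: add.commute)
    have "integrable (distr lborel borel ((+) (t k *\<^sub>R u))) h"
      using inth by (simp add: lborel_distr_plus)
    then have "integrable lborel (\<lambda>x. h (t k *\<^sub>R u + x))"
      by (subst (asm) integrable_distr_eq) auto
    then show ?thesis using 1 inth by (simp add: q_def add.commute)
  qed
  ultimately show ?thesis by (simp add: LIMSEQ_const_iff)
qed

lemma set_integrable_lebesgue_compact:
  fixes f :: "'a::euclidean_space \<Rightarrow> 'b::{banach, second_countable_topology}"
  assumes "compact K" "continuous_on K f"
  shows "set_integrable lebesgue K f"
proof -
  have "integrable lborel (\<lambda>x. indicator K x *\<^sub>R f x)"
    using assms by (rule borel_integrable_compact)
  then show ?thesis
    unfolding set_integrable_def by (subst integrable_completion) auto
qed

lemma test_function_C1: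
  assumes "test_function V \<eta>"
  shows "(\<eta> has_derivative frechet_derivative \<eta> (at x)) (at x)"
    and "continuous_on UNIV \<eta>"
    and "continuous_on UNIV (\<lambda>x. frechet_derivative \<eta> (at x) u)"
proof -
  have "Ck_on (Suc 0) \<eta> UNIV" "Ck_on 0 \<eta> UNIV"
    using assms unfolding test_function_def smooth_on_def by blast+
  then show "(\<eta> has_derivative frechet_derivative \<eta> (at x)) (at x)"
    "continuous_on UNIV \<eta>" "continuous_on UNIV (\<lambda>x. frechet_derivative \<eta> (at x) u)"
    by (auto simp: frechet_derivative_works)
qed

lemma test_function_support:
  assumes "test_function V \<eta>"
  obtains K where "compact K" "K \<subseteq> V" "\<And>x. x \<notin> K \<Longrightarrow> \<eta> x = 0"
    "\<And>x. x \<notin> K \<Longrightarrow> frechet_derivative \<eta> (at x) = (\<lambda>_. 0)"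
proof
  let ?K = "closure {x. \<eta> x \<noteq> 0}"
  show "compact ?K" "?K \<subseteq> V" using assms by (auto simp: test_function_def)
  show z: "\<eta> x = 0" if "x \<notin> ?K" for x
    using that closure_subset[of "{x. \<eta> x \<noteq> 0}"] by auto
  show "frechet_derivative \<eta> (at x) = (\<lambda>_. 0)" if "x \<notin> ?K" for x
    by (rule frechet_derivative_at[OF has_derivative_zero_outside[OF closed_closure z that], symmetric])
qed

text \<open>
  The product of \<open>f\<close> with a test function extends by zero to a compactly supported \<open>C\<^sup>1\<close> function on
  the whole space, whose directional derivatives have integral zero.
\<close>

lemma weak_gradient_on_C1:
  fixes V :: "(real ^ 'n::finite) set"
  assumes V: "open V"
    and f: "\<And>x. x \<in> V \<Longrightarrow> (f has_derivative f' x) (at x)"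
    and cont: "\<And>i. continuous_on V (\<lambda>x. f' x (axis i 1))"
    and F: "\<And>x i. x \<in> V \<Longrightarrow> F x $ i = f' x (axis i 1)"
  shows "weak_gradient_on V f F"
  unfolding weak_gradient_on_def
proof (intro conjI allI impI)
  have contf: "continuous_on V f"
    by (intro continuous_at_imp_continuous_on ballI has_derivative_continuous[OF f])
  have contF: "continuous_on V F"
  proof -
    have "continuous_on V (\<lambda>x. \<chi> i. f' x (axis i 1))"
      by (intro continuous_on_vec_lambda cont)
    then show ?thesis
      by (rule continuous_on_eq) (simp add: F vec_eq_iff)
  qed
  fix K assume "compact K \<and> K \<subseteq> V"
  then show "set_integrable lebesgue K f" "set_integrable lebesgue K F"
    by (auto intro!: set_integrable_lebesgue_compact
        intro: continuous_on_subset[OF contf] continuous_on_subset[OF contF])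
next
  have contf: "continuous_on V f"
    by (intro continuous_at_imp_continuous_on ballI has_derivative_continuous[OF f])
  fix \<eta> :: "real^'n \<Rightarrow> real" and i assume \<eta>: "test_function V \<eta>"
  obtain K where K: "compact K" "K \<subseteq> V" "\<And>x. x \<notin> K \<Longrightarrow> \<eta> x = 0"
    "\<And>x. x \<notin> K \<Longrightarrow> frechet_derivative \<eta> (at x) = (\<lambda>_. 0)"
    using test_function_support[OF \<eta>] by blast
  let ?e = "axis i 1 :: real^'n"
  define P where "P x = complex_of_real (frechet_derivative \<eta> (at x) ?e) * f x" for x
  define Q where "Q x = complex_of_real (\<eta> x) * f' x ?e" for x
  have contP: "continuous_on V P" and contQ: "continuous_on V Q"
    unfolding P_def Q_def using test_function_C1[OF \<eta>] contf cont[of i]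
    by (auto intro!: continuous_intros intro: continuous_on_subset)
  have P0: "P x = 0" and Q0: "Q x = 0" if "x \<notin> K" for x
    using K(3,4)[OF that] by (auto simp: P_def Q_def)
  have int: "integrable lborel g \<and> (LINT x:V|lebesgue. g x) = (LINT x|lborel. g x)"
    if g: "continuous_on V g" "\<And>x. x \<notin> K \<Longrightarrow> g x = 0" for g :: "real^'n \<Rightarrow> complex"
  proof -
    have "integrable lborel (\<lambda>x. indicator K x *\<^sub>R g x)"
      using K(1,2) g by (intro borel_integrable_compact) (auto intro: continuous_on_subset)
    also have "(\<lambda>x. indicator K x *\<^sub>R g x) = g" using g by (auto simp: indicator_def)
    finally have i: "integrable lborel g" .
    have "(\<lambda>x. indicator V x *\<^sub>R g x) = g" using g K(2) by (auto simp: indicator_def fun_eq_iff)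
    then have "(LINT x:V|lebesgue. g x) = (LINT x|lebesgue. g x)"
      by (simp add: set_lebesgue_integral_def)
    also have "\<dots> = (LINT x|lborel. g x)"
      using i by (intro integral_completion) auto
    finally show ?thesis using i by simp
  qed
  define h' where "h' x u = (if x \<in> V then complex_of_real (\<eta> x) * f' x u +
      complex_of_real (frechet_derivative \<eta> (at x) u) * f x else 0)" for x u
  \<comment> \<open>Outside \<open>V\<close> both summands vanish, so the values of \<open>f'\<close> there do not matter.\<close>
  have h'e: "h' x ?e = P x + Q x" for x
  proof (cases "x \<in> V")
    case False
    then have "x \<notin> K" using K(2) by blast
    then show ?thesis using False P0 Q0 by (simp add: h'_def)
  qed (simp add: h'_def P_def Q_def)
  have "(LINT x|lborel. h' x ?e) = 0"
  proof (rule integral_directional_derivative_eq_0[where h = "\<lambda>x. complex_of_real (\<eta> x) * f x"])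
    show "((\<lambda>x. complex_of_real (\<eta> x) * f x) has_derivative h' x) (at x)" for x
    proof (cases "x \<in> V")
      case True
      have "((\<lambda>x. complex_of_real (\<eta> x) * f x) has_derivative
        (\<lambda>u. complex_of_real (\<eta> x) * f' x u + complex_of_real (frechet_derivative \<eta> (at x) u) * f x)) (at x)"
        by (intro has_derivative_mult has_derivative_of_real test_function_C1[OF \<eta>] f True)
      then show ?thesis using True by (simp add: h'_def[abs_def])
    next
      case False
      have "((\<lambda>x. complex_of_real (\<eta> x) * f x) has_derivative (\<lambda>_. 0)) (at x)"
        using K False by (intro has_derivative_zero_outside[of K]) (auto simp: compact_imp_closed)
      then show ?thesis using False by (simp add: h'_def[abs_def])
    qed
    show "continuous_on UNIV (\<lambda>x. h' x ?e)"
    proof -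
      have "continuous_on V (\<lambda>x. h' x ?e)"
        unfolding h'e by (intro continuous_on_add contP contQ)
      moreover have "continuous_on (- K) (\<lambda>x. h' x ?e)"
        by (rule continuous_on_eq[OF continuous_on_const[of _ 0]]) (auto simp: h'e P0 Q0)
      ultimately have "continuous_on (V \<union> - K) (\<lambda>x. h' x ?e)"
        using V K(1) by (intro continuous_on_open_Un) (auto simp: compact_imp_closed open_Compl)
      moreover have "V \<union> - K = UNIV" using K(2) by auto
      ultimately show ?thesis by simp
    qed
    show "compact K" by fact
    show "complex_of_real (\<eta> x) * f x = 0" if "x \<notin> K" for x using K(3)[OF that] by simp
  qed
  then have "(LINT x|lborel. P x) = - (LINT x|lborel. Q x)"
    unfolding h'e using int[OF contP P0] int[OF contQ Q0]
    by (simp add: eq_neg_iff_add_eq_0)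
  moreover have "(LINT x:V|lebesgue. complex_of_real (\<eta> x) * F x $ i) = (LINT x:V|lebesgue. Q x)"
    using V by (intro set_lebesgue_integral_cong) (auto simp: F Q_def)
  ultimately show "(LINT x:V|lebesgue. complex_of_real (frechet_derivative \<eta> (at x) (axis i 1)) * f x) =
      - (LINT x:V|lebesgue. complex_of_real (\<eta> x) * F x $ i)"
    using int[OF contP P0] int[OF contQ Q0] by (simp add: P_def)
qed

lemma weak_gradient_on_unique:
  fixes V :: "(real ^ 'n::finite) set"
  assumes V: "open V" and F: "weak_gradient_on V f F" and F': "weak_gradient_on V f F'"
  shows "AE x in lebesgue. x \<in> V \<longrightarrow> F x = F' x"
proof -
  have "AE x in lebesgue. x \<in> V \<longrightarrow> F x $ i - F' x $ i = 0" for i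
  proof (rule fundamental_lemma_calculus_of_variations[OF V])
    have comp: "set_integrable lebesgue K (\<lambda>x. H x $ i)"
      if "weak_gradient_on V f H" "compact K" "K \<subseteq> V" for H K
    proof -
      have "integrable lebesgue (\<lambda>x. (indicator K x *\<^sub>R H x) $ i)"
        using that by (intro integrable_bounded_linear[OF bounded_linear_vec_nth])
          (auto simp: weak_gradient_on_def set_integrable_def)
      then show ?thesis by (simp add: set_integrable_def)
    qed
    show "set_integrable lebesgue K (\<lambda>x. F x $ i - F' x $ i)" if "compact K" "K \<subseteq> V" for K
      using comp[OF F that] comp[OF F' that] by (rule set_integral_diff(1))
    fix \<eta> :: "real^'n \<Rightarrow> real" assume \<eta>: "test_function V \<eta>"
    obtain K where K: "compact K" "K \<subseteq> V" "\<And>x. x \<notin> K \<Longrightarrow> \<eta> x = 0"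
      using test_function_support[OF \<eta>] by metis
    have "bounded (\<eta> ` K)"
      using K(1) test_function_C1(2)[OF \<eta>]
      by (intro compact_imp_bounded compact_continuous_image) (auto intro: continuous_on_subset)
    then obtain B where B: "\<And>x. x \<in> K \<Longrightarrow> \<bar>\<eta> x\<bar> \<le> B" by (auto simp: bounded_iff)
    have int: "set_integrable lebesgue V (\<lambda>x. complex_of_real (\<eta> x) * H x $ i)"
      if H: "weak_gradient_on V f H" for H
    proof -
      have "\<eta> \<in> borel_measurable borel"
        using test_function_C1(2)[OF \<eta>] by (rule borel_measurable_continuous_onI)
      then have [measurable]: "\<eta> \<in> borel_measurable lebesgue"
        by (simp add: measurable_completion)
      have i: "integrable lebesgue (\<lambda>x. indicator K x *\<^sub>R H x $ i)"
        using comp[OF H K(1,2)] by (simp add: set_integrable_def)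
      then have [measurable]: "(\<lambda>x. indicator K x *\<^sub>R H x $ i) \<in> borel_measurable lebesgue"
        by simp
      have "integrable lebesgue (\<lambda>x. complex_of_real (\<eta> x) * (indicator K x *\<^sub>R H x $ i))"
      proof (rule Bochner_Integration.integrable_bound)
        show "integrable lebesgue (\<lambda>x. B *\<^sub>R norm (indicator K x *\<^sub>R H x $ i))"
          by (intro integrable_scaleR_right integrable_norm i)
        show "AE x in lebesgue. norm (complex_of_real (\<eta> x) * (indicator K x *\<^sub>R H x $ i))
            \<le> norm (B *\<^sub>R norm (indicator K x *\<^sub>R H x $ i))"
        proof (rule AE_I2)
          fix x
          show "norm (complex_of_real (\<eta> x) * (indicator K x *\<^sub>R H x $ i))
            \<le> norm (B *\<^sub>R norm (indicator K x *\<^sub>R H x $ i))"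
            using B[of x] by (cases "x \<in> K") (auto simp: norm_mult intro!: mult_right_mono)
        qed
      qed measurable
      also have "(\<lambda>x. complex_of_real (\<eta> x) * (indicator K x *\<^sub>R H x $ i)) =
          (\<lambda>x. indicator V x *\<^sub>R (complex_of_real (\<eta> x) * H x $ i))"
        using K by (auto simp: fun_eq_iff indicator_def)
      finally show ?thesis by (simp add: set_integrable_def)
    qed
    have "(LINT x:V|lebesgue. complex_of_real (\<eta> x) * F x $ i) =
        (LINT x:V|lebesgue. complex_of_real (\<eta> x) * F' x $ i)"
      using F F' \<eta> by (simp add: weak_gradient_on_def)
    then show "(LINT x:V|lebesgue. complex_of_real (\<eta> x) * (F x $ i - F' x $ i)) = 0"
      using int[OF F] int[OF F'] by (simp add: right_diff_distrib set_integral_diff(2))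
  qed
  then have "AE x in lebesgue. \<forall>i. x \<in> V \<longrightarrow> F x $ i - F' x $ i = 0"
    by (subst AE_all_countable) auto
  then show ?thesis by eventually_elim (auto simp: vec_eq_iff)
qed

section \<open>Dual norms\<close>

text \<open>
  Invariance of the dual norm under an invertible change of coordinates: it makes the covector norms
  independent of the chart.
\<close>

lemma dual_norm_transform:
  assumes "invertible J"
    and "\<And>u. B u u = B' (J *v u) (J *v u)"
    and "\<And>u. \<xi> \<bullet> u = \<xi>' \<bullet> (J *v u)"
  shows "dual_norm B \<xi> = dual_norm B' \<xi>'"
proof -
  obtain J' where J': "J ** J' = mat 1" using assms(1) by (auto simp: invertible_def)
  have "{\<xi> \<bullet> u | u. B u u \<le> 1} = {\<xi>' \<bullet> u | u. B' u u \<le> 1}"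
  proof (intro equalityI subsetI)
    fix x assume "x \<in> {\<xi> \<bullet> u | u. B u u \<le> 1}"
    then show "x \<in> {\<xi>' \<bullet> u | u. B' u u \<le> 1}" using assms(2,3) by auto
  next
    fix x assume "x \<in> {\<xi>' \<bullet> u | u. B' u u \<le> 1}"
    then obtain u where u: "x = \<xi>' \<bullet> u" "B' u u \<le> 1" by blast
    have "J *v (J' *v u) = u" by (simp add: matrix_vector_mul_assoc J')
    then have "x = \<xi> \<bullet> (J' *v u)" "B (J' *v u) (J' *v u) \<le> 1"
      using u assms(2,3) by auto
    then show "x \<in> {\<xi> \<bullet> u | u. B u u \<le> 1}" by blast
  qed
  then show ?thesis by (simp add: dual_norm_def)
qed

context
  fixes B :: "real ^ 'n \<Rightarrow> real ^ 'n \<Rightarrow> real" and a :: real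
  assumes a: "a > 0" and lower: "\<And>u. a * (norm u)\<^sup>2 \<le> B u u" and B0: "B 0 0 = 0"
begin

lemma dual_pairing_le:
  assumes "B u u \<le> 1"
  shows "\<xi> \<bullet> u \<le> norm \<xi> / sqrt a"
proof -
  have "a * (norm u)\<^sup>2 \<le> 1" using lower[of u] assms by simp
  then have "(sqrt a * norm u)\<^sup>2 \<le> 1\<^sup>2" using a by (simp add: power_mult_distrib)
  then have "sqrt a * norm u \<le> 1" by (rule power2_le_imp_le) simp
  then have "norm u \<le> 1 / sqrt a" using a by (simp add: field_simps)
  then have "norm \<xi> * norm u \<le> norm \<xi> * (1 / sqrt a)" by (rule mult_left_mono) simp
  then show ?thesis using norm_cauchy_schwarz[of \<xi> u] by simp
qed

lemma dual_norm_le: "dual_norm B \<xi> \<le> norm \<xi> / sqrt a"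
  unfolding dual_norm_def
proof (rule cSup_least)
  have "\<xi> \<bullet> 0 \<in> {\<xi> \<bullet> u | u. B u u \<le> 1}"
    by (intro CollectI exI[of _ 0] conjI) (simp_all add: B0)
  then show "{\<xi> \<bullet> u | u. B u u \<le> 1} \<noteq> {}" by blast
qed (use dual_pairing_le in blast)

lemma dual_norm_ge:
  assumes "B u u \<le> 1"
  shows "\<xi> \<bullet> u \<le> dual_norm B \<xi>"
  unfolding dual_norm_def
proof (rule cSup_upper)
  show "\<xi> \<bullet> u \<in> {\<xi> \<bullet> u | u. B u u \<le> 1}" using assms by blast
  show "bdd_above {\<xi> \<bullet> u | u. B u u \<le> 1}"
    by (rule bdd_aboveI[of _ "norm \<xi> / sqrt a"]) (use dual_pairing_le in blast)
qed

lemma dual_norm_nonneg: "0 \<le> dual_norm B \<xi>"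
  using dual_norm_ge[of 0 \<xi>] B0 by simp

lemma dual_norm_ge_norm:
  assumes b: "b > 0" and upper: "\<And>u. B u u \<le> b * (norm u)\<^sup>2"
  shows "norm \<xi> / sqrt b \<le> dual_norm B \<xi>"
proof (cases "\<xi> = 0")
  case True
  then show ?thesis using dual_norm_nonneg by simp
next
  case False
  define u where "u = (1 / (norm \<xi> * sqrt b)) *\<^sub>R \<xi>"
  have "norm u = 1 / sqrt b" using False b by (simp add: u_def)
  then have "b * (norm u)\<^sup>2 = 1" using b by (simp add: power_divide)
  then have "B u u \<le> 1" using upper[of u] by simp
  from dual_norm_ge[OF this, of \<xi>]
  show ?thesis using False b by (simp add: u_def dot_square_norm power2_eq_square)
qed

end

lemma norm_complex_vec_square:
  fixes \<zeta> :: "complex ^ 'n::finite"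
  shows "(norm \<zeta>)\<^sup>2 = (norm (\<chi> i. Re (\<zeta> $ i)))\<^sup>2 + (norm (\<chi> i. Im (\<zeta> $ i)))\<^sup>2"
proof -
  have "(norm \<zeta>)\<^sup>2 = (\<Sum>i\<in>UNIV. (cmod (\<zeta> $ i))\<^sup>2)"
    by (simp add: norm_vec_def L2_set_def sum_nonneg)
  also have "\<dots> = (\<Sum>i\<in>UNIV. (Re (\<zeta> $ i))\<^sup>2) + (\<Sum>i\<in>UNIV. (Im (\<zeta> $ i))\<^sup>2)"
    by (simp add: cmod_power2 sum.distrib)
  finally show ?thesis by (simp add: norm_vec_def L2_set_def sum_nonneg)
qed

lemma complex_dual_norm_le:
  assumes "0 \<le> k" "\<And>\<xi>. 0 \<le> dual_norm B \<xi>" "\<And>\<xi>. dual_norm B \<xi> \<le> k * norm \<xi>"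
  shows "complex_dual_norm B \<zeta> \<le> k * norm \<zeta>"
proof -
  have "(dual_norm B (\<chi> i. Re (\<zeta> $ i)))\<^sup>2 + (dual_norm B (\<chi> i. Im (\<zeta> $ i)))\<^sup>2
    \<le> (k * norm (\<chi> i. Re (\<zeta> $ i)))\<^sup>2 + (k * norm (\<chi> i. Im (\<zeta> $ i)))\<^sup>2"
    using assms by (intro add_mono power_mono) auto
  also have "\<dots> = (k * norm \<zeta>)\<^sup>2"
    by (simp add: power_mult_distrib norm_complex_vec_square distrib_left)
  finally show ?thesis
    unfolding complex_dual_norm_def using assms(1) by (intro real_le_lsqrt) auto
qed

lemma complex_dual_norm_ge:
  assumes "0 \<le> k" "\<And>\<xi>. k * norm \<xi> \<le> dual_norm B \<xi>"
  shows "k * norm \<zeta> \<le> complex_dual_norm B \<zeta>"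
proof -
  have "(k * norm \<zeta>)\<^sup>2 = (k * norm (\<chi> i. Re (\<zeta> $ i)))\<^sup>2 + (k * norm (\<chi> i. Im (\<zeta> $ i)))\<^sup>2"
    by (simp add: power_mult_distrib norm_complex_vec_square distrib_left)
  also have "\<dots> \<le> (dual_norm B (\<chi> i. Re (\<zeta> $ i)))\<^sup>2 + (dual_norm B (\<chi> i. Im (\<zeta> $ i)))\<^sup>2"
    using assms by (intro add_mono power_mono) auto
  finally show ?thesis
    unfolding complex_dual_norm_def by (rule real_le_rsqrt)
qed

lemma complex_dual_norm_nonneg: "0 \<le> complex_dual_norm B \<zeta>"
  by (simp add: complex_dual_norm_def)

lemma complex_dual_norm_0:
  fixes B :: "real ^ 'n \<Rightarrow> real ^ 'n::finite \<Rightarrow> real"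
  assumes "B 0 0 = 0"
  shows "complex_dual_norm B 0 = 0"
proof -
  have "{(0::real^'n) \<bullet> u | u. B u u \<le> 1} = {0}"
  proof (intro equalityI subsetI)
    fix x :: real assume "x \<in> {0}"
    then show "x \<in> {(0::real^'n) \<bullet> u | u. B u u \<le> 1}"
      by (intro CollectI exI[of _ 0] conjI) (simp_all add: assms)
  qed auto
  then have "dual_norm B (\<chi> i. 0) = 0" by (simp add: dual_norm_def zero_vec_def[symmetric])
  then show ?thesis by (simp add: complex_dual_norm_def)
qed

section \<open>Charts and transformation laws\<close>

locale closed_riemannian_manifold =
  fixes A :: "('m::{t2_space, second_countable_topology}, 'n::finite) chart set"
    and g :: "('m, 'n) chart \<Rightarrow> 'm \<Rightarrow> real ^ 'n ^ 'n"
    and vol :: "'m measure"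
  assumes mfd: "closed_connected_oriented_riemannian_manifold A g"
    and volume: "riemannian_volume A g vol"
begin

abbreviation coords :: "('m, 'n) chart \<Rightarrow> (real ^ 'n) set" where
  "coords c \<equiv> snd c ` fst c"

lemma atlas: "oriented_smooth_atlas A"
  and metric: "riemannian_metric A g"
  and compact_UNIV: "compact (UNIV :: 'm set)"
  using mfd by (auto simp: closed_connected_oriented_riemannian_manifold_def)

lemma chart_exists: "\<exists>c\<in>A. p \<in> fst c"
proof -
  have "p \<in> (\<Union>c\<in>A. fst c)" using atlas unfolding oriented_smooth_atlas_def by simp
  then show ?thesis by blast
qed

lemma chart_at: "chart_at A p \<in> A" "p \<in> fst (chart_at A p)"
proof -
  have "\<exists>c. c \<in> A \<and> p \<in> fst c" using chart_exists by blast
  from someI_ex[OF this] show "chart_at A p \<in> A" "p \<in> fst (chart_at A p)"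
    by (simp_all add: chart_at_def)
qed

context
  fixes c assumes c: "c \<in> A"
begin

lemma open_domain: "open (fst c)" and open_coords: "open (coords c)"
  and homeo: "homeomorphism (fst c) (coords c) (snd c) (chart_inv c)"
  using atlas c unfolding oriented_smooth_atlas_def by blast+

lemma chart_inv_chart [simp]: "p \<in> fst c \<Longrightarrow> chart_inv c (snd c p) = p"
  by (rule homeomorphism_apply1[OF homeo])

lemma chart_chart_inv [simp]: "y \<in> coords c \<Longrightarrow> snd c (chart_inv c y) = y"
  by (rule homeomorphism_apply2[OF homeo])

lemma chart_inv_in: "y \<in> coords c \<Longrightarrow> chart_inv c y \<in> fst c"
  by auto

lemma continuous_chart: "continuous_on (fst c) (snd c)"
  and continuous_chart_inv: "continuous_on (coords c) (chart_inv c)"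
  using homeo by (simp_all add: homeomorphism_def)

lemma open_chart_image:
  assumes "open U" "U \<subseteq> fst c"
  shows "open (snd c ` U)"
proof -
  have "openin (top_of_set (fst c)) U"
    using assms by (simp add: open_domain openin_open_eq)
  from homeomorphism_imp_open_map[OF homeo this]
  show ?thesis by (simp add: open_coords openin_open_eq)
qed

lemma chart_inv_image: "Y \<subseteq> coords c \<Longrightarrow> chart_inv c ` Y = fst c \<inter> snd c -` Y"
proof (intro equalityI subsetI)
  fix p assume "Y \<subseteq> coords c" "p \<in> chart_inv c ` Y"
  then obtain y where "y \<in> Y" "y \<in> coords c" "p = chart_inv c y" by blast
  then show "p \<in> fst c \<inter> snd c -` Y" using chart_inv_in by simp
next
  fix p assume "p \<in> fst c \<inter> snd c -` Y"
  then show "p \<in> chart_inv c ` Y" by (intro image_eqI[of _ _ "snd c p"]) simp_all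
qed

lemma compact_chart_inv_image:
  "compact K \<Longrightarrow> K \<subseteq> coords c \<Longrightarrow> compact (chart_inv c ` K)"
  by (intro compact_continuous_image continuous_on_subset[OF continuous_chart_inv])

end

lemma transition_derivative:
  assumes "c \<in> A" "c' \<in> A" "p \<in> fst c" "p \<in> fst c'"
  shows "((snd c' \<circ> chart_inv c) has_derivative (\<lambda>u. transition_jacobian c c' p *v u)) (at (snd c p))"
    and "invertible (transition_jacobian c c' p)"
proof -
  have "Ck_on (Suc 0) (snd c' \<circ> chart_inv c) (snd c ` (fst c \<inter> fst c'))"
    using assms atlas unfolding oriented_smooth_atlas_def smooth_on_def by blast
  then have "(snd c' \<circ> chart_inv c) differentiable (at (snd c p))"
    using assms by auto
  then show "((snd c' \<circ> chart_inv c) has_derivative (\<lambda>u. transition_jacobian c c' p *v u)) (at (snd c p))"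
    unfolding transition_jacobian_def by (simp add: jacobian_works)
  have "det (transition_jacobian c c' p) > 0"
    using assms atlas unfolding oriented_smooth_atlas_def by blast
  then show "invertible (transition_jacobian c c' p)"
    by (simp add: invertible_det_nz)
qed

lemma continuous_transition_derivative:
  assumes "c \<in> A" "c' \<in> A"
  shows "continuous_on (snd c ` (fst c \<inter> fst c'))
    (\<lambda>y. frechet_derivative (snd c' \<circ> chart_inv c) (at y) u)"
proof -
  have "Ck_on (Suc 0) (snd c' \<circ> chart_inv c) (snd c ` (fst c \<inter> fst c'))"
    using assms atlas unfolding oriented_smooth_atlas_def smooth_on_def by blast
  then show ?thesis by simp
qed

lemma metric_inner_transform:
  assumes "c \<in> A" "c' \<in> A" "p \<in> fst c" "p \<in> fst c'"
  shows "metric_inner g c p u w =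
    metric_inner g c' p (transition_jacobian c c' p *v u) (transition_jacobian c c' p *v w)"
proof -
  let ?J = "transition_jacobian c c' p"
  have "g c p = transpose ?J ** g c' p ** ?J"
    using metric assms unfolding riemannian_metric_def two_tensor_field_def by blast
  then have "g c p *v w = transpose ?J *v (g c' p *v (?J *v w))"
    by (simp add: matrix_vector_mul_assoc matrix_mul_assoc)
  moreover have "u \<bullet> (transpose ?J *v x) = (?J *v u) \<bullet> x" for x
    using dot_lmul_matrix[of x ?J u] by (simp add: inner_commute)
  ultimately show ?thesis
    unfolding metric_inner_def by simp
qed

lemma elliptic_inner_transform:
  assumes "endomorphism_field A G" "c \<in> A" "c' \<in> A" "p \<in> fst c" "p \<in> fst c'"
  shows "elliptic_inner g G c p u w =
    elliptic_inner g G c' p (transition_jacobian c c' p *v u) (transition_jacobian c c' p *v w)"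
proof -
  let ?J = "transition_jacobian c c' p"
  have "G c' p ** ?J = ?J ** G c p"
    using assms unfolding endomorphism_field_def by blast
  then have "G c' p *v (?J *v u) = ?J *v (G c p *v u)"
    by (simp add: matrix_vector_mul_assoc)
  then show ?thesis
    unfolding elliptic_inner_def using metric_inner_transform[OF assms(2-)] by simp
qed

lemma covector_transform:
  assumes "covector_field A \<omega>" "c \<in> A" "c' \<in> A" "p \<in> fst c" "p \<in> fst c'"
  shows "(\<chi> i. Re (\<omega> c p $ i)) \<bullet> u = (\<chi> i. Re (\<omega> c' p $ i)) \<bullet> (transition_jacobian c c' p *v u)"
    and "(\<chi> i. Im (\<omega> c p $ i)) \<bullet> u = (\<chi> i. Im (\<omega> c' p $ i)) \<bullet> (transition_jacobian c c' p *v u)"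
proof -
  let ?J = "transition_jacobian c c' p"
  have \<omega>: "\<omega> c p $ i = (\<Sum>k\<in>UNIV. complex_of_real (?J $ k $ i) * \<omega> c' p $ k)" for i
    using assms unfolding covector_field_def by blast
  have *: "(\<Sum>i\<in>UNIV. (\<Sum>k\<in>UNIV. ?J $ k $ i * f k) * u $ i) =
      (\<Sum>k\<in>UNIV. f k * (\<Sum>i\<in>UNIV. ?J $ k $ i * u $ i))" for f :: "'n \<Rightarrow> real"
    unfolding sum_distrib_left sum_distrib_right
    by (subst sum.swap) (simp add: mult_ac)
  show "(\<chi> i. Re (\<omega> c p $ i)) \<bullet> u = (\<chi> i. Re (\<omega> c' p $ i)) \<bullet> (?J *v u)"
    "(\<chi> i. Im (\<omega> c p $ i)) \<bullet> u = (\<chi> i. Im (\<omega> c' p $ i)) \<bullet> (?J *v u)"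
    using *[of "\<lambda>k. Re (\<omega> c' p $ k)"] *[of "\<lambda>k. Im (\<omega> c' p $ k)"]
    by (simp_all add: inner_vec_def \<omega> matrix_vector_mult_def)
qed

text \<open>
  The norm is defined in an arbitrarily chosen chart around \<open>p\<close>; this frees its computation from that
  choice.
\<close>

lemma elliptic_covector_norm_chart:
  assumes "endomorphism_field A G" "covector_field A \<omega>" "c \<in> A" "p \<in> fst c"
  shows "elliptic_covector_norm A g G \<omega> p = complex_dual_norm (elliptic_inner g G c p) (\<omega> c p)"
proof -
  let ?c = "chart_at A p"
  have inv: "invertible (transition_jacobian ?c c p)"
    using transition_derivative(2) chart_at assms by blast
  have "dual_norm (elliptic_inner g G ?c p) (\<chi> i. Re (\<omega> ?c p $ i)) =
      dual_norm (elliptic_inner g G c p) (\<chi> i. Re (\<omega> c p $ i))"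
    using assms chart_at[of p]
    by (intro dual_norm_transform[OF inv] elliptic_inner_transform covector_transform)
  moreover have "dual_norm (elliptic_inner g G ?c p) (\<chi> i. Im (\<omega> ?c p $ i)) =
      dual_norm (elliptic_inner g G c p) (\<chi> i. Im (\<omega> c p $ i))"
    using assms chart_at[of p]
    by (intro dual_norm_transform[OF inv] elliptic_inner_transform covector_transform)
  ultimately show ?thesis
    by (simp add: elliptic_covector_norm_def complex_dual_norm_def)
qed

lemma covector_norm_eq_elliptic:
  "covector_norm A g \<omega> p = elliptic_covector_norm A g (\<lambda>_ _. mat 1) \<omega> p"
  by (simp add: covector_norm_def elliptic_covector_norm_def elliptic_inner_def[abs_def]
      metric_inner_def[abs_def])

lemma endomorphism_field_identity: "endomorphism_field A (\<lambda>_ _. mat 1)"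
  by (simp add: endomorphism_field_def)

section \<open>The metric and the volume in a chart\<close>

lemma metric_inner_0: "metric_inner g c p 0 0 = 0"
  by (simp add: metric_inner_def)

lemma elliptic_inner_0: "elliptic_inner g G c p 0 0 = 0"
  by (simp add: elliptic_inner_def metric_inner_def)

lemma continuous_metric:
  assumes "c \<in> A"
  shows "continuous_on (coords c) (\<lambda>y. g c (chart_inv c y))"
proof -
  have "smooth_on (coords c) (\<lambda>y. g c (chart_inv c y))"
    using assms metric unfolding riemannian_metric_def by blast
  then show ?thesis unfolding smooth_on_def by (metis Ck_on.simps(1))
qed

lemma metric_pos:
  assumes "c \<in> A" "p \<in> fst c" "u \<noteq> 0"
  shows "u \<bullet> (g c p *v u) > 0"
  using assms metric unfolding riemannian_metric_def metric_inner_def by blast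

end

text \<open>
  The determinant does not vanish along the segment from the identity to \<open>H\<close>, which consists of
  positive definite matrices.
\<close>

lemma det_pos_if_positive_definite:
  fixes H :: "real ^ 'n ^ 'n::finite"
  assumes H: "\<And>u. u \<noteq> 0 \<Longrightarrow> u \<bullet> (H *v u) > 0"
  shows "det H > 0"
proof (rule ccontr)
  assume neg: "\<not> det H > 0"
  define H' where "H' t = (1 - t) *\<^sub>R mat 1 + t *\<^sub>R H" for t :: real
  have mv: "H' t *v u = (1 - t) *\<^sub>R u + t *\<^sub>R (H *v u)" for t u
    by (simp add: H'_def matrix_vector_mult_add_rdistrib scaleR_matrix_vector_assoc[symmetric])
  \<comment> \<open>Otherwise the determinant would change sign, and \<open>H' t\<close> would have a kernel for some \<open>t\<close>.\<close>
  have "\<exists>t\<ge>0. t \<le> 1 \<and> det (H' t) = 0"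
  proof (rule IVT2')
    show "continuous_on {0..1} (\<lambda>t. det (H' t))"
      unfolding H'_def det_def
      by (simp only: vector_add_component vector_scaleR_component) (intro continuous_intros)
  qed (use neg in \<open>auto simp: H'_def\<close>)
  then obtain t where t: "0 \<le> t" "t \<le> 1" "det (H' t) = 0" by blast
  then have "\<not> invertible (H' t)" by (simp add: invertible_det_nz)
  then obtain u where u: "u \<noteq> 0" "H' t *v u = 0"
    using invertible_left_inverse matrix_left_invertible_ker by blast
  have "0 = u \<bullet> (H' t *v u)" using u by simp
  also have "\<dots> = (1 - t) * (u \<bullet> u) + t * (u \<bullet> (H *v u))"
    by (simp add: mv inner_add_right)
  also have "\<dots> > 0"
  proof (cases "t = 0")
    case True
    then show ?thesis using u by simp
  next
    case False
    then have "t * (u \<bullet> (H *v u)) > 0" using t H[OF u(1)] by simp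
    moreover have "(1 - t) * (u \<bullet> u) \<ge> 0" using t by simp
    ultimately show ?thesis by linarith
  qed
  finally show False by simp
qed

context closed_riemannian_manifold
begin

lemma sets_vol: "sets vol = sets borel" and space_vol: "space vol = UNIV"
proof -
  show "sets vol = sets borel" using volume by (simp add: riemannian_volume_def)
  then have "space vol = space borel" by (rule sets_eq_imp_space_eq)
  then show "space vol = UNIV" by simp
qed

text \<open>
  By compactness of \<open>K\<close> times the unit sphere, the metric is comparable to the Euclidean one.
\<close>

lemma metric_bounds:
  assumes c: "c \<in> A" and K: "compact K" "K \<subseteq> coords c"
  shows "\<exists>a>0. \<exists>b>0. \<forall>y\<in>K. \<forall>u. a * (norm u)\<^sup>2 \<le> metric_inner g c (chart_inv c y) u u \<and>
    metric_inner g c (chart_inv c y) u u \<le> b * (norm u)\<^sup>2"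
proof (cases "K = {}")
  case True
  then show ?thesis by (auto intro: exI[of _ 1])
next
  case False
  define \<phi> where "\<phi> = (\<lambda>(y, u). u \<bullet> (g c (chart_inv c y) *v u))"
  let ?S = "K \<times> sphere (0 :: real^'n) 1"
  have S: "compact ?S" "?S \<noteq> {}"
    using K(1) False by (auto intro!: compact_Times simp: sphere_eq_empty)
  have "continuous_on ?S (\<lambda>z. g c (chart_inv c (fst z)))"
    by (rule continuous_on_compose2[OF continuous_metric[OF c] continuous_on_fst[OF continuous_on_id]])
      (use K(2) in auto)
  then have cont: "continuous_on ?S \<phi>"
    unfolding \<phi>_def case_prod_beta inner_vec_def matrix_vector_mult_def
    by (simp only: vec_lambda_beta inner_real_def) (intro continuous_intros)
  obtain z1 where z1: "z1 \<in> ?S" "\<And>z. z \<in> ?S \<Longrightarrow> \<phi> z1 \<le> \<phi> z"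
    using continuous_attains_inf[OF S cont] by blast
  obtain z2 where z2: "z2 \<in> ?S" "\<And>z. z \<in> ?S \<Longrightarrow> \<phi> z \<le> \<phi> z2"
    using continuous_attains_sup[OF S cont] by blast
  have pos: "\<phi> z > 0" if "z \<in> ?S" for z
  proof -
    obtain y u where "z = (y, u)" by (cases z)
    moreover have "u \<noteq> 0" "chart_inv c y \<in> fst c"
      using that \<open>z = (y, u)\<close> K(2) chart_inv_in[OF c] by auto
    ultimately show ?thesis using metric_pos[OF c] by (simp add: \<phi>_def)
  qed
  have hom: "metric_inner g c (chart_inv c y) u u = \<phi> (y, (1 / norm u) *\<^sub>R u) * (norm u)\<^sup>2"
    if "u \<noteq> 0" for y u
    using that by (simp add: \<phi>_def metric_inner_def matrix_vector_mult_scaleR power2_eq_square)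
  show ?thesis
  proof (rule exI[of _ "\<phi> z1"], rule conjI[rotated], rule exI[of _ "\<phi> z2"],
      intro conjI ballI allI)
    show "0 < \<phi> z1" "0 < \<phi> z2" using pos z1(1) z2(1) by auto
    fix y and u :: "real^'n" assume y: "y \<in> K"
    show "\<phi> z1 * (norm u)\<^sup>2 \<le> metric_inner g c (chart_inv c y) u u"
    proof (cases "u = 0")
      case False
      then have "(y, (1 / norm u) *\<^sub>R u) \<in> ?S" using y by simp
      then show ?thesis using z1(2) hom[OF False] by (simp add: mult_right_mono)
    qed (simp add: metric_inner_0)
    show "metric_inner g c (chart_inv c y) u u \<le> \<phi> z2 * (norm u)\<^sup>2"
    proof (cases "u = 0")
      case False
      then have "(y, (1 / norm u) *\<^sub>R u) \<in> ?S" using y by simp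
      then show ?thesis using z2(2) hom[OF False] by (simp add: mult_right_mono)
    qed (simp add: metric_inner_0)
  qed
qed

abbreviation vol_density :: "('m, 'n) chart \<Rightarrow> real ^ 'n \<Rightarrow> real" where
  "vol_density c y \<equiv> sqrt (det (g c (chart_inv c y)))"

lemma vol_density_bounds:
  assumes c: "c \<in> A" and K: "compact K" "K \<subseteq> coords c"
  shows "\<exists>a>0. \<exists>b>0. \<forall>y\<in>K. a \<le> vol_density c y \<and> vol_density c y \<le> b"
proof (cases "K = {}")
  case True
  then show ?thesis by (auto intro: exI[of _ 1])
next
  case False
  have "continuous_on K (\<lambda>y. g c (chart_inv c y))"
    by (rule continuous_on_subset[OF continuous_metric[OF c] K(2)])
  then have cont: "continuous_on K (\<lambda>y. vol_density c y)"
    unfolding det_def by (intro continuous_intros)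
  obtain y1 where y1: "y1 \<in> K" "\<And>y. y \<in> K \<Longrightarrow> vol_density c y1 \<le> vol_density c y"
    using continuous_attains_inf[OF K(1) False cont] by blast
  obtain y2 where y2: "y2 \<in> K" "\<And>y. y \<in> K \<Longrightarrow> vol_density c y \<le> vol_density c y2"
    using continuous_attains_sup[OF K(1) False cont] by blast
  have pos: "0 < vol_density c y" if "y \<in> K" for y
  proof -
    have "chart_inv c y \<in> fst c" using that K(2) chart_inv_in[OF c] by blast
    then have "det (g c (chart_inv c y)) > 0"
      by (intro det_pos_if_positive_definite metric_pos[OF c])
    then show ?thesis by simp
  qed
  show ?thesis
    by (rule exI[of _ "vol_density c y1"], rule conjI[rotated], rule exI[of _ "vol_density c y2"])
      (use pos y1 y2 in auto)
qed

lemma chart_inv_image_borel: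
  assumes c: "c \<in> A" and Y: "Y \<in> sets borel" "Y \<subseteq> coords c"
  shows "chart_inv c ` Y \<in> sets borel"
proof -
  have "snd c \<in> borel_measurable (restrict_space borel (fst c))"
    by (intro borel_measurable_continuous_on_restrict continuous_chart c)
  from measurable_sets[OF this Y(1)]
  have "snd c -` Y \<inter> fst c \<in> sets (restrict_space borel (fst c))"
    by (simp add: space_restrict_space)
  then have "snd c -` Y \<inter> fst c \<in> sets borel"
    using open_domain[OF c] by (subst (asm) sets_restrict_space_iff) auto
  then show ?thesis
    using chart_inv_image[OF c Y(2)] by (simp add: Int_commute)
qed

lemma emeasure_vol_chart:
  assumes c: "c \<in> A" and Y: "Y \<in> sets borel" "Y \<subseteq> coords c"
  shows "emeasure vol (chart_inv c ` Y) = (\<integral>\<^sup>+y\<in>Y. ennreal (vol_density c y) \<partial>lborel)"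
proof -
  have "snd c ` chart_inv c ` Y = Y"
    using Y(2) by (auto simp: image_image chart_chart_inv[OF c] subset_iff intro!: image_eqI)
  moreover have "chart_inv c ` Y \<subseteq> fst c"
    using Y(2) chart_inv_in[OF c] by blast
  ultimately show ?thesis
    using volume c chart_inv_image_borel[OF assms] by (simp add: riemannian_volume_def)
qed

lemma emeasure_vol_chart_le:
  assumes c: "c \<in> A" and Y: "Y \<in> sets borel" "Y \<subseteq> coords c"
    and b: "\<And>y. y \<in> Y \<Longrightarrow> vol_density c y \<le> b"
  shows "emeasure vol (chart_inv c ` Y) \<le> ennreal b * emeasure lborel Y"
proof -
  have "emeasure vol (chart_inv c ` Y) \<le> (\<integral>\<^sup>+y. ennreal b * indicator Y y \<partial>lborel)"
    unfolding emeasure_vol_chart[OF c Y]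
    by (intro nn_integral_mono) (auto simp: indicator_def b ennreal_leI)
  also have "\<dots> = ennreal b * emeasure lborel Y"
    using Y by (intro nn_integral_cmult_indicator) simp
  finally show ?thesis .
qed

lemma emeasure_vol_chart_ge:
  assumes c: "c \<in> A" and Y: "Y \<in> sets borel" "Y \<subseteq> coords c"
    and a: "\<And>y. y \<in> Y \<Longrightarrow> a \<le> vol_density c y"
  shows "ennreal a * emeasure lborel Y \<le> emeasure vol (chart_inv c ` Y)"
proof -
  have "ennreal a * emeasure lborel Y = (\<integral>\<^sup>+y. ennreal a * indicator Y y \<partial>lborel)"
    using Y by (intro nn_integral_cmult_indicator[symmetric]) simp
  also have "\<dots> \<le> emeasure vol (chart_inv c ` Y)"
    unfolding emeasure_vol_chart[OF c Y]
    by (intro nn_integral_mono) (auto simp: indicator_def a ennreal_leI)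
  finally show ?thesis .
qed

text \<open>
  Sets that are Lebesgue null in coordinates are null for the volume. The exceptional set is first
  enlarged to a Borel null set, because the volume is described on Borel sets only.
\<close>

lemma AE_vol_chart:
  assumes c: "c \<in> A" and P: "AE y in lebesgue. y \<in> coords c \<longrightarrow> P y"
  shows "AE p in vol. p \<in> fst c \<longrightarrow> P (snd c p)"
proof -
  have "AE y in lborel. y \<in> coords c \<longrightarrow> P y"
    using P by (rule AE_completion_iff[THEN iffD1])
  then obtain N where N: "{y \<in> space lborel. \<not> (y \<in> coords c \<longrightarrow> P y)} \<subseteq> N" "emeasure lborel N = 0" "N \<in> sets lborel"
    by (rule AE_E)
  define Y where "Y = N \<inter> coords c"
  have Y: "Y \<in> sets borel" "Y \<subseteq> coords c"
    using N(3) open_coords[OF c] by (auto simp: Y_def)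
  have "N \<in> null_sets lborel" using N(2,3) by (rule null_setsI)
  moreover have "Y \<in> sets lborel" "Y \<subseteq> N" using Y(1) by (auto simp: Y_def)
  ultimately have "Y \<in> null_sets lborel" by (rule null_sets_subset)
  then have "emeasure vol (chart_inv c ` Y) = 0"
    unfolding emeasure_vol_chart[OF c Y] by (rule nn_integral_null_set)
  then have "chart_inv c ` Y \<in> null_sets vol"
    using chart_inv_image_borel[OF c Y] by (simp add: null_sets_def sets_vol)
  then have "AE p in vol. p \<notin> chart_inv c ` Y" by (rule AE_not_in)
  then show ?thesis
  proof eventually_elim
    case (elim p)
    show ?case
    proof
      assume p: "p \<in> fst c"
      then have "snd c p \<notin> Y"
        using elim chart_inv_image[OF c Y(2)] by blast
      then show "P (snd c p)" using N(1) p by (auto simp: Y_def)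
    qed
  qed
qed

lemma cball_in_chart:
  assumes "c \<in> A" "p \<in> fst c"
  obtains r where "0 < r" "cball (snd c p) r \<subseteq> coords c"
proof -
  have "\<forall>y\<in>coords c. \<exists>r>0. cball y r \<subseteq> coords c"
    using open_coords[OF assms(1)] by (simp only: open_contains_cball)
  moreover have "snd c p \<in> coords c" using assms(2) by (rule imageI)
  ultimately show ?thesis using that by (metis (no_types))
qed

text \<open>
  Finiteness matters because normalizing an infinite volume would produce the zero measure, for which
  all energies vanish. Small coordinate balls have finite volume, and finitely many cover the manifold.
\<close>

lemma finite_vol: "emeasure vol UNIV < \<infinity>"
proof -
  have "\<exists>U. open U \<and> p \<in> U \<and> emeasure vol U < \<infinity>" for p
  proof -
    obtain c where c: "c \<in> A" "p \<in> fst c" using chart_exists by blast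
    obtain r where r: "0 < r" "cball (snd c p) r \<subseteq> coords c" using cball_in_chart[OF c] .
    obtain b where b: "\<forall>y\<in>cball (snd c p) r. vol_density c y \<le> b"
      using vol_density_bounds[OF c(1) compact_cball r(2)] by blast
    let ?Y = "ball (snd c p) r"
    have Y: "?Y \<subseteq> coords c" using r(2) ball_subset_cball by blast
    have "emeasure vol (chart_inv c ` ?Y) \<le> ennreal b * emeasure lborel ?Y"
      using b by (intro emeasure_vol_chart_le[OF c(1) _ Y]) auto
    also have "\<dots> < \<infinity>"
      using emeasure_bounded_finite[of ?Y] by (simp add: ennreal_mult_less_top)
    finally have "emeasure vol (chart_inv c ` ?Y) < \<infinity>" .
    moreover have "open (chart_inv c ` ?Y)"
      unfolding chart_inv_image[OF c(1) Y]
      using continuous_chart[OF c(1)] open_domain[OF c(1)]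
      by (simp add: continuous_on_open_vimage Int_commute)
    moreover have "p \<in> chart_inv c ` ?Y"
      unfolding chart_inv_image[OF c(1) Y] using c(2) r(1) by simp
    ultimately show ?thesis by blast
  qed
  then obtain U where U: "\<And>p. open (U p)" "\<And>p. p \<in> U p" "\<And>p. emeasure vol (U p) < \<infinity>"
    by metis
  obtain I where I: "finite I" "UNIV \<subseteq> (\<Union>p\<in>I. U p)"
  proof (rule compactE_image[OF compact_UNIV, of UNIV U])
    show "UNIV \<subseteq> (\<Union>p. U p)" using U(2) by blast
  qed (use U(1) in simp_all)
  have "emeasure vol UNIV \<le> emeasure vol (\<Union>p\<in>I. U p)"
    using I(2) U(1) by (intro emeasure_mono sets.countable_UN'') (auto simp: sets_vol I(1) countable_finite)
  also have "\<dots> \<le> (\<Sum>p\<in>I. emeasure vol (U p))"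
    using I(1) U(1) by (intro emeasure_subadditive_finite) (auto simp: sets_vol)
  also have "\<dots> < \<infinity>" using U(3) I(1) by (simp add: ennreal_sum_less_top)
  finally show ?thesis .
qed

lemma vol_chart_ball_pos:
  assumes c: "c \<in> A" and r: "0 < r" "ball q r \<subseteq> coords c"
  shows "0 < emeasure vol (chart_inv c ` ball q r)"
proof -
  have sub: "cball q (r / 2) \<subseteq> coords c" using r by (force simp: subset_iff)
  obtain a where a: "0 < a" "\<forall>y\<in>cball q (r / 2). a \<le> vol_density c y"
    using vol_density_bounds[OF c compact_cball sub] by blast
  have "0 < ennreal a * emeasure lborel (cball q (r / 2))"
    using a r(1) content_cball_pos[of "r / 2" q]
    by (simp add: ennreal_zero_less_mult_iff emeasure_cball unit_ball_vol_pos)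
  also have "\<dots> \<le> emeasure vol (chart_inv c ` cball q (r / 2))"
    using a(2) by (intro emeasure_vol_chart_ge[OF c _ sub]) auto
  also have "\<dots> \<le> emeasure vol (chart_inv c ` ball q r)"
    using r by (intro emeasure_mono image_mono) (auto simp: sets_vol intro!: chart_inv_image_borel[OF c])
  finally show ?thesis .
qed

lemma vol_pos: "0 < emeasure vol UNIV"
proof -
  obtain c where c: "c \<in> A" "undefined \<in> fst c" using chart_exists by blast
  obtain r where r: "0 < r" "cball (snd c undefined) r \<subseteq> coords c" using cball_in_chart[OF c] .
  have "0 < emeasure vol (chart_inv c ` ball (snd c undefined) r)"
    using r ball_subset_cball by (intro vol_chart_ball_pos[OF c(1)]) blast+
  also have "\<dots> \<le> emeasure vol UNIV"
    by (intro emeasure_mono) (auto simp: sets_vol)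
  finally show ?thesis .
qed

lemma sets_normalized: "sets (normalized_volume vol) = sets borel"
  by (simp add: normalized_volume_def sets_vol)

lemma AE_normalized: "AE p in vol. P p \<Longrightarrow> AE p in normalized_volume vol. P p"
  unfolding normalized_volume_def using finite_vol vol_pos
  by (intro AE_uniform_measureI) (auto simp: space_vol sets_vol)

lemma emeasure_normalized:
  assumes "S \<in> sets borel"
  shows "emeasure (normalized_volume vol) S = emeasure vol S / emeasure vol UNIV"
  unfolding normalized_volume_def using assms
  by (subst emeasure_uniform_measure) (auto simp: space_vol sets_vol)

section \<open>Differentials of functions of class C1\<close>

definition chart_d :: "('m \<Rightarrow> complex) \<Rightarrow> ('m, 'n) chart \<Rightarrow> 'm \<Rightarrow> complex ^ 'n" where
  "chart_d v c p = (\<chi> i. frechet_derivative (v \<circ> chart_inv c) (at (snd c p)) (axis i 1))"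

definition C1_function :: "('m \<Rightarrow> complex) \<Rightarrow> bool" where
  "C1_function v \<longleftrightarrow> (\<forall>c\<in>A. (\<forall>y\<in>coords c. (v \<circ> chart_inv c) differentiable (at y)) \<and>
     (\<forall>u. continuous_on (coords c) (\<lambda>y. frechet_derivative (v \<circ> chart_inv c) (at y) u)))"

lemma covector_field_chart_d:
  assumes v: "C1_function v"
  shows "covector_field A (chart_d v)"
  unfolding covector_field_def
proof (intro ballI allI)
  fix c c' p i assume c: "c \<in> A" and c': "c' \<in> A" and p: "p \<in> fst c \<inter> fst c'"
  let ?J = "transition_jacobian c c' p"
  let ?D = "frechet_derivative (v \<circ> chart_inv c') (at (snd c' p))"
  have D: "((v \<circ> chart_inv c') has_derivative ?D) (at (snd c' p))"
    using v c' p unfolding C1_function_def by (auto simp: frechet_derivative_works[symmetric])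
  have "((v \<circ> chart_inv c') \<circ> (snd c' \<circ> chart_inv c) has_derivative (?D \<circ> (\<lambda>u. ?J *v u))) (at (snd c p))"
    using transition_derivative(1)[OF c c'] p D c
    by (intro diff_chain_at) auto
  then have "((v \<circ> chart_inv c) has_derivative (?D \<circ> (\<lambda>u. ?J *v u))) (at (snd c p))"
  proof (rule has_derivative_transform_within_open)
    show "open (snd c ` (fst c \<inter> fst c'))"
      using c c' by (intro open_chart_image open_Int open_domain) auto
    show "snd c p \<in> snd c ` (fst c \<inter> fst c')" using p by blast
    fix y assume "y \<in> snd c ` (fst c \<inter> fst c')"
    then show "(v \<circ> chart_inv c' \<circ> (snd c' \<circ> chart_inv c)) y = (v \<circ> chart_inv c) y"
      using c c' by auto
  qed
  from frechet_derivative_at[OF this]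
  have "chart_d v c p $ i = ?D (?J *v axis i 1)"
    by (simp add: chart_d_def o_def fun_eq_iff)
  also have "?J *v axis i 1 = (\<Sum>k\<in>UNIV. ?J $ k $ i *\<^sub>R axis k 1)"
    using basis_expansion[of "column i ?J"]
    by (simp add: matrix_vector_mult_basis column_def scalar_mult_eq_scaleR)
  also have "?D \<dots> = (\<Sum>k\<in>UNIV. ?J $ k $ i *\<^sub>R ?D (axis k 1))"
    using has_derivative_linear[OF D] by (simp add: linear_sum linear_cmul)
  finally show "chart_d v c p $ i = (\<Sum>k\<in>UNIV. complex_of_real (?J $ k $ i) * chart_d v c' p $ k)"
    by (simp add: chart_d_def scaleR_conv_of_real)
qed

lemma weak_differential_chart_d:
  assumes v: "C1_function v"
  shows "weak_differential A v (chart_d v)"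
  unfolding weak_differential_def
proof (intro conjI ballI covector_field_chart_d[OF v])
  fix c assume c: "c \<in> A"
  have "weak_gradient_on (coords c) (v \<circ> chart_inv c) (\<lambda>y. chart_d v c (chart_inv c y))"
  proof (rule weak_gradient_on_C1[OF open_coords[OF c]])
    show "(v \<circ> chart_inv c has_derivative frechet_derivative (v \<circ> chart_inv c) (at y)) (at y)"
      if "y \<in> coords c" for y
      using v c that unfolding C1_function_def frechet_derivative_works[symmetric] by blast
    show "continuous_on (coords c) (\<lambda>y. frechet_derivative (v \<circ> chart_inv c) (at y) (axis i 1))" for i
      using v c unfolding C1_function_def by blast
    show "chart_d v c (chart_inv c y) $ i = frechet_derivative (v \<circ> chart_inv c) (at y) (axis i 1)"
      if "y \<in> coords c" for y i
      using that by (simp add: chart_d_def chart_chart_inv[OF c])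
  qed
  then show "weak_gradient_on (coords c) (\<lambda>y. v (chart_inv c y)) (\<lambda>y. chart_d v c (chart_inv c y))"
    by (simp add: o_def)
qed

text \<open>
  Uniqueness holds in each chart, and finitely many charts suffice by compactness. The conclusion
  mentions one chart per point only, which is what chart-independent norms require; agreement in all
  charts at once would involve a possibly uncountable union of null sets.
\<close>

lemma weak_differential_unique:
  assumes \<omega>: "weak_differential A v \<omega>" and \<omega>': "weak_differential A v \<omega>'"
  shows "AE p in vol. \<exists>c\<in>A. p \<in> fst c \<and> \<omega> c p = \<omega>' c p"
proof -
  have chart: "AE p in vol. p \<in> fst c \<longrightarrow> \<omega> c p = \<omega>' c p" if c: "c \<in> A" for c
  proof -
    have "AE y in lebesgue. y \<in> coords c \<longrightarrow> \<omega> c (chart_inv c y) = \<omega>' c (chart_inv c y)"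
      using \<omega> \<omega>' c unfolding weak_differential_def
      by (intro weak_gradient_on_unique[OF open_coords[OF c]]) blast+
    from AE_vol_chart[OF c this] show ?thesis
      by eventually_elim (simp add: chart_inv_chart[OF c])
  qed
  obtain C where C: "C \<subseteq> A" "finite C" "UNIV \<subseteq> (\<Union>c\<in>C. fst c)"
  proof (rule compactE_image[OF compact_UNIV, of A fst])
    show "open (fst c)" if "c \<in> A" for c using open_domain[OF that] .
    show "UNIV \<subseteq> (\<Union>c\<in>A. fst c)" using chart_exists by blast
  qed
  have "AE p in vol. \<forall>c\<in>C. p \<in> fst c \<longrightarrow> \<omega> c p = \<omega>' c p"
    using C(1,2) chart by (subst AE_ball_countable) (auto intro: countable_finite)
  then show ?thesis
    by eventually_elim (use C(1,3) in blast)
qed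

lemma norm_weak_d_C1:
  assumes v: "C1_function v" and G: "endomorphism_field A G"
  shows "AE p in vol. elliptic_covector_norm A g G (weak_d A v) p =
    elliptic_covector_norm A g G (chart_d v) p"
proof -
  have w: "weak_differential A v (weak_d A v)"
    unfolding weak_d_def by (rule someI[where P = "weak_differential A v", OF weak_differential_chart_d[OF v]])
  from weak_differential_unique[OF w weak_differential_chart_d[OF v]]
  show ?thesis
  proof eventually_elim
    case (elim p)
    then obtain c where "c \<in> A" "p \<in> fst c" "weak_d A v c p = chart_d v c p" by blast
    then show ?case
      using w covector_field_chart_d[OF v] G
      by (simp add: elliptic_covector_norm_chart weak_differential_def)
  qed
qed

end

context closed_riemannian_manifold
begin

section \<open>Functions transplanted from a chart\<close>

text \<open>
  A function on coordinate space is transplanted to the manifold, extended by zero outside the chart.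
  For a \<open>C\<^sup>1\<close> function \<open>\<Phi>\<close> supported in a compact part \<open>K\<close> of the chart, the result is \<open>C\<^sup>1\<close> with the
  same support; this is verified in an arbitrary second chart, on the two open sets where the
  transition map to \<open>c\<close> is defined and where the transplanted function vanishes.
\<close>

definition lift :: "('m, 'n) chart \<Rightarrow> (real ^ 'n \<Rightarrow> real) \<Rightarrow> 'm \<Rightarrow> real" where
  "lift c \<Phi> p = (if p \<in> fst c then \<Phi> (snd c p) else 0)"

context
  fixes c :: "('m, 'n) chart" and K :: "(real ^ 'n) set"
    and \<Phi> :: "real ^ 'n \<Rightarrow> real" and grad :: "real ^ 'n \<Rightarrow> real ^ 'n"
  assumes c: "c \<in> A" and K: "compact K" "K \<subseteq> coords c"
    and deriv: "\<And>y. (\<Phi> has_derivative (\<lambda>u. grad y \<bullet> u)) (at y)"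
    and cont_grad: "continuous_on UNIV grad"
    and supp: "\<And>y. y \<notin> K \<Longrightarrow> \<Phi> y = 0"
begin

lemma grad_zero: "y \<notin> K \<Longrightarrow> grad y = 0"
proof -
  assume y: "y \<notin> K"
  have "(\<Phi> has_derivative (\<lambda>_. 0)) (at y)"
    by (rule has_derivative_zero_outside[OF compact_imp_closed[OF K(1)] supp y])
  from has_derivative_unique[OF deriv this] have "grad y \<bullet> grad y = 0" by metis
  then show ?thesis by simp
qed

lemma closed_support: "closed (chart_inv c ` K)"
  by (intro compact_imp_closed compact_chart_inv_image c K)

lemma lift_zero: "p \<notin> chart_inv c ` K \<Longrightarrow> lift c \<Phi> p = 0"
  using supp unfolding chart_inv_image[OF c K(2)] by (auto simp: lift_def)

lemma continuous_lift: "continuous_on UNIV (lift c \<Phi>)"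
proof -
  have "continuous_on UNIV \<Phi>"
    by (intro continuous_at_imp_continuous_on ballI has_derivative_continuous[OF deriv])
  then have "continuous_on (fst c) (\<lambda>p. \<Phi> (snd c p))"
    by (rule continuous_on_compose2) (auto intro: continuous_chart c)
  then have 1: "continuous_on (fst c) (lift c \<Phi>)"
    by (rule continuous_on_eq) (simp add: lift_def)
  have 2: "continuous_on (- chart_inv c ` K) (lift c \<Phi>)"
    by (rule continuous_on_eq[OF continuous_on_const[of _ 0]]) (simp add: lift_zero)
  have "fst c \<union> - chart_inv c ` K = UNIV"
    unfolding chart_inv_image[OF c K(2)] by blast
  then show ?thesis
    using continuous_on_open_Un[OF open_domain[OF c] open_Compl[OF closed_support] 1 2] by simp
qed

lemma lift_derivative_inside:
  assumes c': "c' \<in> A" and p: "p \<in> fst c'" "p \<in> fst c"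
  shows "(((\<lambda>p. complex_of_real (lift c \<Phi> p)) \<circ> chart_inv c') has_derivative
    (\<lambda>u. complex_of_real (grad (snd c p) \<bullet> (frechet_derivative (snd c \<circ> chart_inv c') (at (snd c' p)) u))))
    (at (snd c' p))"
proof -
  let ?\<tau> = "snd c \<circ> chart_inv c'" and ?y = "snd c' p"
  have \<tau>: "(?\<tau> has_derivative frechet_derivative ?\<tau> (at ?y)) (at ?y)"
    using transition_derivative(1)[OF c' c p] differentiable_def frechet_derivative_works by blast
  have "?\<tau> ?y = snd c p" using p by (simp add: chart_inv_chart[OF c'])
  then have "((\<Phi> \<circ> ?\<tau>) has_derivative ((\<lambda>u. grad (snd c p) \<bullet> u) \<circ> frechet_derivative ?\<tau> (at ?y))) (at ?y)"
    using deriv by (intro diff_chain_at[OF \<tau>]) simp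
  then have "((\<lambda>y. complex_of_real ((\<Phi> \<circ> ?\<tau>) y)) has_derivative
      (\<lambda>u. complex_of_real (grad (snd c p) \<bullet> frechet_derivative ?\<tau> (at ?y) u))) (at ?y)"
    using has_derivative_of_real by (fastforce simp: o_def)
  then show ?thesis
  proof (rule has_derivative_transform_within_open)
    show "open (snd c' ` (fst c' \<inter> fst c))"
      using c c' by (intro open_chart_image open_Int open_domain) auto
    show "?y \<in> snd c' ` (fst c' \<inter> fst c)" using p by blast
    fix y assume "y \<in> snd c' ` (fst c' \<inter> fst c)"
    then show "complex_of_real ((\<Phi> \<circ> ?\<tau>) y) = ((\<lambda>p. complex_of_real (lift c \<Phi> p)) \<circ> chart_inv c') y"
      using chart_inv_chart[OF c'] by (auto simp: lift_def)
  qed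
qed

lemma lift_derivative_outside:
  assumes c': "c' \<in> A" and p: "p \<in> fst c'" "p \<notin> chart_inv c ` K"
  shows "(((\<lambda>p. complex_of_real (lift c \<Phi> p)) \<circ> chart_inv c') has_derivative (\<lambda>_. 0)) (at (snd c' p))"
proof -
  have "((\<lambda>_. 0) has_derivative (\<lambda>_. 0)) (at (snd c' p))" by simp
  then show ?thesis
  proof (rule has_derivative_transform_within_open)
    show "open (snd c' ` (fst c' - chart_inv c ` K))"
      using c' by (intro open_chart_image open_Diff open_domain closed_support) auto
    show "snd c' p \<in> snd c' ` (fst c' - chart_inv c ` K)" using p by blast
    fix y assume "y \<in> snd c' ` (fst c' - chart_inv c ` K)"
    then show "0 = ((\<lambda>p. complex_of_real (lift c \<Phi> p)) \<circ> chart_inv c') y"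
      using chart_inv_chart[OF c'] lift_zero by auto
  qed
qed

lemma C1_function_lift: "C1_function (\<lambda>p. complex_of_real (lift c \<Phi> p))"
  unfolding C1_function_def
proof (intro ballI conjI allI)
  fix c' assume c': "c' \<in> A"
  let ?v = "(\<lambda>p. complex_of_real (lift c \<Phi> p)) \<circ> chart_inv c'"
  let ?\<tau> = "snd c \<circ> chart_inv c'"
  let ?W = "snd c' ` (fst c' \<inter> fst c)" and ?W' = "snd c' ` (fst c' - chart_inv c ` K)"
  have cover: "coords c' \<subseteq> ?W \<union> ?W'"
    unfolding chart_inv_image[OF c K(2)] by blast
  show "?v differentiable (at y)" if y: "y \<in> coords c'" for y
  proof -
    obtain p where p: "p \<in> fst c'" "y = snd c' p" using y by blast
    show ?thesis
    proof (cases "p \<in> chart_inv c ` K")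
      case True
      then have "p \<in> fst c" unfolding chart_inv_image[OF c K(2)] by blast
      from lift_derivative_inside[OF c' p(1) this] show ?thesis
        using p(2) differentiable_def by blast
    next
      case False
      from lift_derivative_outside[OF c' p(1) this] show ?thesis
        using p(2) differentiable_def by blast
    qed
  qed
  fix u
  have "continuous_on ?W (\<lambda>y. frechet_derivative ?v (at y) u)"
  proof -
    have sub: "?W \<subseteq> coords c'" by blast
    have "continuous_on ?W ?\<tau>"
    proof (rule continuous_on_compose)
      show "continuous_on ?W (chart_inv c')"
        by (rule continuous_on_subset[OF continuous_chart_inv[OF c'] sub])
      show "continuous_on (chart_inv c' ` ?W) (snd c)"
        by (rule continuous_on_subset[OF continuous_chart[OF c]])
          (auto simp: chart_inv_chart[OF c'])
    qed
    then have "continuous_on ?W (\<lambda>y. grad (?\<tau> y))"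
      by (intro continuous_on_compose2[OF cont_grad]) auto
    then have "continuous_on ?W (\<lambda>y. complex_of_real (grad (?\<tau> y) \<bullet> frechet_derivative ?\<tau> (at y) u))"
      by (intro continuous_intros continuous_transition_derivative c c')
    then show ?thesis
    proof (rule continuous_on_eq)
      fix y assume "y \<in> ?W"
      then obtain p where p: "p \<in> fst c'" "p \<in> fst c" "y = snd c' p" by blast
      have "?\<tau> y = snd c p" using p by (simp add: chart_inv_chart[OF c'])
      then show "complex_of_real (grad (?\<tau> y) \<bullet> frechet_derivative ?\<tau> (at y) u) =
          frechet_derivative ?v (at y) u"
        using fun_cong[OF frechet_derivative_at[OF lift_derivative_inside[OF c' p(1,2)]], of u] p(3)
        by simp
    qed
  qed
  moreover have "continuous_on ?W' (\<lambda>y. frechet_derivative ?v (at y) u)"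
  proof (rule continuous_on_eq[OF continuous_on_const[of _ 0]])
    fix y assume "y \<in> ?W'"
    then obtain p where p: "p \<in> fst c'" "p \<notin> chart_inv c ` K" "y = snd c' p" by blast
    show "0 = frechet_derivative ?v (at y) u"
      using fun_cong[OF frechet_derivative_at[OF lift_derivative_outside[OF c' p(1,2)]], of u] p(3)
      by simp
  qed
  moreover have "open ?W" "open ?W'"
    using c c' by (intro open_chart_image open_Int open_Diff open_domain closed_support; simp)+
  ultimately have "continuous_on (?W \<union> ?W') (\<lambda>y. frechet_derivative ?v (at y) u)"
    by (intro continuous_on_open_Un)
  then show "continuous_on (coords c') (\<lambda>y. frechet_derivative ?v (at y) u)"
    by (rule continuous_on_subset[OF _ cover])
qed

lemma norm_chart_d_lift:
  assumes p: "p \<in> fst c"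
  shows "norm (chart_d (\<lambda>p. complex_of_real (lift c \<Phi> p)) c p) = norm (grad (snd c p))"
proof -
  let ?v = "\<lambda>p. complex_of_real (lift c \<Phi> p)"
  have "((\<lambda>y. complex_of_real (\<Phi> y)) has_derivative (\<lambda>u. complex_of_real (grad (snd c p) \<bullet> u))) (at (snd c p))"
    by (intro has_derivative_of_real deriv)
  then have "(?v \<circ> chart_inv c has_derivative (\<lambda>u. complex_of_real (grad (snd c p) \<bullet> u))) (at (snd c p))"
  proof (rule has_derivative_transform_within_open[OF _ open_coords[OF c]])
    show "snd c p \<in> coords c" using p by blast
    show "complex_of_real (\<Phi> y) = (?v \<circ> chart_inv c) y" if "y \<in> coords c" for y
      using that chart_chart_inv[OF c that] chart_inv_in[OF c that] by (simp add: lift_def)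
  qed
  from frechet_derivative_at[OF this, symmetric]
  have "chart_d ?v c p $ i = complex_of_real (grad (snd c p) $ i)" for i
    by (simp add: chart_d_def inner_axis)
  then show ?thesis by (simp add: norm_vec_def)
qed

lemma elliptic_norm_lift_outside:
  assumes G: "endomorphism_field A G" and p: "p \<notin> chart_inv c ` K"
  shows "elliptic_covector_norm A g G (chart_d (\<lambda>p. complex_of_real (lift c \<Phi> p))) p = 0"
proof -
  have "chart_d (\<lambda>p. complex_of_real (lift c \<Phi> p)) (chart_at A p) p = 0"
    using fun_cong[OF frechet_derivative_at[OF lift_derivative_outside[OF chart_at(1,2) p]]]
    by (simp add: chart_d_def vec_eq_iff)
  then show ?thesis
    unfolding elliptic_covector_norm_def by (simp add: complex_dual_norm_0 elliptic_inner_0)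
qed

text \<open>
  At almost every point the elliptic norm of the differential is comparable to the Euclidean norm of the
  coordinate gradient: the ellipticity bound compares it with the Riemannian norm, and \<open>a\<close> and \<open>b\<close>
  compare the latter with the Euclidean one.
\<close>

lemma elliptic_norm_lift_bounds:
  assumes G: "bounded_elliptic_structure A g vol \<Lambda> G"
    and ab: "0 < a" "0 < b" "\<forall>y\<in>K. \<forall>u. a * (norm u)\<^sup>2 \<le> metric_inner g c (chart_inv c y) u u \<and>
      metric_inner g c (chart_inv c y) u u \<le> b * (norm u)\<^sup>2"
  shows "AE p in vol. p \<in> fst c \<longrightarrow>
    inverse \<Lambda> / sqrt b * norm (grad (snd c p))
      \<le> elliptic_covector_norm A g G (weak_d A (\<lambda>p. complex_of_real (lift c \<Phi> p))) p"
   and "AE p in vol.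
    elliptic_covector_norm A g G (weak_d A (\<lambda>p. complex_of_real (lift c \<Phi> p))) p
      \<le> (if p \<in> fst c then \<Lambda> / sqrt a * norm (grad (snd c p)) else 0)"
proof -
  let ?v = "\<lambda>p. complex_of_real (lift c \<Phi> p)"
  have endo: "endomorphism_field A G" and \<Lambda>: "\<Lambda> \<ge> 1"
    and bound: "AE p in vol. \<forall>c\<in>A. p \<in> fst c \<longrightarrow> (\<forall>\<xi>.
        inverse \<Lambda> * dual_norm (metric_inner g c p) \<xi> \<le> dual_norm (elliptic_inner g G c p) \<xi> \<and>
        dual_norm (elliptic_inner g G c p) \<xi> \<le> \<Lambda> * dual_norm (metric_inner g c p) \<xi>)"
    using G by (simp_all add: bounded_elliptic_structure_def elliptic_field_def ellipticity_bound_def)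
  have "AE p in vol. (p \<in> fst c \<longrightarrow> inverse \<Lambda> / sqrt b * norm (grad (snd c p))
      \<le> elliptic_covector_norm A g G (weak_d A ?v) p) \<and>
    elliptic_covector_norm A g G (weak_d A ?v) p
      \<le> (if p \<in> fst c then \<Lambda> / sqrt a * norm (grad (snd c p)) else 0)"
    using bound norm_weak_d_C1[OF C1_function_lift endo]
  proof eventually_elim
    case (elim p)
    show ?case
    proof (cases "p \<in> chart_inv c ` K")
      case False
      then have "elliptic_covector_norm A g G (weak_d A ?v) p = 0"
        using elim(2) elliptic_norm_lift_outside[OF endo] by simp
      moreover have "grad (snd c p) = 0" if "p \<in> fst c"
        using False that unfolding chart_inv_image[OF c K(2)] by (intro grad_zero) blast
      ultimately show ?thesis by simp
    next
      case True
      then have p: "p \<in> fst c" "snd c p \<in> K"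
        unfolding chart_inv_image[OF c K(2)] by auto
      have lower: "a * (norm u)\<^sup>2 \<le> metric_inner g c p u u"
        and upper: "metric_inner g c p u u \<le> b * (norm u)\<^sup>2" for u
        using ab(3) p chart_inv_chart[OF c p(1)] by metis+
      have dual: "0 \<le> dual_norm (metric_inner g c p) \<xi>"
        "dual_norm (metric_inner g c p) \<xi> \<le> norm \<xi> / sqrt a"
        "norm \<xi> / sqrt b \<le> dual_norm (metric_inner g c p) \<xi>" for \<xi>
        using dual_norm_nonneg[where B = "metric_inner g c p", OF ab(1) lower metric_inner_0]
          dual_norm_le[where B = "metric_inner g c p", OF ab(1) lower metric_inner_0]
          dual_norm_ge_norm[where B = "metric_inner g c p", OF ab(1) lower metric_inner_0 ab(2) upper]
        by auto
      have ell: "inverse \<Lambda> * dual_norm (metric_inner g c p) \<xi> \<le> dual_norm (elliptic_inner g G c p) \<xi>"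
        "dual_norm (elliptic_inner g G c p) \<xi> \<le> \<Lambda> * dual_norm (metric_inner g c p) \<xi>" for \<xi>
        using elim(1) c p(1) by auto
      have "inverse \<Lambda> / sqrt b * norm \<xi> \<le> dual_norm (elliptic_inner g G c p) \<xi>" for \<xi>
      proof -
        have "inverse \<Lambda> * (norm \<xi> / sqrt b) \<le> inverse \<Lambda> * dual_norm (metric_inner g c p) \<xi>"
          using dual(3) \<Lambda> by (intro mult_left_mono) auto
        then show ?thesis using ell(1)[of \<xi>] by simp
      qed
      moreover have "dual_norm (elliptic_inner g G c p) \<xi> \<le> \<Lambda> / sqrt a * norm \<xi>" for \<xi>
      proof -
        have "\<Lambda> * dual_norm (metric_inner g c p) \<xi> \<le> \<Lambda> * (norm \<xi> / sqrt a)"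
          using dual(2) \<Lambda> by (intro mult_left_mono) auto
        then show ?thesis using ell(2)[of \<xi>] by simp
      qed
      moreover have "0 \<le> dual_norm (elliptic_inner g G c p) \<xi>" for \<xi>
      proof -
        have "0 \<le> inverse \<Lambda> * dual_norm (metric_inner g c p) \<xi>"
          using dual(1) \<Lambda> by (intro mult_nonneg_nonneg) auto
        then show ?thesis using ell(1)[of \<xi>] by linarith
      qed
      moreover have "elliptic_covector_norm A g G (weak_d A ?v) p =
          complex_dual_norm (elliptic_inner g G c p) (chart_d ?v c p)"
        using elim(2) elliptic_covector_norm_chart[OF endo covector_field_chart_d[OF C1_function_lift] c p(1)]
        by simp
      ultimately show ?thesis
        using \<Lambda> ab(1,2) p(1) norm_chart_d_lift[OF p(1)]
          complex_dual_norm_le[of "\<Lambda> / sqrt a" "elliptic_inner g G c p" "chart_d ?v c p"]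
          complex_dual_norm_ge[of "inverse \<Lambda> / sqrt b" "elliptic_inner g G c p" "chart_d ?v c p"]
        by auto
    qed
  qed
  then show "AE p in vol. p \<in> fst c \<longrightarrow> inverse \<Lambda> / sqrt b * norm (grad (snd c p))
      \<le> elliptic_covector_norm A g G (weak_d A ?v) p"
    "AE p in vol. elliptic_covector_norm A g G (weak_d A ?v) p
      \<le> (if p \<in> fst c then \<Lambda> / sqrt a * norm (grad (snd c p)) else 0)"
    by (eventually_elim; simp)+
qed

text \<open>
  The integrand is dominated by a step function on Borel sets \<open>Y k\<close>, so that only their measures have to
  be estimated and the integrand itself need not be known to be measurable. The measure \<open>M\<close> will be
  both the volume, for membership in the Sobolev space, and its normalization, for the energy.
\<close>

lemma energy_integral_le:
  assumes G: "bounded_elliptic_structure A g vol \<Lambda> G"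
    and a: "0 < a" "\<forall>y\<in>K. \<forall>u. a * (norm u)\<^sup>2 \<le> metric_inner g c (chart_inv c y) u u"
    and d: "\<forall>y\<in>K. vol_density c y \<le> d"
    and I: "finite I" "\<And>k. k \<in> I \<Longrightarrow> Y k \<in> sets borel" "\<And>k. k \<in> I \<Longrightarrow> Y k \<subseteq> K"
    and s: "\<And>k. k \<in> I \<Longrightarrow> 0 \<le> s k"
      "\<And>y. norm (grad y) ^ CARD('n) \<le> (\<Sum>k\<in>I. s k * indicator (Y k) y)"
    and M: "sets M = sets borel" "\<And>P. (AE p in vol. P p) \<Longrightarrow> (AE p in M. P p)"
      "\<And>S. S \<in> sets borel \<Longrightarrow> emeasure M S \<le> ennreal r * emeasure vol S"
    and r: "0 \<le> r"
  shows "(\<integral>\<^sup>+p. ennreal (elliptic_covector_norm A g G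
        (weak_d A (\<lambda>p. complex_of_real (lift c \<Phi> p))) p ^ CARD('n)) \<partial>M)
    \<le> ennreal (r * d * (\<Lambda> / sqrt a) ^ CARD('n)) * (\<Sum>k\<in>I. ennreal (s k) * emeasure lborel (Y k))"
proof -
  let ?n = "CARD('n)" and ?l = "\<Lambda> / sqrt a"
  let ?N = "elliptic_covector_norm A g G (weak_d A (\<lambda>p. complex_of_real (lift c \<Phi> p)))"
  have \<Lambda>: "\<Lambda> \<ge> 1"
    using G by (simp add: bounded_elliptic_structure_def ellipticity_bound_def)
  obtain b where b: "0 < b"
      "\<forall>y\<in>K. \<forall>u. metric_inner g c (chart_inv c y) u u \<le> b * (norm u)\<^sup>2"
    using metric_bounds[OF c K] by blast
  have "AE p in M. ennreal (?N p ^ ?n) \<le>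
      (\<Sum>k\<in>I. ennreal (?l ^ ?n * s k) * indicator (chart_inv c ` Y k) p)"
  proof (rule M(2))
    have "AE p in vol. ?N p \<le> (if p \<in> fst c then ?l * norm (grad (snd c p)) else 0)"
      by (rule elliptic_norm_lift_bounds(2)[OF G a(1) b(1)]) (use a(2) b(2) in blast)
    then show "AE p in vol. ennreal (?N p ^ ?n) \<le>
      (\<Sum>k\<in>I. ennreal (?l ^ ?n * s k) * indicator (chart_inv c ` Y k) p)"
    proof eventually_elim
      case (elim p)
      have N0: "0 \<le> ?N p"
        by (simp add: elliptic_covector_norm_def complex_dual_norm_nonneg)
      show ?case
      proof (cases "p \<in> fst c")
        case False
        then have "?N p = 0" using elim N0 by simp
        then show ?thesis by (simp add: zero_power)
      next
        case True
        have ind: "indicator (Y k) (snd c p) = (indicator (chart_inv c ` Y k) p :: real)" if "k \<in> I" for k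
          using True I(3)[OF that] K(2) chart_inv_image[OF c, of "Y k"] by (auto simp: indicator_def)
        have "?N p ^ ?n \<le> (?l * norm (grad (snd c p))) ^ ?n"
          using elim N0 True by (intro power_mono) auto
        also have "\<dots> = ?l ^ ?n * norm (grad (snd c p)) ^ ?n"
          by (rule power_mult_distrib)
        also have "\<dots> \<le> ?l ^ ?n * (\<Sum>k\<in>I. s k * indicator (Y k) (snd c p))"
          using s(2) \<Lambda> a(1) by (intro mult_left_mono) auto
        also have "\<dots> = (\<Sum>k\<in>I. ?l ^ ?n * s k * indicator (chart_inv c ` Y k) p)"
          unfolding sum_distrib_left by (intro sum.cong) (auto simp: ind)
        finally have "ennreal (?N p ^ ?n) \<le> ennreal (\<Sum>k\<in>I. ?l ^ ?n * s k * indicator (chart_inv c ` Y k) p)"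
          by (rule ennreal_leI)
        also have "\<dots> = (\<Sum>k\<in>I. ennreal (?l ^ ?n * s k * indicator (chart_inv c ` Y k) p))"
          using s(1) \<Lambda> a(1) by (intro sum_ennreal[symmetric]) auto
        also have "\<dots> = (\<Sum>k\<in>I. ennreal (?l ^ ?n * s k) * indicator (chart_inv c ` Y k) p)"
          using s(1) \<Lambda> a(1) by (intro sum.cong) (auto simp: indicator_def)
        finally show ?thesis .
      qed
    qed
  qed
  then have "(\<integral>\<^sup>+p. ennreal (?N p ^ ?n) \<partial>M) \<le>
      (\<integral>\<^sup>+p. (\<Sum>k\<in>I. ennreal (?l ^ ?n * s k) * indicator (chart_inv c ` Y k) p) \<partial>M)"
    by (rule nn_integral_mono_AE)
  also have "\<dots> = (\<Sum>k\<in>I. ennreal (?l ^ ?n * s k) * emeasure M (chart_inv c ` Y k))"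
  proof -
    have meas: "chart_inv c ` Y k \<in> sets M" if "k \<in> I" for k
      unfolding M(1) using I(2,3)[OF that] K(2) by (intro chart_inv_image_borel[OF c]) auto
    then have "(\<integral>\<^sup>+p. (\<Sum>k\<in>I. ennreal (?l ^ ?n * s k) * indicator (chart_inv c ` Y k) p) \<partial>M) =
      (\<Sum>k\<in>I. (\<integral>\<^sup>+p. ennreal (?l ^ ?n * s k) * indicator (chart_inv c ` Y k) p \<partial>M))"
      by (intro nn_integral_sum) auto
    also have "\<dots> = (\<Sum>k\<in>I. ennreal (?l ^ ?n * s k) * emeasure M (chart_inv c ` Y k))"
      using meas by (intro sum.cong nn_integral_cmult_indicator) auto
    finally show ?thesis .
  qed
  also have "\<dots> \<le> (\<Sum>k\<in>I. ennreal (?l ^ ?n * s k) * (ennreal r * (ennreal d * emeasure lborel (Y k))))"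
  proof (intro sum_mono mult_left_mono)
    fix k assume k: "k \<in> I"
    have Yk: "Y k \<subseteq> coords c" using I(3)[OF k] K(2) by blast
    have "emeasure M (chart_inv c ` Y k) \<le> ennreal r * emeasure vol (chart_inv c ` Y k)"
      by (intro M(3) chart_inv_image_borel[OF c] I(2)[OF k] Yk)
    also have "\<dots> \<le> ennreal r * (ennreal d * emeasure lborel (Y k))"
      using d I(3)[OF k] by (intro mult_left_mono emeasure_vol_chart_le[OF c I(2)[OF k] Yk]) auto
    finally show "emeasure M (chart_inv c ` Y k) \<le> ennreal r * (ennreal d * emeasure lborel (Y k))" .
  qed simp
  also have "\<dots> = ennreal (r * d * ?l ^ ?n) * (\<Sum>k\<in>I. ennreal (s k) * emeasure lborel (Y k))"
    unfolding sum_distrib_left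
  proof (intro sum.cong refl)
    fix k assume k: "k \<in> I"
    have "0 \<le> ?l ^ ?n" using \<Lambda> a(1) by simp
    then show "ennreal (?l ^ ?n * s k) * (ennreal r * (ennreal d * emeasure lborel (Y k))) =
        ennreal (r * d * ?l ^ ?n) * (ennreal (s k) * emeasure lborel (Y k))"
      using s(1)[OF k] r by (simp add: ennreal_mult' ennreal_mult'' mult_ac)
  qed
  finally show ?thesis .
qed

text \<open>
  Near \<open>y0\<close> the gradient is bounded away from zero by continuity, and coordinate balls have positive
  volume.
\<close>

lemma energy_integral_pos:
  assumes G: "bounded_elliptic_structure A g vol \<Lambda> G" and y0: "grad y0 \<noteq> 0"
  shows "0 < (\<integral>\<^sup>+p. ennreal (elliptic_covector_norm A g G
        (weak_d A (\<lambda>p. complex_of_real (lift c \<Phi> p))) p ^ CARD('n)) \<partial>normalized_volume vol)"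
proof -
  let ?N = "elliptic_covector_norm A g G (weak_d A (\<lambda>p. complex_of_real (lift c \<Phi> p)))"
  have \<Lambda>: "\<Lambda> \<ge> 1"
    using G by (simp add: bounded_elliptic_structure_def ellipticity_bound_def)
  obtain a b where ab: "0 < a" "0 < b"
      "\<forall>y\<in>K. \<forall>u. a * (norm u)\<^sup>2 \<le> metric_inner g c (chart_inv c y) u u \<and>
      metric_inner g c (chart_inv c y) u u \<le> b * (norm u)\<^sup>2"
    using metric_bounds[OF c K] by blast
  define \<delta> where "\<delta> = norm (grad y0) / 2"
  have \<delta>: "0 < \<delta>" using y0 by (simp add: \<delta>_def)
  have "open ((\<lambda>y. norm (grad y)) -` {\<delta><..})"
    using cont_grad by (intro continuous_open_vimage) (auto simp: continuous_on_eq_continuous_at intro!: continuous_intros)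
  moreover have "y0 \<in> (\<lambda>y. norm (grad y)) -` {\<delta><..}" using y0 by (simp add: \<delta>_def)
  ultimately obtain r where r: "0 < r" "ball y0 r \<subseteq> (\<lambda>y. norm (grad y)) -` {\<delta><..}"
    by (metis open_contains_ball)
  have big: "\<delta> < norm (grad y)" if "y \<in> ball y0 r" for y using r(2) that by auto
  have sub: "ball y0 r \<subseteq> coords c"
  proof
    fix y assume "y \<in> ball y0 r"
    then have "grad y \<noteq> 0" using big \<delta> by fastforce
    then show "y \<in> coords c" using grad_zero K(2) by blast
  qed
  let ?S = "chart_inv c ` ball y0 r" and ?e = "inverse \<Lambda> / sqrt b * \<delta>"
  have S: "?S \<in> sets borel" by (intro chart_inv_image_borel[OF c _ sub]) simp
  have e: "0 < ?e" using \<Lambda> ab(2) \<delta> by simp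
  have "AE p in normalized_volume vol. ennreal (?e ^ CARD('n)) * indicator ?S p \<le> ennreal (?N p ^ CARD('n))"
  proof (rule AE_normalized)
    show "AE p in vol. ennreal (?e ^ CARD('n)) * indicator ?S p \<le> ennreal (?N p ^ CARD('n))"
      using elliptic_norm_lift_bounds(1)[OF G ab]
    proof eventually_elim
      case (elim p)
      show ?case
      proof (cases "p \<in> ?S")
        case True
        then have p: "p \<in> fst c" "snd c p \<in> ball y0 r"
          unfolding chart_inv_image[OF c sub] by auto
        have "?e \<le> inverse \<Lambda> / sqrt b * norm (grad (snd c p))"
          using big[OF p(2)] \<Lambda> ab(2) by (intro mult_left_mono) auto
        then have "?e \<le> ?N p" using elim p(1) by simp
        then have "?e ^ CARD('n) \<le> ?N p ^ CARD('n)" using e by (intro power_mono) auto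
        then show ?thesis using True by (simp add: ennreal_leI)
      qed simp
    qed
  qed
  then have "(\<integral>\<^sup>+p. ennreal (?e ^ CARD('n)) * indicator ?S p \<partial>normalized_volume vol) \<le>
      (\<integral>\<^sup>+p. ennreal (?N p ^ CARD('n)) \<partial>normalized_volume vol)"
    by (rule nn_integral_mono_AE)
  moreover have "0 < (\<integral>\<^sup>+p. ennreal (?e ^ CARD('n)) * indicator ?S p \<partial>normalized_volume vol)"
  proof -
    have "0 < emeasure vol ?S" using vol_chart_ball_pos[OF c r(1) sub] .
    then have "0 < emeasure vol ?S / emeasure vol UNIV"
      using finite_vol by (simp add: ennreal_zero_less_divide)
    then have "0 < emeasure (normalized_volume vol) ?S"
      by (simp add: emeasure_normalized[OF S])
    moreover have "0 < ennreal (?e ^ CARD('n))" using e by simp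
    ultimately show ?thesis
      using S by (subst nn_integral_cmult_indicator) (simp_all only: sets_normalized ennreal_zero_less_mult_iff simp_thms)
  qed
  ultimately show ?thesis by (rule less_le_trans[rotated])
qed

end

text \<open>
  The Riemannian norm is itself an elliptic norm, so the estimates for elliptic structures also yield
  finiteness of the Sobolev seminorm.
\<close>

lemma bounded_elliptic_identity: "bounded_elliptic_structure A g vol 1 (\<lambda>_ _. mat 1)"
proof -
  have e: "elliptic_inner g (\<lambda>_ _. mat 1) c p = metric_inner g c p" for c p
    by (simp add: elliptic_inner_def[abs_def] metric_inner_def[abs_def])
  show ?thesis
    unfolding bounded_elliptic_structure_def elliptic_field_def ellipticity_bound_def e
    using endomorphism_field_identity metric
    by (auto simp: metric_inner_def riemannian_metric_def)
qed

end

section \<open>A cascade of radial bumps\<close>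

lemma has_derivative_positive_part_square:
  "((\<lambda>t::real. (max 0 t)\<^sup>2) has_real_derivative 2 * max 0 t) (at t)"
proof (cases t "0::real" rule: linorder_cases)
  case less
  have "((\<lambda>_::real. 0::real) has_real_derivative 0) (at t)" by simp
  then have "((\<lambda>t::real. (max 0 t)\<^sup>2) has_real_derivative 0) (at t)"
    by (rule has_field_derivative_transform_within_open[of _ _ _ "{..<0}"]) (use less in auto)
  then show ?thesis using less by simp
next
  case greater
  have "((\<lambda>t::real. t\<^sup>2) has_real_derivative 2 * t) (at t)"
    by (auto intro!: derivative_eq_intros)
  then have "((\<lambda>t::real. (max 0 t)\<^sup>2) has_real_derivative 2 * t) (at t)"
    by (rule has_field_derivative_transform_within_open[of _ _ _ "{0<..}"]) (use greater in auto)
  then show ?thesis using greater by simp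
next
  case equal
  have "((\<lambda>s::real. max 0 s) \<longlongrightarrow> max 0 0) (at 0)"
    by (intro tendsto_intros)
  then have "((\<lambda>s::real. max 0 s) \<longlongrightarrow> 0) (at 0)" by simp
  then have "((\<lambda>s::real. ((max 0 s)\<^sup>2 - (max 0 0)\<^sup>2) / (s - 0)) \<longlongrightarrow> 0) (at 0)"
    by (rule Lim_transform_eventually)
       (auto simp: eventually_at_filter max_def power2_eq_square)
  then show ?thesis using equal by (simp add: has_field_derivative_iff)
qed

text \<open>
  A piecewise polynomial in \<open>s = |z|\<^sup>2\<close>: it is \<open>1\<close> for \<open>s \<le> 1/4\<close> and \<open>0\<close> for \<open>s \<ge> 1\<close>, and \<open>C\<^sup>1\<close>
  because the square of the positive part is.
\<close>

definition bump_profile :: "real \<Rightarrow> real" where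
  "bump_profile s = (max 0 (1 - (max 0 ((4 * s - 1) / 3))\<^sup>2))\<^sup>2"

definition bump_profile_deriv :: "real \<Rightarrow> real" where
  "bump_profile_deriv s =
     2 * max 0 (1 - (max 0 ((4 * s - 1) / 3))\<^sup>2) * (- (2 * max 0 ((4 * s - 1) / 3) * (4 / 3)))"

lemma bump_profile_has_derivative:
  "(bump_profile has_real_derivative bump_profile_deriv s) (at s)"
proof -
  have "((\<lambda>s::real. (4 * s - 1) / 3) has_real_derivative 4 / 3) (at s)"
    by (auto intro!: derivative_eq_intros)
  from DERIV_chain2[OF has_derivative_positive_part_square this]
  have "((\<lambda>s. 1 - (max 0 ((4 * s - 1) / 3))\<^sup>2) has_real_derivative
      - (2 * max 0 ((4 * s - 1) / 3) * (4 / 3))) (at s)"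
    using DERIV_diff[OF DERIV_const] by fastforce
  from DERIV_chain2[OF has_derivative_positive_part_square this]
  show ?thesis unfolding bump_profile_def bump_profile_deriv_def .
qed

definition bump :: "'a::real_inner \<Rightarrow> real" where
  "bump z = bump_profile (z \<bullet> z)"

definition bump_grad :: "'a::real_inner \<Rightarrow> 'a" where
  "bump_grad z = (2 * bump_profile_deriv (z \<bullet> z)) *\<^sub>R z"

lemma bump_has_derivative:
  fixes z :: "'a::real_inner"
  shows "(bump has_derivative (\<lambda>u. bump_grad z \<bullet> u)) (at z)"
proof -
  have "((\<lambda>z. z \<bullet> z) has_derivative (\<lambda>u. 2 * (z \<bullet> u))) (at z)"
    by (auto intro!: derivative_eq_intros simp: inner_commute)
  moreover have "(bump_profile has_derivative (\<lambda>h. bump_profile_deriv (z \<bullet> z) * h)) (at (z \<bullet> z))"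
    using bump_profile_has_derivative by (simp add: has_field_derivative_def)
  ultimately have "((bump_profile \<circ> (\<lambda>z. z \<bullet> z)) has_derivative
      ((\<lambda>h. bump_profile_deriv (z \<bullet> z) * h) \<circ> (\<lambda>u. 2 * (z \<bullet> u)))) (at z)"
    by (rule diff_chain_at)
  moreover have "bump_profile \<circ> (\<lambda>z::'a. z \<bullet> z) = bump" by (auto simp: bump_def)
  moreover have "(\<lambda>h. bump_profile_deriv (z \<bullet> z) * h) \<circ> (\<lambda>u. 2 * (z \<bullet> u)) = (\<lambda>u. bump_grad z \<bullet> u)"
    by (auto simp: bump_grad_def fun_eq_iff)
  ultimately show ?thesis by simp
qed

lemma continuous_bump_grad: "continuous_on UNIV bump_grad"
  unfolding bump_grad_def[abs_def] bump_profile_deriv_def by (intro continuous_intros) auto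

lemma bump_bounds: "0 \<le> bump z" "bump z \<le> 1"
proof -
  show "0 \<le> bump z" by (simp add: bump_def bump_profile_def)
  show "bump z \<le> 1" unfolding bump_def bump_profile_def
    by (intro power_le_one) auto
qed

lemma bump_0 [simp]: "bump 0 = 1"
  by (simp add: bump_def bump_profile_def)

lemma bump_outside:
  assumes "norm z \<ge> 1"
  shows "bump z = 0" and "bump_grad z = 0"
proof -
  have "1 \<le> z \<bullet> z" using assms by (simp add: dot_square_norm power2_eq_square one_le_mult_iff
      order_trans[OF _ mult_mono'[of 1 "norm z" 1 "norm z"]])
  then have "1 \<le> (max 0 ((4 * (z \<bullet> z) - 1) / 3))\<^sup>2"
    by (intro one_le_power) auto
  then show "bump z = 0" "bump_grad z = 0"
    by (auto simp: bump_def bump_grad_def bump_profile_def bump_profile_deriv_def)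
qed

lemma bump_grad_inside:
  assumes "norm z \<le> 1 / 2"
  shows "bump_grad z = 0"
proof -
  have "z \<bullet> z \<le> (1 / 2)\<^sup>2" using assms by (simp add: dot_square_norm power_mono)
  then show ?thesis by (simp add: bump_grad_def bump_profile_deriv_def power2_eq_square)
qed

lemma norm_bump_grad_le: "norm (bump_grad z) \<le> 32 / 3"
proof (cases "norm z \<ge> 1")
  case True
  then show ?thesis by (simp add: bump_outside)
next
  case False
  then have z: "norm z \<le> 1" "z \<bullet> z \<le> 1"
    using power_le_one[of "norm z" 2] by (auto simp: dot_square_norm)
  let ?w = "max 0 ((4 * (z \<bullet> z) - 1) / 3)"
  have w: "0 \<le> ?w" "?w \<le> 1" using z by auto
  have "\<bar>bump_profile_deriv (z \<bullet> z)\<bar> = 16 / 3 * (max 0 (1 - ?w\<^sup>2) * ?w)"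
    unfolding bump_profile_deriv_def using w(1) by (simp only: abs_mult abs_minus abs_of_nonneg max.cobounded1)
  also have "\<dots> \<le> 16 / 3 * (1 * 1)"
    using w by (intro mult_left_mono mult_mono) auto
  finally have "\<bar>bump_profile_deriv (z \<bullet> z)\<bar> * norm z \<le> 16 / 3 * 1"
    using z(1) by (intro mult_mono) auto
  then show ?thesis by (simp add: bump_grad_def abs_mult mult_ac)
qed

lemma bump_grad_nonzero:
  assumes "1 / 2 < norm z" "norm z < 1"
  shows "bump_grad z \<noteq> 0"
proof -
  have "(1 / 2)\<^sup>2 < z \<bullet> z" using assms unfolding dot_square_norm by (intro power_strict_mono) auto
  moreover have "z \<bullet> z < 1" using assms unfolding dot_square_norm by (simp add: power_less_one_iff)
  ultimately have w: "0 < (4 * (z \<bullet> z) - 1) / 3" "(4 * (z \<bullet> z) - 1) / 3 < 1"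
    by (auto simp: power2_eq_square)
  then have "((4 * (z \<bullet> z) - 1) / 3)\<^sup>2 < 1" by (simp add: power_less_one_iff)
  then have "bump_profile_deriv (z \<bullet> z) \<noteq> 0" using w by (simp add: bump_profile_deriv_def)
  moreover have "z \<noteq> 0" using assms by auto
  ultimately show ?thesis by (simp add: bump_grad_def)
qed

text \<open>
  The \<open>k\<close>-th summand drops from \<open>1\<close> to \<open>0\<close> on the annulus where \<open>|y - q|\<close> lies between
  \<open>R / 2\<^sup>k\<^sup>+\<^sup>1\<close> and \<open>R / 2\<^sup>k\<close>, so the average descends from \<open>1\<close> to \<open>0\<close> like
  \<open>log\<^sub>2 (R / |y - q|) / N\<close>.
\<close>

definition cascade :: "'a::euclidean_space \<Rightarrow> real \<Rightarrow> nat \<Rightarrow> 'a \<Rightarrow> real" where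
  "cascade q R N y = (\<Sum>k<N. bump ((2 ^ k / R) *\<^sub>R (y - q))) / real N"

definition cascade_grad :: "'a::euclidean_space \<Rightarrow> real \<Rightarrow> nat \<Rightarrow> 'a \<Rightarrow> 'a" where
  "cascade_grad q R N y =
     (\<Sum>k<N. (2 ^ k / R) *\<^sub>R bump_grad ((2 ^ k / R) *\<^sub>R (y - q))) /\<^sub>R real N"

lemma cascade_has_derivative:
  "(cascade q R N has_derivative (\<lambda>u. cascade_grad q R N y \<bullet> u)) (at y)"
proof -
  have "((\<lambda>y. bump ((2 ^ k / R) *\<^sub>R (y - q))) has_derivative
      (\<lambda>u. (2 ^ k / R) *\<^sub>R bump_grad ((2 ^ k / R) *\<^sub>R (y - q)) \<bullet> u)) (at y)" for k
  proof -
    have "((\<lambda>y. (2 ^ k / R) *\<^sub>R (y - q)) has_derivative (\<lambda>u. (2 ^ k / R) *\<^sub>R u)) (at y)"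
      by (auto intro!: derivative_eq_intros)
    from diff_chain_at[OF this bump_has_derivative] show ?thesis by (simp add: o_def)
  qed
  then have "((\<lambda>y. (\<Sum>k<N. bump ((2 ^ k / R) *\<^sub>R (y - q))) * inverse (real N)) has_derivative
      (\<lambda>u. (\<Sum>k<N. (2 ^ k / R) *\<^sub>R bump_grad ((2 ^ k / R) *\<^sub>R (y - q)) \<bullet> u) * inverse (real N))) (at y)"
    by (intro has_derivative_mult_left has_derivative_sum)
  moreover have "(\<lambda>u. (\<Sum>k<N. (2 ^ k / R) *\<^sub>R bump_grad ((2 ^ k / R) *\<^sub>R (y - q)) \<bullet> u) * inverse (real N)) =
      (\<lambda>u. cascade_grad q R N y \<bullet> u)"
    by (simp add: cascade_grad_def inner_sum_left mult.commute)
  moreover have "(\<lambda>y. (\<Sum>k<N. bump ((2 ^ k / R) *\<^sub>R (y - q))) * inverse (real N)) = cascade q R N"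
    by (simp add: cascade_def fun_eq_iff divide_inverse)
  ultimately show ?thesis by simp
qed

lemma continuous_cascade_grad: "continuous_on UNIV (cascade_grad q R N)"
  unfolding cascade_grad_def[abs_def]
  by (intro continuous_intros continuous_on_compose2[OF continuous_bump_grad]) auto

context
  fixes R :: real
  assumes R: "R > 0"
begin

lemma cascade_term_outside:
  assumes "R / 2 ^ k \<le> norm (y - q)"
  shows "bump ((2 ^ k / R) *\<^sub>R (y - q)) = 0" "bump_grad ((2 ^ k / R) *\<^sub>R (y - q)) = 0"
proof -
  have "1 \<le> norm ((2 ^ k / R) *\<^sub>R (y - q))"
  proof -
    have "1 \<le> 2 ^ k / R * norm (y - q)" using assms R by (simp add: field_simps)
    then show ?thesis using R by simp
  qed
  then show "bump ((2 ^ k / R) *\<^sub>R (y - q)) = 0" "bump_grad ((2 ^ k / R) *\<^sub>R (y - q)) = 0"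
    by (simp_all add: bump_outside)
qed

lemma cascade_support: "y \<notin> cball q R \<Longrightarrow> cascade q R N y = 0"
proof -
  assume y: "y \<notin> cball q R"
  have "R / 2 ^ k \<le> norm (y - q)" for k
  proof -
    have "R / 2 ^ k \<le> R / 1" using R by (intro divide_left_mono) auto
    moreover have "R < norm (y - q)" using y by (simp add: dist_norm norm_minus_commute)
    ultimately show ?thesis by simp
  qed
  then show ?thesis by (simp add: cascade_def cascade_term_outside)
qed

lemma cascade_bounds: "0 \<le> cascade q R N y" "cascade q R N y \<le> 1"
proof -
  show "0 \<le> cascade q R N y" by (simp add: cascade_def sum_nonneg bump_bounds)
  have "(\<Sum>k<N. bump ((2 ^ k / R) *\<^sub>R (y - q))) \<le> (\<Sum>k<N. 1)"
    by (intro sum_mono bump_bounds)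
  then show "cascade q R N y \<le> 1" by (simp add: cascade_def divide_le_eq)
qed

lemma cascade_center: "N > 0 \<Longrightarrow> cascade q R N q = 1"
  by (simp add: cascade_def)

text \<open>
  Away from the centre, only a number of summands independent of \<open>N\<close> is nonzero.
\<close>

lemma cascade_tendsto_0:
  assumes "y \<noteq> q"
  shows "(\<lambda>N. cascade q R N y) \<longlonglongrightarrow> 0"
proof -
  obtain k0 where k0: "R / norm (y - q) < 2 ^ k0"
    using real_arch_pow[of 2] by auto
  have out: "bump ((2 ^ k / R) *\<^sub>R (y - q)) = 0" if "k0 \<le> k" for k
  proof (rule cascade_term_outside)
    have "(2::real) ^ k0 \<le> 2 ^ k" using that by simp
    then have "R / norm (y - q) \<le> 2 ^ k" using k0 by linarith
    then show "R / 2 ^ k \<le> norm (y - q)" using assms by (simp add: field_simps)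
  qed
  have "cascade q R N y \<le> real k0 / real N" for N
  proof -
    have "(\<Sum>k<N. bump ((2 ^ k / R) *\<^sub>R (y - q))) \<le> (\<Sum>k<N. if k < k0 then 1 else 0)"
      using out by (intro sum_mono) (auto simp: bump_bounds)
    also have "\<dots> = (\<Sum>k\<in>{..<N} \<inter> {..<k0}. 1)"
      by (subst sum.inter_restrict) auto
    also have "\<dots> \<le> real k0"
      using card_mono[of "{..<k0}" "{..<N} \<inter> {..<k0}"] by simp
    finally show ?thesis by (simp add: cascade_def divide_right_mono)
  qed
  moreover have "(\<lambda>N. real k0 / real N) \<longlonglongrightarrow> 0" by (rule lim_const_over_n)
  ultimately show ?thesis
    using tendsto_sandwich[of "\<lambda>_. 0" "\<lambda>N. cascade q R N y" sequentially "\<lambda>N. real k0 / real N" 0]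
    by (simp add: cascade_bounds)
qed

lemma cascade_grad_disjoint:
  assumes k: "bump_grad ((2 ^ k / R) *\<^sub>R (y - q)) \<noteq> 0"
    and l: "bump_grad ((2 ^ l / R) *\<^sub>R (y - q)) \<noteq> 0"
  shows "k = l"
proof -
  have ring: "1 / 2 < 2 ^ i / R * norm (y - q) \<and> 2 ^ i / R * norm (y - q) < 1"
    if "bump_grad ((2 ^ i / R) *\<^sub>R (y - q)) \<noteq> 0" for i
  proof -
    have "norm ((2 ^ i / R) *\<^sub>R (y - q)) = 2 ^ i / R * norm (y - q)" using R by simp
    then show ?thesis
      using that bump_outside(2)[of "(2 ^ i / R) *\<^sub>R (y - q)"]
        bump_grad_inside[of "(2 ^ i / R) *\<^sub>R (y - q)"] by linarith
  qed
  have less: False if "i < j" and i: "1 / 2 < 2 ^ i / R * norm (y - q)"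
    and j: "2 ^ j / R * norm (y - q) < 1" for i j
  proof -
    have "(2::real) ^ Suc i \<le> 2 ^ j" using that(1) by (intro power_increasing) auto
    then have "2 ^ Suc i / R * norm (y - q) \<le> 2 ^ j / R * norm (y - q)"
      using R by (intro mult_right_mono divide_right_mono) auto
    moreover have "2 ^ Suc i / R * norm (y - q) = 2 * (2 ^ i / R * norm (y - q))" by simp
    ultimately show False using i j by linarith
  qed
  show ?thesis
    using ring[OF k] ring[OF l] less[of k l] less[of l k] by (meson linorder_neqE_nat)
qed

text \<open>
  At most one summand contributes to the gradient at a given point. Therefore the \<open>n\<close>-th power of the
  sum is the sum of the \<open>n\<close>-th powers, which is what makes the energy small: one factor \<open>N\<close> from the number of
  summands against \<open>N\<^sup>n\<close> from the averaging.
\<close>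

lemma norm_cascade_grad_le:
  assumes n: "n > 0"
  shows "norm (cascade_grad q R N y) ^ n \<le>
    (\<Sum>k<N. (32 / 3 * 2 ^ k / (R * real N)) ^ n * indicator (cball q (R / 2 ^ k)) y)"
proof (cases "\<exists>k<N. bump_grad ((2 ^ k / R) *\<^sub>R (y - q)) \<noteq> 0")
  case False
  then have "cascade_grad q R N y = 0" by (simp add: cascade_grad_def)
  then show ?thesis using n R by (simp add: zero_power sum_nonneg)
next
  case True
  then obtain k where k: "k < N" "bump_grad ((2 ^ k / R) *\<^sub>R (y - q)) \<noteq> 0" by blast
  have "(\<Sum>l<N. (2 ^ l / R) *\<^sub>R bump_grad ((2 ^ l / R) *\<^sub>R (y - q))) =
      (\<Sum>l\<in>{k}. (2 ^ l / R) *\<^sub>R bump_grad ((2 ^ l / R) *\<^sub>R (y - q)))"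
  proof (rule sum.mono_neutral_right)
    show "\<forall>l\<in>{..<N} - {k}. (2 ^ l / R) *\<^sub>R bump_grad ((2 ^ l / R) *\<^sub>R (y - q)) = 0"
    proof
      fix l assume "l \<in> {..<N} - {k}"
      then have "k \<noteq> l" by blast
      then have "bump_grad ((2 ^ l / R) *\<^sub>R (y - q)) = 0"
        using cascade_grad_disjoint[OF k(2)] by blast
      then show "(2 ^ l / R) *\<^sub>R bump_grad ((2 ^ l / R) *\<^sub>R (y - q)) = 0"
        by (simp only: scaleR_zero_right)
    qed
  qed (use k(1) in simp_all)
  then have "norm (cascade_grad q R N y) =
      2 ^ k / R * norm (bump_grad ((2 ^ k / R) *\<^sub>R (y - q))) / real N"
    using R by (simp add: cascade_grad_def divide_inverse del: scaleR_scaleR)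
  also have "\<dots> \<le> 2 ^ k / R * (32 / 3) / real N"
    using R by (intro divide_right_mono mult_left_mono norm_bump_grad_le) auto
  finally have "norm (cascade_grad q R N y) \<le> 32 / 3 * 2 ^ k / (R * real N)"
    by (simp add: mult_ac)
  then have "norm (cascade_grad q R N y) ^ n \<le> (32 / 3 * 2 ^ k / (R * real N)) ^ n"
    by (intro power_mono) auto
  moreover have "y \<in> cball q (R / 2 ^ k)"
  proof -
    have "\<not> R / 2 ^ k \<le> norm (y - q)" using cascade_term_outside(2) k(2) by blast
    then show ?thesis by (simp add: dist_norm norm_minus_commute)
  qed
  ultimately have "norm (cascade_grad q R N y) ^ n \<le>
      (32 / 3 * 2 ^ k / (R * real N)) ^ n * indicator (cball q (R / 2 ^ k)) y" by simp
  also have "\<dots> \<le> (\<Sum>k<N. (32 / 3 * 2 ^ k / (R * real N)) ^ n * indicator (cball q (R / 2 ^ k)) y)"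
    using k(1) R by (intro member_le_sum) auto
  finally show ?thesis .
qed

lemma cascade_grad_nonzero:
  fixes q :: "'a::euclidean_space"
  assumes "N > 0"
  obtains y where "cascade_grad q R N y \<noteq> 0"
proof -
  obtain e :: 'a where e: "e \<in> Basis" using nonempty_Basis by blast
  \<comment> \<open>A point in the middle of the outermost annulus, where only the summand \<open>k = 0\<close> varies.\<close>
  define y where "y = q + (3 / 4 * R) *\<^sub>R e"
  have z: "(2 ^ k / R) *\<^sub>R (y - q) = (2 ^ k * (3 / 4)) *\<^sub>R e" for k
    using R by (simp add: y_def)
  have "bump_grad ((2 ^ 0 / R) *\<^sub>R (y - q)) \<noteq> 0"
    unfolding z using e by (intro bump_grad_nonzero) auto
  then have 0: "bump_grad ((2 ^ 0 / R) *\<^sub>R (y - q)) \<noteq> 0" .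
  have "(\<Sum>l<N. (2 ^ l / R) *\<^sub>R bump_grad ((2 ^ l / R) *\<^sub>R (y - q))) =
      (\<Sum>l\<in>{0}. (2 ^ l / R) *\<^sub>R bump_grad ((2 ^ l / R) *\<^sub>R (y - q)))"
  proof (rule sum.mono_neutral_right)
    show "\<forall>l\<in>{..<N} - {0}. (2 ^ l / R) *\<^sub>R bump_grad ((2 ^ l / R) *\<^sub>R (y - q)) = 0"
    proof
      fix l assume "l \<in> {..<N} - {0}"
      then have "0 \<noteq> l" by blast
      then have "bump_grad ((2 ^ l / R) *\<^sub>R (y - q)) = 0"
        using cascade_grad_disjoint[OF 0] by blast
      then show "(2 ^ l / R) *\<^sub>R bump_grad ((2 ^ l / R) *\<^sub>R (y - q)) = 0"
        by (simp only: scaleR_zero_right)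
    qed
  qed (use assms in simp_all)
  then have "cascade_grad q R N y \<noteq> 0"
    using 0 assms R by (simp add: cascade_grad_def)
  then show ?thesis by (rule that)
qed

text \<open>
  Scaling invariance: the factor \<open>(2\<^sup>k)\<^sup>n\<close> of the gradient cancels against the volume of the \<open>k\<close>-th
  ball, so all summands are equal. The hypothesis \<open>n \<ge> 2\<close> gives \<open>N / N\<^sup>n \<le> 1 / N\<close>.
\<close>

lemma cascade_energy_sum:
  fixes q :: "'a::euclidean_space"
  assumes n: "n = DIM('a)" "n \<ge> 2" and N: "N > 0"
  shows "(\<Sum>k<N. ennreal ((32 / 3 * 2 ^ k / (R * real N)) ^ n) * emeasure lborel (cball q (R / 2 ^ k)))
    \<le> ennreal ((32 / 3) ^ n * unit_ball_vol (real n) / real N)"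
proof -
  have "ennreal ((32 / 3 * 2 ^ k / (R * real N)) ^ n) * emeasure lborel (cball q (R / 2 ^ k)) =
      ennreal ((32 / 3 / real N) ^ n * unit_ball_vol (real n))" for k
  proof -
    have "(32 / 3 * 2 ^ k / (R * real N)) ^ n * (unit_ball_vol (real n) * (R / 2 ^ k) ^ n) =
        (32 / 3 * 2 ^ k / (R * real N) * (R / 2 ^ k)) ^ n * unit_ball_vol (real n)"
      by (simp only: power_mult_distrib mult_ac)
    also have "32 / 3 * 2 ^ k / (R * real N) * (R / 2 ^ k) = 32 / 3 / real N"
      using R by simp
    finally show ?thesis
      using R n(1) by (simp add: emeasure_cball ennreal_mult'[symmetric])
  qed
  then have "(\<Sum>k<N. ennreal ((32 / 3 * 2 ^ k / (R * real N)) ^ n) * emeasure lborel (cball q (R / 2 ^ k)))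
      = ennreal (real N * ((32 / 3 / real N) ^ n * unit_ball_vol (real n)))"
    by (simp add: ennreal_of_nat_eq_real_of_nat ennreal_mult')
  also have "\<dots> \<le> ennreal ((32 / 3) ^ n * unit_ball_vol (real n) / real N)"
  proof (rule ennreal_leI)
    have "real N ^ 2 \<le> real N ^ n" using n(2) N by (intro power_increasing) auto
    then have "real N / real N ^ n \<le> 1 / real N"
      using N by (simp add: field_simps power2_eq_square)
    then have "real N / real N ^ n * ((32 / 3) ^ n * unit_ball_vol (real n)) \<le>
        1 / real N * ((32 / 3) ^ n * unit_ball_vol (real n))"
      by (intro mult_right_mono) auto
    then show "real N * ((32 / 3 / real N) ^ n * unit_ball_vol (real n)) \<le>
        (32 / 3) ^ n * unit_ball_vol (real n) / real N"
      by (simp add: power_divide mult_ac)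
  qed
  finally show ?thesis .
qed

end

section \<open>Test functions of small energy\<close>

context closed_riemannian_manifold
begin

text \<open>
  The functions \<open>w\<^sub>N\<close> of the introduction: they approximate the indicator of \<open>x\<close>.
\<close>

definition log_cutoff :: "('m, 'n) chart \<Rightarrow> 'm \<Rightarrow> real \<Rightarrow> nat \<Rightarrow> 'm \<Rightarrow> real" where
  "log_cutoff c x R N = lift c (cascade (snd c x) R N)"

context
  fixes c :: "('m, 'n) chart" and x :: 'm and R :: real
  assumes c: "c \<in> A" and x: "x \<in> fst c" and R: "0 < R" and ball: "cball (snd c x) R \<subseteq> coords c"
begin

lemmas cascade_facts =
  c compact_cball ball cascade_has_derivative continuous_cascade_grad cascade_support[OF R]

lemma continuous_log_cutoff: "continuous_on UNIV (log_cutoff c x R N)"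
  unfolding log_cutoff_def by (rule continuous_lift[OF cascade_facts])

lemma log_cutoff_bounds: "0 \<le> log_cutoff c x R N p" "log_cutoff c x R N p \<le> 1"
  by (auto simp: log_cutoff_def lift_def cascade_bounds[OF R])

lemma log_cutoff_tendsto: "(\<lambda>N. log_cutoff c x R N p) \<longlonglongrightarrow> indicator {x} p"
proof (cases "p \<in> fst c")
  case False
  then have "p \<noteq> x" using x by blast
  then show ?thesis using False by (simp add: log_cutoff_def lift_def)
next
  case p: True
  show ?thesis
  proof (cases "p = x")
    case True
    have "eventually (\<lambda>N. 1 = log_cutoff c x R N p) sequentially"
      using eventually_gt_at_top[of 0]
      by eventually_elim (simp add: True x log_cutoff_def lift_def cascade_center[OF R])
    then have "(\<lambda>N. log_cutoff c x R N p) \<longlonglongrightarrow> 1"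
      by (rule Lim_transform_eventually[OF tendsto_const])
    then show ?thesis using True by simp
  next
    case False
    have "snd c p \<noteq> snd c x"
      using False chart_inv_chart[OF c p] chart_inv_chart[OF c x] by force
    from cascade_tendsto_0[OF R this] show ?thesis
      using p False by (simp add: log_cutoff_def lift_def)
  qed
qed

text \<open>
  The constant depends on the elliptic structure only through its bound, as is needed for a varying
  sequence of structures.
\<close>

lemma log_cutoff_energy:
  assumes n: "CARD('n) \<ge> 2"
  shows "\<exists>C\<ge>0. \<forall>N>0. \<forall>G. bounded_elliptic_structure A g vol \<Lambda> G \<longrightarrow>
    (\<lambda>p. complex_of_real (log_cutoff c x R N p)) \<in> energy_space A g vol \<and>
    0 < energy A g vol G (\<lambda>p. complex_of_real (log_cutoff c x R N p)) \<and>
    energy A g vol G (\<lambda>p. complex_of_real (log_cutoff c x R N p)) \<le> (C / real N) powr (1 / real CARD('n))"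
proof -
  let ?n = "CARD('n)" and ?K = "cball (snd c x) R" and ?m = "normalized_volume vol"
  obtain a where a: "0 < a"
      "\<forall>y\<in>?K. \<forall>u. a * (norm u)\<^sup>2 \<le> metric_inner g c (chart_inv c y) u u"
    using metric_bounds[OF c compact_cball ball] by blast
  obtain d where d: "0 < d" "\<forall>y\<in>?K. vol_density c y \<le> d"
    using vol_density_bounds[OF c compact_cball ball] by blast
  define V where "V = measure vol UNIV"
  have V: "emeasure vol UNIV = ennreal V" "0 < V"
  proof -
    show "emeasure vol UNIV = ennreal V"
      unfolding V_def using finite_vol by (intro emeasure_eq_ennreal_measure) simp
    then show "0 < V" using vol_pos by simp
  qed
  define B where "B r l = r * d * (l / sqrt a) ^ ?n * ((32 / 3) ^ ?n * unit_ball_vol (real ?n))" for r l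
  have B0: "0 \<le> B r l" if "0 \<le> r" "1 \<le> l" for r l
    using that a(1) d(1) unfolding B_def by (intro mult_nonneg_nonneg) auto
  have int: "(\<integral>\<^sup>+p. ennreal (elliptic_covector_norm A g G
        (weak_d A (\<lambda>p. complex_of_real (log_cutoff c x R N p))) p ^ ?n) \<partial>M) \<le> ennreal (B r l / real N)"
    if N: "N > 0" and G: "bounded_elliptic_structure A g vol l G" and r: "0 \<le> r"
      and M: "sets M = sets borel" "\<And>P. (AE p in vol. P p) \<Longrightarrow> (AE p in M. P p)"
        "\<And>S. S \<in> sets borel \<Longrightarrow> emeasure M S \<le> ennreal r * emeasure vol S"
    for N G r l M
  proof -
    have l: "1 \<le> l" using G by (simp add: bounded_elliptic_structure_def ellipticity_bound_def)
    define s where "s k = (32 / 3 * 2 ^ k / (R * real N)) ^ ?n" for k :: nat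
    define Y where "Y k = cball (snd c x) (R / 2 ^ k)" for k :: nat
    have YK: "Y k \<subseteq> ?K" for k
    proof -
      have "R / 2 ^ k \<le> R / 1" using R by (intro divide_left_mono) auto
      then show ?thesis by (simp add: Y_def subset_cball)
    qed
    have "(\<integral>\<^sup>+p. ennreal (elliptic_covector_norm A g G
        (weak_d A (\<lambda>p. complex_of_real (lift c (cascade (snd c x) R N) p))) p ^ ?n) \<partial>M)
      \<le> ennreal (r * d * (l / sqrt a) ^ ?n) * (\<Sum>k\<in>{..<N}. ennreal (s k) * emeasure lborel (Y k))"
    proof (rule energy_integral_le[OF cascade_facts G a d(2)])
      show "norm (cascade_grad (snd c x) R N y) ^ ?n \<le> (\<Sum>k<N. s k * indicator (Y k) y)" for y
        unfolding s_def Y_def using n by (intro norm_cascade_grad_le[OF R]) simp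
      show "0 \<le> s k" for k using R by (simp add: s_def)
    qed (use YK M r in \<open>auto simp: Y_def\<close>)
    also have "\<dots> \<le> ennreal (r * d * (l / sqrt a) ^ ?n) *
        ennreal ((32 / 3) ^ ?n * unit_ball_vol (real ?n) / real N)"
      unfolding s_def Y_def
      using n N by (intro mult_left_mono cascade_energy_sum[OF R]) auto
    also have "\<dots> = ennreal (B r l / real N)"
      using r d(1) l a(1) by (subst ennreal_mult[symmetric]) (auto simp: B_def)
    finally show ?thesis by (simp add: log_cutoff_def)
  qed
  have m_le: "emeasure ?m S \<le> ennreal (1 / V) * emeasure vol S" if "S \<in> sets borel" for S
    using V that by (simp add: emeasure_normalized divide_ennreal_def inverse_ennreal
        mult.commute inverse_eq_divide)
  have space: "(\<lambda>p. complex_of_real (log_cutoff c x R N p)) \<in> energy_space A g vol" if N: "N > 0" for N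
  proof -
    let ?v = "\<lambda>p. complex_of_real (log_cutoff c x R N p)"
    have cont: "continuous_on UNIV ?v"
      by (intro continuous_on_of_real continuous_log_cutoff)
    have "?v \<in> borel_measurable vol"
      using borel_measurable_continuous_onI[OF cont] measurable_cong_sets[OF sets_vol refl] by blast
    then have "?v \<in> borel_measurable (completion vol)" by (rule measurable_completion)
    moreover have "(\<integral>\<^sup>+p. ennreal (norm (?v p) ^ ?n) \<partial>vol) < \<infinity>"
    proof -
      have "(\<integral>\<^sup>+p. ennreal (norm (?v p) ^ ?n) \<partial>vol) \<le> (\<integral>\<^sup>+p. 1 \<partial>vol)"
        using log_cutoff_bounds by (intro nn_integral_mono) (simp add: power_le_one)
      also have "\<dots> < \<infinity>" using finite_vol by (simp add: space_vol)
      finally show ?thesis .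
    qed
    moreover have "C1_function ?v"
      unfolding log_cutoff_def by (rule C1_function_lift[OF cascade_facts])
    then have "\<exists>\<omega>. weak_differential A ?v \<omega>" using weak_differential_chart_d by blast
    moreover have "(\<integral>\<^sup>+p. ennreal (covector_norm A g (weak_d A ?v) p ^ ?n) \<partial>vol) < \<infinity>"
    proof -
      have "(\<integral>\<^sup>+p. ennreal (covector_norm A g (weak_d A ?v) p ^ ?n) \<partial>vol) \<le> ennreal (B 1 1 / real N)"
        unfolding covector_norm_eq_elliptic
        by (rule int[OF N bounded_elliptic_identity]) (auto simp: sets_vol)
      then show ?thesis using le_less_trans by fastforce
    qed
    ultimately show ?thesis using cont by (simp add: energy_space_def sobolev_W1n_def)
  qed
  have bounds: "0 < energy A g vol G (\<lambda>p. complex_of_real (log_cutoff c x R N p)) \<and>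
    energy A g vol G (\<lambda>p. complex_of_real (log_cutoff c x R N p)) \<le> (B (1 / V) \<Lambda> / real N) powr (1 / real ?n)"
    if N: "N > 0" and G: "bounded_elliptic_structure A g vol \<Lambda> G" for N G
  proof -
    let ?I = "\<integral>\<^sup>+p. ennreal (elliptic_covector_norm A g G
        (weak_d A (\<lambda>p. complex_of_real (log_cutoff c x R N p))) p ^ ?n) \<partial>?m"
    have \<Lambda>: "1 \<le> \<Lambda>" using G by (simp add: bounded_elliptic_structure_def ellipticity_bound_def)
    have le: "?I \<le> ennreal (B (1 / V) \<Lambda> / real N)"
      using V(2) by (intro int[OF N G]) (auto simp: sets_normalized m_le intro: AE_normalized)
    obtain y where y: "cascade_grad (snd c x) R N y \<noteq> 0" using cascade_grad_nonzero[OF R N] .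
    have pos: "0 < ?I"
      unfolding log_cutoff_def by (rule energy_integral_pos[OF cascade_facts G y])
    have "0 < enn2real ?I"
      using pos le by (simp add: enn2real_positive_iff le_less_trans[OF _ ennreal_less_top])
    moreover have "enn2real ?I \<le> B (1 / V) \<Lambda> / real N"
      using le B0[of "1 / V" \<Lambda>] V(2) \<Lambda> by (intro enn2real_leI) auto
    ultimately show ?thesis
      unfolding energy_def by (auto intro!: powr_mono2)
  qed
  show ?thesis
  proof (cases "\<Lambda> \<ge> 1")
    case True
    then show ?thesis
      using B0[of "1 / V" \<Lambda>] V(2) space bounds by (intro exI[of _ "B (1 / V) \<Lambda>"]) auto
  next
    case False
    then show ?thesis
      by (intro exI[of _ 0]) (auto simp: bounded_elliptic_structure_def ellipticity_bound_def)
  qed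
qed

end

end

section \<open>Oscillation and weak convergence\<close>

definition oscillation :: "'a measure \<Rightarrow> ('a \<Rightarrow> real) \<Rightarrow> real" where
  "oscillation \<nu> w = (LINT p|\<nu>. \<bar>w p - (LINT q|\<nu>. w q)\<bar>)"

lemma integrable_continuous_bounded:
  fixes w :: "'m::topological_space \<Rightarrow> real"
  assumes \<nu>: "borel_prob \<nu>" and w: "continuous_on UNIV w" "\<And>p. \<bar>w p\<bar> \<le> b"
  shows "integrable \<nu> w"
proof -
  interpret prob_space \<nu> using \<nu> by (simp add: borel_prob_def)
  have "sets \<nu> = sets borel" using \<nu> by (simp add: borel_prob_def)
  from measurable_cong_sets[OF this refl] have "w \<in> borel_measurable \<nu>"
    using borel_measurable_continuous_onI[OF w(1)] by blast
  then show ?thesis using w(2) by (intro integrable_const_bound[of _ b]) auto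
qed

text \<open>
  Replacing the mean with respect to \<open>\<mu>\<^sub>j\<close> by the mean with respect to \<open>\<nu>\<close> changes the oscillation by at
  most the difference of the means, which tends to zero. After that the integrand is a fixed bounded
  continuous function.
\<close>

lemma oscillation_tendsto:
  fixes w :: "'m::topological_space \<Rightarrow> real"
  assumes \<mu>: "\<And>j. borel_prob (\<mu> j)" and \<nu>: "borel_prob \<nu>" and conv: "weakly_converges \<mu> \<nu>"
    and w: "continuous_on UNIV w" "\<And>p. \<bar>w p\<bar> \<le> b"
  shows "(\<lambda>j. oscillation (\<mu> j) w) \<longlonglongrightarrow> oscillation \<nu> w"
proof -
  define \<beta> where "\<beta> = (LINT q|\<nu>. w q)"
  define \<beta>j where "\<beta>j j = (LINT q|\<mu> j. w q)" for j
  let ?u = "\<lambda>p. \<bar>w p - \<beta>\<bar>"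
  have u: "continuous_on UNIV ?u" by (intro continuous_intros w)
  have ub: "\<bar>?u p\<bar> \<le> b + \<bar>\<beta>\<bar>" for p using w(2)[of p] by simp
  have "\<beta>j \<longlonglongrightarrow> \<beta>"
  proof -
    have "bounded (range w)"
      unfolding bounded_iff using w(2) by (intro exI[of _ b]) simp
    then show ?thesis
      using conv w(1) unfolding weakly_converges_def \<beta>_def \<beta>j_def[abs_def] by blast
  qed
  then have lim0: "(\<lambda>j. \<bar>\<beta>j j - \<beta>\<bar>) \<longlonglongrightarrow> 0"
    by (intro tendsto_rabs_zero) (simp add: LIM_zero_iff)
  have diff: "\<bar>oscillation (\<mu> j) w - (LINT p|\<mu> j. ?u p)\<bar> \<le> \<bar>\<beta>j j - \<beta>\<bar>" for j
  proof -
    interpret prob_space "\<mu> j" using \<mu>[of j] by (simp add: borel_prob_def)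
    have iu: "integrable (\<mu> j) ?u" by (rule integrable_continuous_bounded[OF \<mu> u ub])
    have iw: "integrable (\<mu> j) (\<lambda>p. \<bar>w p - \<beta>j j\<bar>)"
    proof (rule integrable_continuous_bounded[OF \<mu>])
      show "continuous_on UNIV (\<lambda>p. \<bar>w p - \<beta>j j\<bar>)" by (intro continuous_intros w)
      show "\<bar>\<bar>w p - \<beta>j j\<bar>\<bar> \<le> b + \<bar>\<beta>j j\<bar>" for p using w(2)[of p] by simp
    qed
    have "oscillation (\<mu> j) w - (LINT p|\<mu> j. ?u p) = (LINT p|\<mu> j. \<bar>w p - \<beta>j j\<bar> - ?u p)"
      unfolding oscillation_def \<beta>j_def[symmetric] using iw iu by simp
    also have "\<bar>\<dots>\<bar> \<le> (LINT p|\<mu> j. \<bar>\<bar>w p - \<beta>j j\<bar> - ?u p\<bar>)"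
      by (rule integral_abs_bound)
    also have "\<dots> \<le> (LINT p|\<mu> j. \<bar>\<beta>j j - \<beta>\<bar>)"
      using iw iu by (intro integral_mono) auto
    also have "\<dots> = \<bar>\<beta>j j - \<beta>\<bar>" by (simp add: prob_space)
    finally show ?thesis .
  qed
  have "(\<lambda>j. oscillation (\<mu> j) w - (LINT p|\<mu> j. ?u p)) \<longlonglongrightarrow> 0"
  proof (rule Lim_null_comparison[OF always_eventually lim0], rule allI)
    show "norm (oscillation (\<mu> j) w - (LINT p|\<mu> j. ?u p)) \<le> \<bar>\<beta>j j - \<beta>\<bar>" for j
      unfolding real_norm_def by (rule diff)
  qed
  moreover have "(\<lambda>j. LINT p|\<mu> j. ?u p) \<longlonglongrightarrow> (LINT p|\<nu>. ?u p)"
  proof -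
    have "bounded (range ?u)"
      unfolding bounded_iff using ub by (intro exI[of _ "b + \<bar>\<beta>\<bar>"]) simp
    then show ?thesis using conv u unfolding weakly_converges_def by blast
  qed
  ultimately have "(\<lambda>j. (oscillation (\<mu> j) w - (LINT p|\<mu> j. ?u p)) + (LINT p|\<mu> j. ?u p))
      \<longlonglongrightarrow> 0 + (LINT p|\<nu>. ?u p)"
    by (rule tendsto_add)
  then show ?thesis by (simp add: oscillation_def \<beta>_def)
qed

text \<open>
  The limit is the mean deviation of the indicator of a set of measure \<open>\<alpha>\<close>.
\<close>

lemma oscillation_atom_limit:
  fixes w :: "nat \<Rightarrow> 'm::t2_space \<Rightarrow> real"
  assumes \<nu>: "borel_prob \<nu>"
    and w: "\<And>N. continuous_on UNIV (w N)" "\<And>N p. 0 \<le> w N p" "\<And>N p. w N p \<le> 1"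
    and lim: "\<And>p. (\<lambda>N. w N p) \<longlonglongrightarrow> indicator {x} p"
  shows "(\<lambda>N. oscillation \<nu> (w N)) \<longlonglongrightarrow> 2 * measure \<nu> {x} * (1 - measure \<nu> {x})"
proof -
  interpret prob_space \<nu> using \<nu> by (simp add: borel_prob_def)
  have sets: "sets \<nu> = sets borel" using \<nu> by (simp add: borel_prob_def)
  have x [measurable]: "{x} \<in> sets \<nu>" by (simp add: sets)
  have [measurable]: "w N \<in> borel_measurable \<nu>" for N
    using borel_measurable_continuous_onI[OF w(1)[of N]] measurable_cong_sets[OF sets refl] by blast
  define \<alpha> where "\<alpha> = measure \<nu> {x}"
  have wabs: "\<bar>w N p\<bar> \<le> 1" for N p using w(2,3)[of N p] by simp
  have int: "integrable \<nu> (w N)" for N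
    by (rule integrable_continuous_bounded[OF \<nu> w(1) wabs])
  have mean: "0 \<le> (LINT q|\<nu>. w N q)" "(LINT q|\<nu>. w N q) \<le> 1" for N
    using Bochner_Integration.integral_nonneg[of \<nu> "w N"] integral_mono[OF int[of N] integrable_const[of 1]] w(2,3)
    by (auto simp: prob_space)
  have lim_mean: "(\<lambda>N. LINT q|\<nu>. w N q) \<longlonglongrightarrow> \<alpha>"
  proof -
    have "(\<lambda>N. LINT q|\<nu>. w N q) \<longlonglongrightarrow> (LINT q|\<nu>. indicator {x} q)"
      by (rule integral_dominated_convergence[where w = "\<lambda>_. 1"]) (use lim wabs in auto)
    then show ?thesis using sets_eq_imp_space_eq[OF sets] by (simp add: \<alpha>_def)
  qed
  have "(\<lambda>N. LINT p|\<nu>. \<bar>w N p - (LINT q|\<nu>. w N q)\<bar>) \<longlonglongrightarrow> (LINT p|\<nu>. \<bar>indicator {x} p - \<alpha>\<bar>)"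
  proof (rule integral_dominated_convergence[where w = "\<lambda>_. 1"])
    show "AE p in \<nu>. (\<lambda>N. \<bar>w N p - (LINT q|\<nu>. w N q)\<bar>) \<longlonglongrightarrow> \<bar>indicator {x} p - \<alpha>\<bar>"
      by (intro AE_I2 tendsto_intros lim lim_mean)
    show "AE p in \<nu>. norm \<bar>w N p - (LINT q|\<nu>. w N q)\<bar> \<le> 1" for N
    proof (rule AE_I2)
      fix p
      show "norm \<bar>w N p - (LINT q|\<nu>. w N q)\<bar> \<le> 1"
        using w(2,3)[of N p] mean[of N] by (simp add: abs_le_iff)
    qed
  qed auto
  moreover have "(LINT p|\<nu>. \<bar>indicator {x} p - \<alpha>\<bar>) = 2 * \<alpha> * (1 - \<alpha>)"
  proof -
    have \<alpha>: "0 \<le> \<alpha>" "\<alpha> \<le> 1" by (simp_all add: \<alpha>_def)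
    \<comment> \<open>The integrand is \<open>1 - \<alpha>\<close> at \<open>x\<close> and \<open>\<alpha>\<close> elsewhere.\<close>
    then have "(LINT p|\<nu>. \<bar>indicator {x} p - \<alpha>\<bar>) = (LINT p|\<nu>. \<alpha> + (1 - 2 * \<alpha>) * indicator {x} p)"
      by (intro Bochner_Integration.integral_cong) (auto simp: indicator_def)
    also have "\<dots> = \<alpha> + (1 - 2 * \<alpha>) * \<alpha>"
    proof -
      have "integrable \<nu> (\<lambda>p. indicator {x} p :: real)" by (simp add: integrable_indicator_iff emeasure_eq_measure)
      then show ?thesis
        using prob_space sets_eq_imp_space_eq[OF sets] by (simp add: \<alpha>_def)
    qed
    finally show ?thesis by (simp add: algebra_simps)
  qed
  ultimately show ?thesis by (simp add: oscillation_def \<alpha>_def)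
qed

lemma norm_deviation_of_real:
  "(LINT p|\<nu>. norm (complex_of_real (w p) - (LINT q|\<nu>. complex_of_real (w q)))) = oscillation \<nu> w"
  unfolding oscillation_def
  by (simp only: integral_complex_of_real of_real_diff[symmetric] norm_of_real)

section \<open>Blow-up of the constants\<close>

theorem proposition6p5:
  fixes A :: "('m::{t2_space, second_countable_topology}, 'n::finite) chart set"
    and g :: "('m, 'n) chart \<Rightarrow> 'm \<Rightarrow> real ^ 'n ^ 'n"
    and vol :: "'m measure"
    and \<mu> :: "nat \<Rightarrow> 'm measure"
    and \<nu> :: "'m measure"
    and G :: "nat \<Rightarrow> ('m, 'n) chart \<Rightarrow> 'm \<Rightarrow> real ^ 'n ^ 'n"
    and \<Lambda> :: real
  assumes "CARD('n) \<ge> 2"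
    and "closed_connected_oriented_riemannian_manifold A g"
    and "riemannian_volume A g vol"
    and "\<And>j. borel_prob (\<mu> j)"
    and "borel_prob \<nu>"
    and "weakly_converges \<mu> \<nu>"
    and "\<And>j. bounded_elliptic_structure A g vol \<Lambda> (G j)"
    and "\<exists>x. 0 < measure \<nu> {x} \<and> measure \<nu> {x} < 1"
  shows "(\<lambda>j. A_const A g vol (G j) (\<mu> j)) \<longlonglongrightarrow> \<infinity>"
proof -
  interpret closed_riemannian_manifold A g vol
    using assms(2,3) by unfold_locales
  obtain x where x: "0 < measure \<nu> {x}" "measure \<nu> {x} < 1" using assms(8) by blast
  obtain c where c: "c \<in> A" "x \<in> fst c" using chart_exists by blast
  obtain R where R: "0 < R" "cball (snd c x) R \<subseteq> coords c" using cball_in_chart[OF c] .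
  let ?w = "log_cutoff c x R"
  let ?v = "\<lambda>N p. complex_of_real (?w N p)"
  \<comment> \<open>Half of the limiting oscillation, to be exceeded strictly by one fixed cutoff function.\<close>
  define \<tau> where "\<tau> = measure \<nu> {x} * (1 - measure \<nu> {x})"
  have \<tau>: "0 < \<tau>" using x by (simp add: \<tau>_def)
  obtain C where C: "0 \<le> C" "\<And>N j. N > 0 \<Longrightarrow> ?v N \<in> energy_space A g vol \<and>
      0 < energy A g vol (G j) (?v N) \<and>
      energy A g vol (G j) (?v N) \<le> (C / real N) powr (1 / real CARD('n))"
    using log_cutoff_energy[OF c R assms(1)] assms(7) by metis
  have wabs: "\<bar>?w N p\<bar> \<le> 1" for N p
    using log_cutoff_bounds[OF c R] by simp
  show ?thesis
    unfolding infinity_ennreal_def tendsto_top_iff_ennreal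
  proof (intro allI impI)
    fix l :: real assume l: "0 \<le> l"
    have "(\<lambda>N. oscillation \<nu> (?w N)) \<longlonglongrightarrow> 2 * measure \<nu> {x} * (1 - measure \<nu> {x})"
      by (rule oscillation_atom_limit[OF assms(5) continuous_log_cutoff[OF c R]
            log_cutoff_bounds[OF c R] log_cutoff_tendsto[OF c R]])
    moreover have "\<tau> < 2 * measure \<nu> {x} * (1 - measure \<nu> {x})" using \<tau> by (simp add: \<tau>_def)
    ultimately have "\<forall>\<^sub>F N in sequentially. \<tau> < oscillation \<nu> (?w N)" by (rule order_tendstoD)
    moreover have "(\<lambda>N. (C / real N) powr (1 / real CARD('n))) \<longlonglongrightarrow> 0 powr (1 / real CARD('n))"
      using C(1) lim_const_over_n[of C] by (intro tendsto_powr2) auto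
    then have "\<forall>\<^sub>F N in sequentially. (C / real N) powr (1 / real CARD('n)) < \<tau> / (l + 1)"
      using \<tau> l by (intro order_tendstoD) auto
    ultimately have "\<forall>\<^sub>F N in sequentially. 0 < N \<and> \<tau> < oscillation \<nu> (?w N) \<and>
        (C / real N) powr (1 / real CARD('n)) < \<tau> / (l + 1)"
      using eventually_gt_at_top[of 0] by eventually_elim simp
    then obtain N where N: "0 < N" "\<tau> < oscillation \<nu> (?w N)"
        "(C / real N) powr (1 / real CARD('n)) < \<tau> / (l + 1)"
      unfolding eventually_sequentially by blast
    have "(\<lambda>j. oscillation (\<mu> j) (?w N)) \<longlonglongrightarrow> oscillation \<nu> (?w N)"
      by (rule oscillation_tendsto[OF assms(4,5,6) continuous_log_cutoff[OF c R] wabs])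
    then have "\<forall>\<^sub>F j in sequentially. \<tau> < oscillation (\<mu> j) (?w N)"
      using N(2) by (rule order_tendstoD)
    then show "\<forall>\<^sub>F j in sequentially. ennreal l < A_const A g vol (G j) (\<mu> j)"
    proof eventually_elim
      case (elim j)
      let ?E = "energy A g vol (G j) (?v N)"
      have E: "?v N \<in> energy_space A g vol" "0 < ?E" "?E < \<tau> / (l + 1)"
        using C(2)[OF N(1), of j] N(3) by auto
      have "?E * (l + 1) < \<tau>" using E(3) l by (simp add: pos_less_divide_eq)
      then have "?E * (l + 1) < oscillation (\<mu> j) (?w N)" using elim by linarith
      then have "l + 1 < oscillation (\<mu> j) (?w N) / ?E"
        using E(2) by (simp add: pos_less_divide_eq mult.commute)
      then have "ennreal l < ennreal (oscillation (\<mu> j) (?w N) / ?E)"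
        using l by (intro ennreal_lessI) auto
      also have "\<dots> = ennreal ((LINT p|\<mu> j. norm (?v N p - (LINT q|\<mu> j. ?v N q))) / ?E)"
        by (simp only: norm_deviation_of_real)
      also have "\<dots> \<le> A_const A g vol (G j) (\<mu> j)"
        unfolding A_const_def using E(1,2) by (intro SUP_upper2[of "?v N"]) auto
      finally show ?case .
    qed
  qed
qed

end
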